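(* Let $n\ge2$, let $I\subset\mathbb{R}$ be measurable, and let $k_1,\dots,k_n$ be bounded measurable functions on $I\times\mathbb{R}^+$ such that the operators $(K_if)(\lambda)=\int_{\mathbb{R}^+}k_i(\lambda,x)f(x)\,dx$ satisfy $\|K_if\|_{L^2(I)}\le C_i\|f\|_{L^2(\mathbb{R}^+)}$ on functions of compact support. Let $A$ be any set of ordered pairs $\alpha=(i_\alpha,i'_\alpha)$ with $1\le i_\alpha,i'_\alpha\le n$, let $T_n^{D_1,\dots,D_n}$ be the associated truncated multilinear operators defined in the context, and let \[ M_T(f_1,\dots,f_n)(\lambda)=\sup_{D_1,\dots,D_n}\left|T_n^{D_1,\dots,D_n}(f_1,\dots,f_n)(\lambda)\right|. \] Then for any $1\le p<2$ there is a constant $C_n$ such that for all $f_i\in L^p(\mathbb{R}^+)$, $i=1,\dots,n$, \[ \|M_T(f_1,\dots,f_n)\|_{L^{s_n}(I,d\lambda)}\le C_n\prod_{i=1}^{n}\|f_i\|_p, \] where $s_n^{-1}=nq^{-1}$ and $q^{-1}+p^{-1}=1$.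
   Context: $\mathbb{R}^+=(0,\infty)$ and $\chi_E$ is the characteristic function of $E$. For $D_1,\dots,D_n\in(0,\infty)$, \[ T_n^{D_1,\dots,D_n}(f_1,\dots,f_n)(\lambda)=\int_{(\mathbb{R}^+)^n}\prod_{j=1}^{n}f_j(x_j)\,k_j(\lambda,x_j)\,\chi_{\mathbb{R}^+}(D_j-x_j)\prod_{\alpha\in A}\chi_{\mathbb{R}^+}(x_{i_\alpha}-x_{i'_\alpha})\,dx_1\cdots dx_n. \] The supremum defining $M_T$ is over all $D_1,\dots,D_n\in(0,\infty)$. Here $s_n<1$ is allowed, with $\|g\|_s=(\int|g|^s)^{1/s}$ also for $0<s<1$. *)

theory Defs
  imports "HOL-Analysis.Analysis" "HOL-Probability.Essential_Supremum"
begin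

(* x to the power a for extended nonnegative x; meant for a > 0 only. *)
definition ennpowr :: "ennreal \<Rightarrow> real \<Rightarrow> ennreal" where
  "ennpowr x a = (if x = \<infinity> then \<infinity> else ennreal (enn2real x powr a))"

(* The L^s (quasi-)norm of a nonnegative extended function for 0 < s <= \<infinity>; for s < 1 it is
   not a norm.  As for esssup, a non-measurable function gets the value \<infinity>, so that a finite
   bound on Lnorm includes measurability (nn_integral alone would be a lower integral). *)
definition Lnorm :: "'a measure \<Rightarrow> ennreal \<Rightarrow> ('a \<Rightarrow> ennreal) \<Rightarrow> ennreal" where
  "Lnorm M s g =
     (if g \<notin> borel_measurable M then \<infinity>
      else if s = \<infinity> then esssup M g
      else ennpowr (\<integral>\<^sup>+ x. ennpowr (g x) (enn2real s) \<partial>M) (1 / enn2real s))"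

definition Lnormc :: "'a measure \<Rightarrow> ennreal \<Rightarrow> ('a \<Rightarrow> complex) \<Rightarrow> ennreal" where
  "Lnormc M s f = Lnorm M s (\<lambda>x. ennreal (norm (f x)))"

definition Lspace :: "'a measure \<Rightarrow> ennreal \<Rightarrow> ('a \<Rightarrow> complex) set" where
  "Lspace M s = {f \<in> borel_measurable M. Lnormc M s f < \<infinity>}"

abbreviation leb_pos :: "real measure" where
  "leb_pos \<equiv> lebesgue_on {0<..}"

definition kernel_op :: "(real \<Rightarrow> real \<Rightarrow> complex) \<Rightarrow> (real \<Rightarrow> complex) \<Rightarrow> real \<Rightarrow> complex" where
  "kernel_op k f lam = (\<integral>x. k lam x * f x \<partial>leb_pos)"

(* Support in the open half-line; the values of f outside it play no role. *)
definition compactly_supported :: "(real \<Rightarrow> complex) \<Rightarrow> bool" where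
  "compactly_supported f \<longleftrightarrow>
     (\<exists>S. compact S \<and> S \<subseteq> {0<..} \<and> (\<forall>x\<in>{0<..} - S. f x = 0))"

(* Points of the n-fold product of the half-line are functions on {1..n}, with the product of
   the one-dimensional Lebesgue measures. *)
definition trunc_op ::
  "nat \<Rightarrow> (nat \<Rightarrow> real \<Rightarrow> real \<Rightarrow> complex) \<Rightarrow> (nat \<times> nat) set \<Rightarrow> (nat \<Rightarrow> real)
     \<Rightarrow> (nat \<Rightarrow> real \<Rightarrow> complex) \<Rightarrow> real \<Rightarrow> complex" where
  "trunc_op n k A D f lam =
     (\<integral>x. (\<Prod>j=1..n. f j (x j) * k j lam (x j) * indicator {0<..} (D j - x j)) *
          (\<Prod>\<alpha>\<in>A. indicator {0<..} (x (fst \<alpha>) - x (snd \<alpha>)))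
      \<partial>(\<Pi>\<^sub>M j\<in>{1..n}. leb_pos))"

definition max_op ::
  "nat \<Rightarrow> (nat \<Rightarrow> real \<Rightarrow> real \<Rightarrow> complex) \<Rightarrow> (nat \<times> nat) set
     \<Rightarrow> (nat \<Rightarrow> real \<Rightarrow> complex) \<Rightarrow> real \<Rightarrow> ennreal" where
  "max_op n k A f lam =
     (SUP D\<in>{D. \<forall>j\<in>{1..n}. 0 < D j}. ennreal (norm (trunc_op n k A D f lam)))"

end

theory Submission
  imports Defs
begin

text \<open>For a fixed \<open>\<lambda>\<close> the truncated operator is a sum of iterated integrals of the paths
  \<open>X\<^sub>j t = \<integral> k\<^sub>j(\<lambda>, x) f\<^sub>j(x) dx\<close> over \<open>0 < x < t\<close>. If the increments of each path are bounded by
  \<open>c\<^sub>j \<omega>(s, t)\<^sup>\<kappa>\<close> with a superadditive \<open>\<omega>\<close> and \<open>\<kappa> > 1/2\<close>, Young integration bounds all these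
  iterated integrals by a multiple of \<open>c\<^sub>1 \<cdots> c\<^sub>n\<close>. Stopping a path at \<open>D\<^sub>j\<close> does not
  increase its increments, so the bound is uniform in \<open>D\<close>. To find \<open>c\<^sub>j(\<lambda>)\<close> in \<open>L\<^sup>q\<close>, run the
  path by the clock \<open>\<integral> |f\<^sub>j|\<^sup>p\<close> and chain along dyadic intervals (Kolmogorov's argument in variation
  form); the moments of the increments come from \<open>L\<^sup>p \<rightarrow> L\<^sup>q\<close> boundedness of \<open>K\<^sub>j\<close>, obtained by real
  interpolation. Here \<open>p < 2\<close> leaves room for an exponent \<open>\<kappa>\<close> strictly between \<open>1/2\<close> and \<open>1/p\<close>.
  Hoelder's inequality then gives the exponent \<open>q / n\<close>.\<close>

section \<open>Controls and Young's inequality\<close>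

text \<open>Any \<open>A\<close> can be treated alike because the induction always splits off the
  largest variable: off the null set of ties, the domain is cut according to which coordinate is
  largest, and that coordinate becomes the upper limit of the remaining integral. For p > 1 the
  functions need not be integrable, so the final bound may not involve the L1 mass of the
  integrands. Young's inequality sees only increments of paths, and the normalisation \<omega> \<le>
  1 gives its output the same form as its input. It forces \<kappa> > 1/2, while the moments of the
  increments allow \<kappa> < 1/p; the choice is the midpoint, and the surplus q (1/p - \<kappa>) =
  (q - 2)/4 is the rate at which the dyadic levels decay. For p = 1 one has q = \<infinity>, and a
  bound by absolute values is enough. A separate obstacle is measurability: the kernels are
  measurable for planar Lebesgue measure, not for a product sigma-algebra, and the supremum is
  uncountable. Borel versions of the kernels and rational truncations deal with this, and
  completeness carries the result back.\<close>

lemma dyadic_powr_sum_le: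
  fixes T e \<tau> :: real
  assumes "0 < T" "0 < e" "0 \<le> \<tau>"
  shows "(\<Sum>i<n. if T / 2^i \<le> \<tau> then (T / 2^i) powr e else 0)
           \<le> min \<tau> T powr e / (1 - 2 powr - e)"
  using assms(1)
proof (induction n arbitrary: T)
  case 0
  have "2 powr - e < (2::real) powr 0" using assms by (intro powr_less_mono) auto
  then show ?case by simp
next
  case (Suc n)
  define r where "r = 2 powr - e"
  have "2 powr - e < (2::real) powr 0" using assms by (intro powr_less_mono) auto
  then have r: "0 < r" "r < 1" by (auto simp: r_def)
  have half: "(T / 2) powr e = T powr e * r"
    using Suc.prems unfolding r_def powr_minus by (simp add: powr_divide field_simps)
  have IH: "(\<Sum>i<n. if T / 2 / 2^i \<le> \<tau> then (T / 2 / 2^i) powr e else 0)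
      \<le> min \<tau> (T / 2) powr e / (1 - r)"
    using Suc.IH[of "T / 2"] Suc.prems by (simp add: r_def)
  \<comment> \<open>After its first term the sum is the same sum started at \<open>T / 2\<close>. If
    the first term is counted, the identity 1 + r/(1 - r) = 1/(1 - r) closes the induction; if not,
    only the minimum grows.\<close>
  have split: "(\<Sum>i<Suc n. if T / 2^i \<le> \<tau> then (T / 2^i) powr e else 0)
     = (if T \<le> \<tau> then T powr e else 0) + (\<Sum>i<n. if T / 2 / 2^i \<le> \<tau> then (T / 2 / 2^i) powr e else 0)"
    unfolding sum.lessThan_Suc_shift power_Suc divide_divide_eq_left[symmetric] by simp
  show ?case
  proof (cases "T \<le> \<tau>")
    case True
    have "T powr e + T powr e * r / (1 - r) = T powr e / (1 - r)"
      using r by (simp add: field_simps)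
    moreover have "min \<tau> (T / 2) = T / 2" "min \<tau> T = T" using True Suc.prems by auto
    ultimately show ?thesis using IH half True unfolding split r_def[symmetric] by simp
  next
    case False
    have "min \<tau> (T / 2) powr e / (1 - r) \<le> min \<tau> T powr e / (1 - r)"
      using r assms Suc.prems by (intro divide_right_mono powr_mono2) auto
    with False IH show ?thesis unfolding split r_def[symmetric] by simp
  qed
qed

lemma sum_lessThan_add:
  fixes h :: "nat \<Rightarrow> 'a::comm_monoid_add"
  shows "(\<Sum>j<a + b. h j) = (\<Sum>j<a. h j) + (\<Sum>j<b. h (a + j))"
  by (induction b) (auto simp: add_ac)

text \<open>Controls in the sense of rough paths, with two normalisations: \<omega> \<le> 1 makes
  \<omega>^(2\<kappa>) \<le> \<omega>^\<kappa>, so that second-order errors can be absorbed, and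
  2\<kappa> > 1 makes Young's series converge.\<close>

locale control =
  fixes \<omega> :: "real \<Rightarrow> real \<Rightarrow> real" and \<kappa> :: real
  assumes nonneg: "0 \<le> s \<Longrightarrow> s \<le> t \<Longrightarrow> 0 \<le> \<omega> s t"
    and super: "0 \<le> s \<Longrightarrow> s \<le> u \<Longrightarrow> u \<le> t \<Longrightarrow> \<omega> s u + \<omega> u t \<le> \<omega> s t"
    and le_1: "0 \<le> s \<Longrightarrow> s \<le> t \<Longrightarrow> \<omega> s t \<le> 1"
    and kappa: "1 / 2 < \<kappa>"
begin

lemma mono: "0 \<le> s \<Longrightarrow> s \<le> s' \<Longrightarrow> s' \<le> t' \<Longrightarrow> t' \<le> t \<Longrightarrow> \<omega> s' t' \<le> \<omega> s t"
  using super[of s s' t] super[of s' t' t] nonneg[of s s'] nonneg[of t' t] by linarith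

text \<open>This is 2^(2\<kappa>) \<zeta>(2\<kappa>). The term of index \<open>k\<close> is the cost
  of deleting one of \<open>Suc k\<close> interior partition points.\<close>

definition young_const :: real where
  "young_const = (\<Sum>k. (2 / real (Suc k)) powr (2 * \<kappa>))"

lemma young_summable: "summable (\<lambda>k. (2 / real (Suc k)) powr (2 * \<kappa>))"
proof -
  have "summable (\<lambda>k. real (k + 1) powr (- (2 * \<kappa>)))"
    using kappa by (subst summable_iff_shift) (simp add: summable_real_powr_iff)
  then have "summable (\<lambda>k. 2 powr (2 * \<kappa>) * real (Suc k) powr (- (2 * \<kappa>)))"
    by (intro summable_mult) simp
  also have "(\<lambda>k. 2 powr (2 * \<kappa>) * real (Suc k) powr (- (2 * \<kappa>))) =
      (\<lambda>k. (2 / real (Suc k)) powr (2 * \<kappa>))"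
    by (intro ext) (simp only: powr_divide powr_minus divide_inverse powr_mult inverse_powr)
  finally show ?thesis .
qed

lemma young_const_ge: "(\<Sum>k<n. (2 / real (Suc k)) powr (2 * \<kappa>)) \<le> young_const"
  unfolding young_const_def by (intro sum_le_suminf young_summable) auto

lemma young_const_nonneg: "0 \<le> young_const"
  using young_const_ge[of 0] by simp

lemma sum_le_control:
  assumes "\<And>i. i < n \<Longrightarrow> t i \<le> t (Suc i)" "0 \<le> t 0"
  shows "(\<Sum>i<n. \<omega> (t i) (t (Suc i))) \<le> \<omega> (t 0) (t n) \<and> t 0 \<le> t n"
  using assms
proof (induction n)
  case 0
  then show ?case using nonneg[of "t 0" "t 0"] by simp
next
  case (Suc n)
  then have "(\<Sum>i<n. \<omega> (t i) (t (Suc i))) \<le> \<omega> (t 0) (t n)" "t 0 \<le> t n" by auto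
  then show ?case using super[of "t 0" "t n" "t (Suc n)"] Suc.prems(1)[of n] Suc.prems(2) by simp
qed

text \<open>Young's argument: delete partition points one at a time, always choosing one at which
  the control of the two adjacent intervals is at most average.\<close>

lemma young_discrete:
  fixes F G :: "real \<Rightarrow> 'a::real_normed_algebra"
  assumes F: "\<And>u v. 0 \<le> u \<Longrightarrow> u \<le> v \<Longrightarrow> norm (F v - F u) \<le> a * \<omega> u v powr \<kappa>"
    and G: "\<And>u v. 0 \<le> u \<Longrightarrow> u \<le> v \<Longrightarrow> norm (G v - G u) \<le> b * \<omega> u v powr \<kappa>"
    and ab: "0 \<le> a" "0 \<le> b"
    and "\<And>i. i \<le> M \<Longrightarrow> t i \<le> t (Suc i)" "0 \<le> t 0"
  shows "norm ((\<Sum>i<Suc M. F (t i) * (G (t (Suc i)) - G (t i))) - F (t 0) * (G (t (Suc M)) - G (t 0)))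
     \<le> a * b * (\<Sum>k<M. (2 / real (Suc k)) powr (2 * \<kappa>)) * \<omega> (t 0) (t (Suc M)) powr (2 * \<kappa>)"
  using assms(5,6)
proof (induction M arbitrary: t)
  case 0
  then show ?case by simp
next
  case (Suc M)
  let ?\<Omega> = "\<omega> (t 0) (t (Suc (Suc M)))"
  let ?d = "\<lambda>i. \<omega> (t i) (t (Suc i)) + \<omega> (t (Suc i)) (t (Suc (Suc i)))"
  have mt: "t i \<le> t j" if "i \<le> j" "j \<le> Suc (Suc M)" for i j
    using that
  proof (induction j rule: dec_induct)
    case (step m)
    then have "t i \<le> t m" by simp
    also have "t m \<le> t (Suc m)" using step.hyps step.prems by (intro Suc.prems(1)) simp
    finally show ?case .
  qed auto
  have t0: "0 \<le> t i" if "i \<le> Suc (Suc M)" for i using mt[of 0 i] that Suc.prems(2) by simp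
  have tot: "(\<Sum>i<Suc (Suc M). \<omega> (t i) (t (Suc i))) \<le> ?\<Omega>"
    using sum_le_control[of "Suc (Suc M)" t] Suc.prems by auto
  have \<Omega>0: "0 \<le> ?\<Omega>" using nonneg mt[of 0 "Suc (Suc M)"] Suc.prems(2) by simp
  have nn: "0 \<le> \<omega> (t i) (t (Suc i))" if "i < Suc (Suc M)" for i
    using nonneg[OF t0, of i] mt[of i "Suc i"] that by simp
  \<comment> \<open>Every partition interval belongs to at most two adjacent pairs, so
    superadditivity gives the factor 2; the choice of \<open>i\<close> below is the pigeonhole
    principle for the \<open>Suc M\<close> interior points.\<close>
  have "(\<Sum>i<Suc M. ?d i) \<le> 2 * ?\<Omega>"
  proof -
    have "(\<Sum>i<Suc M. \<omega> (t i) (t (Suc i))) \<le> ?\<Omega>" using tot nn[of "Suc M"] by simp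
    moreover have "(\<Sum>i<Suc M. \<omega> (t (Suc i)) (t (Suc (Suc i)))) \<le> ?\<Omega>"
      using tot nn[of 0] by (subst (asm) sum.lessThan_Suc_shift) simp
    ultimately show ?thesis by (simp add: sum.distrib)
  qed
  then obtain i where i: "i < Suc M" "?d i \<le> 2 * ?\<Omega> / Suc M"
  proof -
    have "\<exists>i<Suc M. ?d i \<le> 2 * ?\<Omega> / Suc M"
    proof (rule ccontr)
      assume "\<not> ?thesis"
      then have "(\<Sum>i<Suc M. 2 * ?\<Omega> / Suc M) < (\<Sum>i<Suc M. ?d i)"
        by (intro sum_strict_mono) (auto simp: not_le)
      with \<open>(\<Sum>i<Suc M. ?d i) \<le> 2 * ?\<Omega>\<close> show False by simp
    qed
    then show ?thesis using that by blast
  qed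
  define t' where "t' j = (if j \<le> i then t j else t (Suc j))" for j
  obtain r where r: "M = i + r" using i(1) less_Suc_eq_le nat_le_iff_add by auto
  \<comment> \<open>\<open>t'\<close> omits the point \<open>t (Suc i)\<close>. Merging its two
    intervals leaves a product of one increment of \<open>F\<close> and one of \<open>G\<close>,
    which is where the exponent 2\<kappa> comes from.\<close>
  have diff: "(\<Sum>i<Suc (Suc M). F (t i) * (G (t (Suc i)) - G (t i))) -
      (\<Sum>i<Suc M. F (t' i) * (G (t' (Suc i)) - G (t' i)))
     = (F (t (Suc i)) - F (t i)) * (G (t (Suc (Suc i))) - G (t (Suc i)))"
  proof -
    define h where "h j = F (t j) * (G (t (Suc j)) - G (t j))" for j
    define h' where "h' j = F (t' j) * (G (t' (Suc j)) - G (t' j))" for j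
    have "sum h {..<Suc (Suc M)} = sum h {..<i + (2 + r)}" using r by simp
    also have "\<dots> = sum h {..<i} + (h i + h (Suc i) + (\<Sum>j<r. h (i + (2 + j))))"
      unfolding sum_lessThan_add by (simp add: numeral_2_eq_2)
    finally have 1: "sum h {..<Suc (Suc M)} = \<dots>" .
    have "sum h' {..<Suc M} = sum h' {..<i + (1 + r)}" using r by simp
    also have "\<dots> = sum h' {..<i} + (h' i + (\<Sum>j<r. h' (i + (1 + j))))"
      unfolding sum_lessThan_add by simp
    finally have 2: "sum h' {..<Suc M} = \<dots>" .
    have 3: "sum h' {..<i} = sum h {..<i}"
      by (intro sum.cong) (auto simp: h_def h'_def t'_def)
    have 4: "(\<Sum>j<r. h' (i + (1 + j))) = (\<Sum>j<r. h (i + (2 + j)))"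
      by (intro sum.cong) (auto simp: h_def h'_def t'_def)
    have 5: "h i + h (Suc i) - h' i = (F (t (Suc i)) - F (t i)) * (G (t (Suc (Suc i))) - G (t (Suc i)))"
      by (simp add: h_def h'_def t'_def algebra_simps)
    show ?thesis
      unfolding h_def[symmetric] h'_def[symmetric] 1 2 3 4 5[symmetric] by simp
  qed
  have step: "norm ((F (t (Suc i)) - F (t i)) * (G (t (Suc (Suc i))) - G (t (Suc i))))
      \<le> a * b * ((2 / real (Suc M)) powr (2 * \<kappa>) * ?\<Omega> powr (2 * \<kappa>))"
  proof -
    have le: "\<omega> (t i) (t (Suc i)) powr \<kappa> \<le> (2 * ?\<Omega> / Suc M) powr \<kappa>"
      "\<omega> (t (Suc i)) (t (Suc (Suc i))) powr \<kappa> \<le> (2 * ?\<Omega> / Suc M) powr \<kappa>"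
      using i nn[of i] nn[of "Suc i"] kappa by (auto intro!: powr_mono2)
    have "norm ((F (t (Suc i)) - F (t i)) * (G (t (Suc (Suc i))) - G (t (Suc i)))) \<le>
      norm (F (t (Suc i)) - F (t i)) * norm (G (t (Suc (Suc i))) - G (t (Suc i)))"
      by (rule norm_mult_ineq)
    also have "\<dots> \<le> (a * (2 * ?\<Omega> / Suc M) powr \<kappa>) * (b * (2 * ?\<Omega> / Suc M) powr \<kappa>)"
      using i(1) ab le t0 mt
      by (intro mult_mono order_trans[OF F] order_trans[OF G] mult_left_mono mult_nonneg_nonneg)
         (simp_all del: of_nat_Suc)
    also have "\<dots> = a * b * ((2 / real (Suc M)) * ?\<Omega>) powr (2 * \<kappa>)"
      unfolding mult_2[of \<kappa>] powr_add by (simp add: ac_simps)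
    also have "\<dots> = a * b * ((2 / real (Suc M)) powr (2 * \<kappa>) * ?\<Omega> powr (2 * \<kappa>))"
      using \<Omega>0 by (subst powr_mult) auto
    finally show ?thesis .
  qed
  have t'0: "t' 0 = t 0" and t'M: "t' (Suc M) = t (Suc (Suc M))" using i by (auto simp: t'_def)
  have IH: "norm ((\<Sum>i<Suc M. F (t' i) * (G (t' (Suc i)) - G (t' i))) - F (t 0) * (G (t (Suc (Suc M))) - G (t 0)))
     \<le> a * b * (\<Sum>k<M. (2 / real (Suc k)) powr (2 * \<kappa>)) * ?\<Omega> powr (2 * \<kappa>)"
    using Suc.IH[of t'] mt Suc.prems(2) unfolding t'0 t'M by (auto simp: t'_def)
  have "norm ((\<Sum>i<Suc (Suc M). F (t i) * (G (t (Suc i)) - G (t i))) - F (t 0) * (G (t (Suc (Suc M))) - G (t 0)))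
      \<le> norm ((\<Sum>i<Suc M. F (t' i) * (G (t' (Suc i)) - G (t' i))) - F (t 0) * (G (t (Suc (Suc M))) - G (t 0)))
       + norm ((F (t (Suc i)) - F (t i)) * (G (t (Suc (Suc i))) - G (t (Suc i))))"
    unfolding diff[symmetric] by (rule order_trans[OF _ norm_triangle_ineq]) (simp add: algebra_simps)
  also have "\<dots> \<le> a * b * (\<Sum>k<Suc M. (2 / real (Suc k)) powr (2 * \<kappa>)) * ?\<Omega> powr (2 * \<kappa>)"
    using IH step by (simp add: algebra_simps)
  finally show ?case .
qed

end

section \<open>Primitives and Riemann sums for a diffuse measure on the half-line\<close>

lemma integrable_if:
  fixes f :: "'a \<Rightarrow> 'b::{banach, second_countable_topology}"
  assumes "integrable M f" and [measurable]: "Measurable.pred M P"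
  shows "integrable M (\<lambda>x. if P x then f x else 0)"
proof (rule Bochner_Integration.integrable_bound[OF assms(1)])
  have [measurable]: "f \<in> borel_measurable M" using assms(1) by simp
  show "(\<lambda>x. if P x then f x else 0) \<in> borel_measurable M" by measurable
qed auto

text \<open>Diffuseness serves twice: it makes primitives continuous and makes ties between
  coordinates negligible. Finite initial segments give local integrability of functions in
  L^p.\<close>

locale half_line_measure = sigma_finite_measure M for M :: "real measure" +
  assumes id_measurable [measurable]: "(\<lambda>x. x) \<in> M \<rightarrow>\<^sub>M borel"
    and diffuse: "AE x in M. x \<noteq> c"
    and space_pos: "space M \<subseteq> {0<..}"
    and finite_initial: "emeasure M {x \<in> space M. x < c} < \<infinity>"
begin

definition primitive :: "(real \<Rightarrow> 'b::{banach, second_countable_topology}) \<Rightarrow> real \<Rightarrow> 'b" where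
  "primitive g t = (\<integral>y. (if y < t then g y else 0) \<partial>M)"

lemma primitive_0 [simp]: "primitive g 0 = 0"
proof -
  have "primitive g 0 = (\<integral>y. 0 \<partial>M)"
    unfolding primitive_def using space_pos
    by (intro Bochner_Integration.integral_cong) (auto simp: not_less)
  then show ?thesis by simp
qed

lemma primitive_diff:
  assumes "integrable M g" "s \<le> t"
  shows "primitive g t - primitive g s = (\<integral>y. (if s \<le> y \<and> y < t then g y else 0) \<partial>M)"
proof -
  have "primitive g t - primitive g s = (\<integral>y. (if y < t then g y else 0) - (if y < s then g y else 0) \<partial>M)"
    unfolding primitive_def
    by (intro Bochner_Integration.integral_diff[symmetric] integrable_if assms) measurable
  also have "\<dots> = (\<integral>y. (if s \<le> y \<and> y < t then g y else 0) \<partial>M)"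
    using assms(2) by (intro Bochner_Integration.integral_cong) auto
  finally show ?thesis .
qed

lemma continuous_primitive:
  assumes g: "integrable M g"
  shows "continuous_on A (primitive g)"
  unfolding continuous_on_sequentially
proof safe
  fix u :: "nat \<Rightarrow> real" and a
  assume u: "u \<longlonglongrightarrow> a"
  have "(\<lambda>n. \<integral>y. (if y < u n then g y else 0) \<partial>M) \<longlonglongrightarrow> (\<integral>y. (if y < a then g y else 0) \<partial>M)"
  proof (rule integral_dominated_convergence[where w = "\<lambda>y. norm (g y)"])
    show "AE y in M. (\<lambda>n. if y < u n then g y else 0) \<longlonglongrightarrow> (if y < a then g y else 0)"
      using diffuse[of a]
    proof eventually_elim
      case (elim y)
      have "eventually (\<lambda>n. (y < u n) = (y < a)) sequentially"
      proof (cases "y < a")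
        case True
        then show ?thesis using order_tendstoD(1)[OF u, of y] by simp
      next
        case False
        then have "a < y" using elim by simp
        then show ?thesis using order_tendstoD(2)[OF u, of y] False by (auto elim: eventually_mono)
      qed
      then have "eventually (\<lambda>n. (if y < u n then g y else 0) = (if y < a then g y else 0)) sequentially"
        by eventually_elim simp
      then show ?case by (rule tendsto_eventually)
    qed
  qed (use g borel_measurable_integrable[OF g] in \<open>auto intro!: integrable_norm\<close>)
  then show "(primitive g \<circ> u) \<longlonglongrightarrow> primitive g a"
    by (simp add: primitive_def comp_def)
qed

lemma integrable_mult_continuous:
  fixes F :: "real \<Rightarrow> complex"
  assumes g: "integrable M g" and F: "continuous_on {0..} F" and bd: "\<And>x. 0 \<le> x \<Longrightarrow> norm (F x) \<le> L"
  shows "integrable M (\<lambda>y. F y * g y)"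
proof (rule Bochner_Integration.integrable_bound[where f = "\<lambda>y. complex_of_real L * g y"])
  have "(\<lambda>x. indicator {0..} x *\<^sub>R F x) \<in> borel_measurable borel"
    by (rule borel_measurable_continuous_on_indicator) (use F in auto)
  then have "(\<lambda>x. indicator {0..} x *\<^sub>R F x) \<in> borel_measurable M"
    using measurable_compose[OF id_measurable] by blast
  then have "F \<in> borel_measurable M"
    by (rule measurable_cong[THEN iffD1, rotated]) (use space_pos in auto)
  then show "(\<lambda>y. F y * g y) \<in> borel_measurable M"
    using borel_measurable_integrable[OF g] by measurable
  show "AE y in M. norm (F y * g y) \<le> norm (complex_of_real L * g y)"
  proof (rule AE_I2)
    fix y assume "y \<in> space M"
    then have "norm (F y) \<le> \<bar>L\<bar>" using bd[of y] space_pos by auto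
    then show "norm (F y * g y) \<le> norm (complex_of_real L * g y)"
      by (auto simp: norm_mult intro: mult_right_mono)
  qed
qed (use g in simp)

text \<open>On one cell the error is the integral of (F y - F (t i)) g y, at most \<epsilon> times
  the mass of |g| there, and the masses of consecutive cells add up.\<close>

lemma riemann_sum_error:
  fixes F :: "real \<Rightarrow> complex"
  assumes g: "integrable M g" and Fg: "integrable M (\<lambda>y. F y * g y)"
    and mono: "\<And>i. i < N \<Longrightarrow> t i \<le> t (Suc i)"
    and osc: "\<And>i y. i < N \<Longrightarrow> t i \<le> y \<Longrightarrow> y < t (Suc i) \<Longrightarrow> norm (F y - F (t i)) \<le> \<epsilon>"
  shows "norm (primitive (\<lambda>y. F y * g y) (t N) - primitive (\<lambda>y. F y * g y) (t 0)
      - (\<Sum>i<N. F (t i) * (primitive g (t (Suc i)) - primitive g (t i))))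
    \<le> \<epsilon> * (\<integral>y. (if t 0 \<le> y \<and> y < t N then norm (g y) else 0) \<partial>M) \<and> t 0 \<le> t N"
  using mono osc
proof (induction N)
  case (Suc N)
  let ?P = "primitive (\<lambda>y. F y * g y)"
  have IH: "norm (?P (t N) - ?P (t 0) - (\<Sum>i<N. F (t i) * (primitive g (t (Suc i)) - primitive g (t i))))
    \<le> \<epsilon> * (\<integral>y. (if t 0 \<le> y \<and> y < t N then norm (g y) else 0) \<partial>M)" "t 0 \<le> t N"
    using Suc.IH Suc.prems by auto
  have le: "t N \<le> t (Suc N)" using Suc.prems by simp
  have "?P (t (Suc N)) - ?P (t N) - F (t N) * (primitive g (t (Suc N)) - primitive g (t N))
    = (\<integral>y. (if t N \<le> y \<and> y < t (Suc N) then F y * g y else 0) \<partial>M)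
        - (\<integral>y. F (t N) * (if t N \<le> y \<and> y < t (Suc N) then g y else 0) \<partial>M)"
    by (simp add: primitive_diff g Fg le)
  also have "\<dots> = (\<integral>y. (if t N \<le> y \<and> y < t (Suc N) then F y * g y else 0)
        - F (t N) * (if t N \<le> y \<and> y < t (Suc N) then g y else 0) \<partial>M)"
    by (intro Bochner_Integration.integral_diff[symmetric] integrable_mult_right integrable_if g Fg) measurable
  also have "norm \<dots> \<le> (\<integral>y. \<epsilon> * (if t N \<le> y \<and> y < t (Suc N) then norm (g y) else 0) \<partial>M)"
  proof (rule Bochner_Integration.integral_norm_bound_integral)
    show "integrable M (\<lambda>y. \<epsilon> * (if t N \<le> y \<and> y < t (Suc N) then norm (g y) else 0))"
      by (intro integrable_mult_right integrable_if integrable_norm g) measurable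
    show "integrable M (\<lambda>y. (if t N \<le> y \<and> y < t (Suc N) then F y * g y else 0)
        - F (t N) * (if t N \<le> y \<and> y < t (Suc N) then g y else 0))"
      by (intro Bochner_Integration.integrable_diff integrable_mult_right integrable_if g Fg) measurable
    fix y assume "y \<in> space M"
    show "norm ((if t N \<le> y \<and> y < t (Suc N) then F y * g y else 0)
        - F (t N) * (if t N \<le> y \<and> y < t (Suc N) then g y else 0))
      \<le> \<epsilon> * (if t N \<le> y \<and> y < t (Suc N) then norm (g y) else 0)"
      using Suc.prems(2)[of N y]
      by (auto simp: left_diff_distrib[symmetric] norm_mult intro!: mult_right_mono)
  qed
  finally have new: "norm (?P (t (Suc N)) - ?P (t N) - F (t N) * (primitive g (t (Suc N)) - primitive g (t N)))
    \<le> \<epsilon> * (\<integral>y. (if t N \<le> y \<and> y < t (Suc N) then norm (g y) else 0) \<partial>M)"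
    by simp
  have "(\<integral>y. (if t 0 \<le> y \<and> y < t N then norm (g y) else 0) \<partial>M)
      + (\<integral>y. (if t N \<le> y \<and> y < t (Suc N) then norm (g y) else 0) \<partial>M)
     = (\<integral>y. (if t 0 \<le> y \<and> y < t N then norm (g y) else 0)
          + (if t N \<le> y \<and> y < t (Suc N) then norm (g y) else 0) \<partial>M)"
    by (intro Bochner_Integration.integral_add[symmetric] integrable_if integrable_norm g) measurable
  also have "\<dots> = (\<integral>y. (if t 0 \<le> y \<and> y < t (Suc N) then norm (g y) else 0) \<partial>M)"
    using le IH(2) by (intro Bochner_Integration.integral_cong) auto
  finally have add: "(\<integral>y. (if t 0 \<le> y \<and> y < t (Suc N) then norm (g y) else 0) \<partial>M) =
     (\<integral>y. (if t 0 \<le> y \<and> y < t N then norm (g y) else 0) \<partial>M)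
      + (\<integral>y. (if t N \<le> y \<and> y < t (Suc N) then norm (g y) else 0) \<partial>M)" ..
  have split: "?P (t (Suc N)) - ?P (t 0) - (\<Sum>i<Suc N. F (t i) * (primitive g (t (Suc i)) - primitive g (t i)))
    = (?P (t N) - ?P (t 0) - (\<Sum>i<N. F (t i) * (primitive g (t (Suc i)) - primitive g (t i))))
    + (?P (t (Suc N)) - ?P (t N) - F (t N) * (primitive g (t (Suc N)) - primitive g (t N)))"
    by simp
  show ?case
    unfolding split add distrib_left
    using norm_triangle_mono[OF IH(1) new] le IH(2) by auto
next
  case 0
  have "(\<lambda>y. if t 0 \<le> y \<and> y < t 0 then norm (g y) else 0) = (\<lambda>y. 0)"
    by (intro ext) auto
  then show ?case by simp
qed

end

locale controlled_half_line = half_line_measure M + control \<omega> \<kappa>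
  for M \<omega> \<kappa>
begin

text \<open>The mass of |g| enters only through the Riemann sum error, which vanishes with the mesh;
  what survives depends on \<open>g\<close> only through the increments of its primitive. The
  conclusion has the shape of \<open>gb\<close>, so the estimate can be iterated.\<close>

lemma young_integral:
  fixes F :: "real \<Rightarrow> complex"
  assumes g: "integrable M g" and F: "continuous_on {0..} F"
    and Fa: "\<And>u v. 0 \<le> u \<Longrightarrow> u \<le> v \<Longrightarrow> norm (F v - F u) \<le> a * \<omega> u v powr \<kappa>"
    and gb: "\<And>u v. 0 \<le> u \<Longrightarrow> u \<le> v \<Longrightarrow> norm (primitive g v - primitive g u) \<le> b * \<omega> u v powr \<kappa>"
    and bd: "\<And>x. 0 \<le> x \<Longrightarrow> norm (F x) \<le> L"
    and ab: "0 \<le> a" "0 \<le> b" and st: "0 \<le> s" "s \<le> t"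
  shows "norm (primitive (\<lambda>y. F y * g y) t - primitive (\<lambda>y. F y * g y) s)
    \<le> (L * b + a * b * young_const) * \<omega> s t powr \<kappa>"
proof -
  let ?P = "primitive (\<lambda>y. F y * g y)"
  let ?Z = "\<integral>y. (if s \<le> y \<and> y < t then norm (g y) else 0) \<partial>M"
  let ?B = "(L * b + a * b * young_const) * \<omega> s t powr \<kappa>"
  have Fg: "integrable M (\<lambda>y. F y * g y)" by (rule integrable_mult_continuous[OF g F bd])
  have Z: "0 \<le> ?Z" by (intro integral_nonneg_AE) auto
  have main: "norm (?P t - ?P s) \<le> ?B + \<epsilon> * ?Z" if "0 < \<epsilon>" for \<epsilon>
  proof -
    have "uniformly_continuous_on {s..t} F"
      by (intro compact_uniformly_continuous continuous_on_subset[OF F]) (use st in auto)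
    then obtain \<delta> where \<delta>: "0 < \<delta>" "\<And>x y. x \<in> {s..t} \<Longrightarrow> y \<in> {s..t} \<Longrightarrow> dist y x < \<delta> \<Longrightarrow> dist (F y) (F x) < \<epsilon>"
      unfolding uniformly_continuous_on_def using \<open>0 < \<epsilon>\<close> by meson
    obtain N where N: "(t - s) / real (Suc N) < \<delta>"
    proof -
      have "(\<lambda>n. (t - s) * inverse (real (Suc n))) \<longlonglongrightarrow> (t - s) * 0"
        by (intro tendsto_mult tendsto_const LIMSEQ_inverse_real_of_nat)
      then have "eventually (\<lambda>n. (t - s) * inverse (real (Suc n)) < \<delta>) sequentially"
        using \<delta>(1) by (auto dest: order_tendstoD(2)[where a = \<delta>])
      then show ?thesis using that by (auto simp: eventually_sequentially divide_inverse)
    qed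
    define h where "h = (t - s) / real (Suc N)"
    define \<tau> where "\<tau> i = s + h * real i" for i :: nat
    have h: "0 \<le> h" "h < \<delta>" using st N by (auto simp: h_def)
    have ends: "\<tau> 0 = s" "\<tau> (Suc N) = t" by (simp_all add: \<tau>_def h_def del: of_nat_Suc)
    have step: "\<tau> (Suc i) = \<tau> i + h" for i by (simp add: \<tau>_def algebra_simps)
    have ge: "s \<le> \<tau> i" for i using h by (simp add: \<tau>_def)
    have le: "\<tau> i \<le> t" if "i \<le> Suc N" for i
    proof -
      have "h * real i \<le> h * real (Suc N)" using that h by (intro mult_left_mono) auto
      then show ?thesis using ends(2) by (simp add: \<tau>_def)
    qed
    have err: "norm (?P t - ?P s - (\<Sum>i<Suc N. F (\<tau> i) * (primitive g (\<tau> (Suc i)) - primitive g (\<tau> i)))) \<le> \<epsilon> * ?Z"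
    proof -
      have "norm (F y - F (\<tau> i)) \<le> \<epsilon>" if "i < Suc N" "\<tau> i \<le> y" "y < \<tau> (Suc i)" for i y
      proof -
        have "\<tau> i \<in> {s..t}" "y \<in> {s..t}" "dist y (\<tau> i) < \<delta>"
          using ge[of i] le[of i] le[of "Suc i"] that step[of i] h by (auto simp: dist_real_def)
        from \<delta>(2)[OF this] show ?thesis by (simp add: dist_norm)
      qed
      with riemann_sum_error[OF g Fg, of "Suc N" \<tau> \<epsilon>] show ?thesis
        using h unfolding ends by (simp add: step)
    qed
    have yd: "norm ((\<Sum>i<Suc N. F (\<tau> i) * (primitive g (\<tau> (Suc i)) - primitive g (\<tau> i))) - F s * (primitive g t - primitive g s))
      \<le> a * b * (\<Sum>k<N. (2 / real (Suc k)) powr (2 * \<kappa>)) * \<omega> s t powr (2 * \<kappa>)"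
      using young_discrete[OF Fa gb ab, of N \<tau>] h st unfolding ends by (simp add: step)
    also have "\<dots> \<le> a * b * young_const * \<omega> s t powr \<kappa>"
    proof (intro mult_mono mult_left_mono young_const_ge)
      \<comment> \<open>Here \<omega> \<le> 1 trades the better exponent 2\<kappa> for \<kappa>, so
        that both terms of Young's bound are multiples of the same power.\<close>
      have "\<omega> s t powr (2 * \<kappa>) = \<omega> s t powr \<kappa> * \<omega> s t powr \<kappa>" by (simp add: powr_add[symmetric])
      also have "\<dots> \<le> 1 * \<omega> s t powr \<kappa>"
        using le_1[OF st] nonneg[OF st] kappa
        by (intro mult_right_mono powr_le1) auto
      finally show "\<omega> s t powr (2 * \<kappa>) \<le> \<omega> s t powr \<kappa>" by simp
    qed (use ab young_const_nonneg in \<open>auto intro!: sum_nonneg mult_nonneg_nonneg\<close>)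
    finally have yd: "norm ((\<Sum>i<Suc N. F (\<tau> i) * (primitive g (\<tau> (Suc i)) - primitive g (\<tau> i))) - F s * (primitive g t - primitive g s))
      \<le> a * b * young_const * \<omega> s t powr \<kappa>" .
    have "norm (F s * (primitive g t - primitive g s)) \<le> L * (b * \<omega> s t powr \<kappa>)"
      unfolding norm_mult using bd[OF st(1)] gb[OF st] order_trans[OF norm_ge_zero bd[OF st(1)]]
      by (intro mult_mono) auto
    with norm_triangle_mono[OF err norm_triangle_mono[OF yd this]]
    show ?thesis by (simp add: algebra_simps)
  qed
  show ?thesis
  proof (rule field_le_epsilon)
    fix e :: real assume "0 < e"
    \<comment> \<open>Dividing by \<open>?Z + 1\<close> instead of \<open>?Z\<close> covers a
      vanishing mass.\<close>
    have "norm (?P t - ?P s) \<le> ?B + e / (?Z + 1) * ?Z"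
      using Z \<open>0 < e\<close> by (intro main divide_pos_pos add_nonneg_pos) simp_all
    also have "e / (z + 1) * z \<le> e" if "0 \<le> z" for z
      using that \<open>0 < e\<close> by (simp add: field_simps)
    note this[OF Z]
    finally show "norm (?P t - ?P s) \<le> ?B + e" by simp
  qed
qed

end

section \<open>Ordered integrals\<close>

context half_line_measure
begin

sublocale prod: product_sigma_finite "\<lambda>_. M"
  by unfold_locales

lemma component_measurable [measurable (raw)]:
  assumes "i \<in> J" shows "(\<lambda>x. x i) \<in> Pi\<^sub>M J (\<lambda>_. M) \<rightarrow>\<^sub>M borel"
  using measurable_compose[OF measurable_component_singleton[OF assms] id_measurable] by simp

text \<open>Fubini with coordinate \<open>i\<close> innermost: once the other coordinates are fixed,
  a tie is the single point \<open>x j\<close>, which is null.\<close>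

lemma AE_PiM_neq:
  fixes i j :: 'i
  assumes "finite J" "i \<in> J" "j \<in> J" "i \<noteq> j"
  shows "AE x in Pi\<^sub>M J (\<lambda>_. M). x i \<noteq> x j"
proof -
  define u :: "('i \<Rightarrow> real) \<Rightarrow> ennreal" where "u x = (if x i = x j then 1 else 0)" for x
  have J: "J = insert i (J - {i})" using assms by auto
  note [measurable] = component_measurable[OF assms(2)] component_measurable[OF assms(3)]
  have u: "u \<in> borel_measurable (Pi\<^sub>M J (\<lambda>_. M))"
    unfolding u_def by measurable
  have "(\<integral>\<^sup>+x. u x \<partial>Pi\<^sub>M (insert i (J - {i})) (\<lambda>_. M)) =
      (\<integral>\<^sup>+x. (\<integral>\<^sup>+y. u (x(i := y)) \<partial>M) \<partial>Pi\<^sub>M (J - {i}) (\<lambda>_. M))"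
    by (rule prod.product_nn_integral_insert) (use assms u J in auto)
  also have "\<dots> = (\<integral>\<^sup>+x. 0 \<partial>Pi\<^sub>M (J - {i}) (\<lambda>_. M))"
  proof (rule nn_integral_cong)
    fix x :: "'i \<Rightarrow> real"
    have "(\<integral>\<^sup>+y. u (x(i := y)) \<partial>M) = (\<integral>\<^sup>+y. 0 \<partial>M)"
      by (rule nn_integral_cong_AE)
         (use diffuse[of "x j"] assms(4) in \<open>auto simp: u_def elim: eventually_mono\<close>)
    then show "(\<integral>\<^sup>+y. u (x(i := y)) \<partial>M) = 0" by simp
  qed
  finally have "(\<integral>\<^sup>+x. u x \<partial>Pi\<^sub>M J (\<lambda>_. M)) = 0" using J by simp
  then have "AE x in Pi\<^sub>M J (\<lambda>_. M). u x = 0" using nn_integral_0_iff_AE[OF u] by simp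
  then show ?thesis by eventually_elim (auto simp: u_def split: if_splits)
qed

lemma AE_PiM_inj_on:
  assumes "finite J" shows "AE x in Pi\<^sub>M J (\<lambda>_. M). inj_on x J"
proof -
  have "AE x in Pi\<^sub>M J (\<lambda>_. M). \<forall>i\<in>J. \<forall>j\<in>J. i \<noteq> j \<longrightarrow> x i \<noteq> x j"
    using assms AE_PiM_neq[OF assms] by (intro AE_finite_allI AE_impI) auto
  then show ?thesis by eventually_elim (auto simp: inj_on_def)
qed

text \<open>Only pairs with both entries in \<open>J\<close> count, so the same \<open>A\<close> can
  be kept when the induction removes an index from \<open>J\<close>.\<close>

definition ordered_on :: "('i \<times> 'i) set \<Rightarrow> 'i set \<Rightarrow> ('i \<Rightarrow> real) \<Rightarrow> bool" where
  "ordered_on A J x \<longleftrightarrow> (\<forall>\<alpha>\<in>{\<alpha>\<in>A. fst \<alpha> \<in> J \<and> snd \<alpha> \<in> J}. x (snd \<alpha>) < x (fst \<alpha>))"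

text \<open>The common upper limit \<open>t\<close> is the running variable of the induction: after
  the largest coordinate is split off, its value is the limit for the others. Individual truncations
  go into the functions \<open>g j\<close>.\<close>

definition ordered_integral ::
  "('i \<times> 'i) set \<Rightarrow> ('i \<Rightarrow> real \<Rightarrow> complex) \<Rightarrow> 'i set \<Rightarrow> real \<Rightarrow> complex" where
  "ordered_integral A g J t =
    (\<integral>x. (if ordered_on A J x then (\<Prod>j\<in>J. if x j < t then g j (x j) else 0) else 0) \<partial>Pi\<^sub>M J (\<lambda>_. M))"

lemma ordered_on_measurable [measurable (raw)]:
  assumes "finite A" shows "Measurable.pred (Pi\<^sub>M J (\<lambda>_. M)) (ordered_on A J)"
  unfolding ordered_on_def
proof (rule pred_intros_finite(3))
  show "finite {\<alpha> \<in> A. fst \<alpha> \<in> J \<and> snd \<alpha> \<in> J}" using assms by simp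
  fix \<alpha> assume "\<alpha> \<in> {\<alpha> \<in> A. fst \<alpha> \<in> J \<and> snd \<alpha> \<in> J}"
  then have [measurable]: "(\<lambda>x. x (fst \<alpha>)) \<in> Pi\<^sub>M J (\<lambda>_. M) \<rightarrow>\<^sub>M borel"
    "(\<lambda>x. x (snd \<alpha>)) \<in> Pi\<^sub>M J (\<lambda>_. M) \<rightarrow>\<^sub>M borel"
    by (auto intro: component_measurable)
  show "Measurable.pred (Pi\<^sub>M J (\<lambda>_. M)) (\<lambda>x. x (snd \<alpha>) < x (fst \<alpha>))" by measurable
qed

lemma integrable_ordered:
  assumes "finite A" "finite J" "\<And>j. j \<in> J \<Longrightarrow> integrable M (g j)"
  shows "integrable (Pi\<^sub>M J (\<lambda>_. M))
    (\<lambda>x. if ordered_on A J x then (\<Prod>j\<in>J. if x j < t then g j (x j) else (0::complex)) else 0)"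
proof (rule integrable_if)
  show "integrable (Pi\<^sub>M J (\<lambda>_. M)) (\<lambda>x. \<Prod>j\<in>J. if x j < t then g j (x j) else 0)"
    by (rule prod.product_integrable_prod[where f = "\<lambda>j y. if y < t then g j y else 0"])
       (use assms in \<open>auto intro!: integrable_if\<close>)
qed (use assms in measurable)

lemma strict_max_partition:
  fixes x :: "'i \<Rightarrow> real" and c :: complex
  assumes "finite J" "J \<noteq> {}" "inj_on x J"
  shows "(\<Sum>j\<in>J. if \<forall>i\<in>J - {j}. x i < x j then c else 0) = c"
proof -
  obtain m where m: "m \<in> J" "\<And>i. i \<in> J \<Longrightarrow> x i \<le> x m"
  proof -
    have "Max (x ` J) \<in> x ` J" using assms by (intro Max_in) auto
    then obtain m where "m \<in> J" "x m = Max (x ` J)" by auto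
    with that[of m] show ?thesis using assms by auto
  qed
  have "(\<forall>i\<in>J - {j}. x i < x j) \<longleftrightarrow> j = m" if "j \<in> J" for j
  proof
    assume "\<forall>i\<in>J - {j}. x i < x j"
    then have "x m < x j" if "j \<noteq> m" using that m(1) by blast
    then show "j = m" using m(2)[OF that] by fastforce
  next
    assume "j = m"
    then show "\<forall>i\<in>J - {j}. x i < x j"
      using m assms(3) by (auto simp: less_le inj_on_def)
  qed
  then have "(\<Sum>j\<in>J. if \<forall>i\<in>J - {j}. x i < x j then c else 0) = (\<Sum>j\<in>J. if j = m then c else 0)"
    by (intro sum.cong) auto
  then show ?thesis using assms m by simp
qed

text \<open>The summand of index \<open>j\<close> comes from the region where \<open>x j\<close> is the largest coordinate.\<close>

lemma ordered_integral_rec: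
  assumes A: "finite A" and J: "finite J" "J \<noteq> {}" and g: "\<And>j. j \<in> J \<Longrightarrow> integrable M (g j)"
  shows "ordered_integral A g J t =
    (\<Sum>j\<in>J. if \<exists>a\<in>J. (a, j) \<in> A then 0 else primitive (\<lambda>y. ordered_integral A g (J - {j}) y * g j y) t)"
proof -
  let ?f = "\<lambda>x. if ordered_on A J x then (\<Prod>j\<in>J. if x j < t then g j (x j) else 0) else 0"
  let ?fj = "\<lambda>j x. if \<forall>i\<in>J - {j}. x i < x j then ?f x else 0"
  have f: "integrable (Pi\<^sub>M J (\<lambda>_. M)) ?f" by (rule integrable_ordered[OF A J(1) g])
  have fj: "integrable (Pi\<^sub>M J (\<lambda>_. M)) (?fj j)" if "j \<in> J" for j
  proof (rule integrable_if[OF f], rule pred_intros_finite(3))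
    fix i assume "i \<in> J - {j}"
    then have [measurable]: "(\<lambda>x. x i) \<in> Pi\<^sub>M J (\<lambda>_. M) \<rightarrow>\<^sub>M borel" "(\<lambda>x. x j) \<in> Pi\<^sub>M J (\<lambda>_. M) \<rightarrow>\<^sub>M borel"
      using that by (auto intro: component_measurable)
    show "Measurable.pred (Pi\<^sub>M J (\<lambda>_. M)) (\<lambda>x. x i < x j)" by measurable
  qed (use J in auto)
  have "ordered_integral A g J t = (\<integral>x. (\<Sum>j\<in>J. ?fj j x) \<partial>Pi\<^sub>M J (\<lambda>_. M))"
    unfolding ordered_integral_def
  proof (rule integral_cong_AE)
    show "AE x in Pi\<^sub>M J (\<lambda>_. M). ?f x = (\<Sum>j\<in>J. ?fj j x)"
      using AE_PiM_inj_on[OF J(1)] by eventually_elim (simp add: strict_max_partition J)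
    show "(\<lambda>x. \<Sum>j\<in>J. ?fj j x) \<in> borel_measurable (Pi\<^sub>M J (\<lambda>_. M))"
      using fj by (intro borel_measurable_sum borel_measurable_integrable) auto
  qed (use f in simp)
  also have "\<dots> = (\<Sum>j\<in>J. \<integral>x. ?fj j x \<partial>Pi\<^sub>M J (\<lambda>_. M))"
    by (rule Bochner_Integration.integral_sum) (rule fj)
  also have "\<dots> = (\<Sum>j\<in>J. if \<exists>a\<in>J. (a, j) \<in> A then 0
      else primitive (\<lambda>y. ordered_integral A g (J - {j}) y * g j y) t)"
  proof (rule sum.cong[OF refl])
    fix j assume j: "j \<in> J"
    let ?K = "J - {j}"
    have JK: "J = insert j ?K" using j by auto
    have K: "finite ?K" "j \<notin> ?K" using J by auto
    show "(\<integral>x. ?fj j x \<partial>Pi\<^sub>M J (\<lambda>_. M)) = (if \<exists>a\<in>J. (a, j) \<in> A then 0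
      else primitive (\<lambda>y. ordered_integral A g ?K y * g j y) t)"
    proof (cases "\<exists>a\<in>J. (a, j) \<in> A")
      case True
      then obtain a where a: "a \<in> J" "(a, j) \<in> A" by auto
      \<comment> \<open>The pair asks for \<open>x j < x a\<close>, which fails when
        \<open>x j\<close> is the largest coordinate; for \<open>a = j\<close> it asks for
        \<open>x j < x j\<close>.\<close>
      have "?fj j x = 0" for x
      proof -
        have "\<not> (ordered_on A J x \<and> (\<forall>i\<in>?K. x i < x j))"
        proof
          assume *: "ordered_on A J x \<and> (\<forall>i\<in>?K. x i < x j)"
          then have "x j < x a" using a j by (auto simp: ordered_on_def)
          moreover have "x a < x j" if "a \<noteq> j" using * a that by blast
          ultimately show False by (cases "a = j") auto
        qed
        then show ?thesis by auto
      qed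
      then show ?thesis using True by simp
    next
      case False
      \<comment> \<open>The integrand with \<open>y\<close> as the largest coordinate. The limit
        \<open>t\<close> of the other coordinates is replaced by the stronger limit
        \<open>y\<close>, pairs \<open>(j, i)\<close> hold automatically, and pairs
        \<open>(a, j)\<close> do not occur in this case.\<close>
      define h :: "('a \<Rightarrow> real) \<Rightarrow> real \<Rightarrow> complex" where
        "h x y = (if ordered_on A ?K x then (\<Prod>i\<in>?K. if x i < y then g i (x i) else 0) else 0)
           * (if y < t then g j y else 0)" for x y
      have upd: "?fj j (x(j := y)) = h x y" for x y
      proof (cases "\<forall>i\<in>?K. x i < y")
        case True
        have "ordered_on A J (x(j := y)) \<longleftrightarrow> ordered_on A ?K x"
          using True False unfolding ordered_on_def by (auto simp: j)
        moreover have "(\<Prod>i\<in>J. if (x(j := y)) i < t then g i ((x(j := y)) i) else 0)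
          = (\<Prod>i\<in>?K. if x i < y then g i (x i) else 0) * (if y < t then g j y else 0)"
        proof (cases "y < t")
          case yt: True
          have "(\<Prod>i\<in>?K. if (x(j := y)) i < t then g i ((x(j := y)) i) else 0)
             = (\<Prod>i\<in>?K. if x i < y then g i (x i) else 0)"
          proof (rule prod.cong[OF refl])
            fix i assume "i \<in> ?K"
            then have "x i < y" "i \<noteq> j" using True by auto
            then show "(if (x(j := y)) i < t then g i ((x(j := y)) i) else 0) = (if x i < y then g i (x i) else 0)"
              using yt by simp
          qed
          then show ?thesis using yt by (subst prod.remove[OF J(1) j]) (auto simp: mult.commute)
        next
          case False
          then show ?thesis by (subst prod.remove[OF J(1) j]) auto
        qed
        ultimately show ?thesis using True by (auto simp: h_def)
      next
        case False
        then obtain i where "i \<in> ?K" "\<not> x i < y" by auto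
        then have "(\<Prod>i\<in>?K. if x i < y then g i (x i) else 0) = 0"
          using K by (intro prod_zero) auto
        then show ?thesis using False by (auto simp: h_def)
      qed
      interpret K: finite_product_sigma_finite "\<lambda>_. M" ?K by unfold_locales (rule K)
      interpret P: pair_sigma_finite "Pi\<^sub>M ?K (\<lambda>_. M)" M ..
      have h_meas: "case_prod h \<in> borel_measurable (Pi\<^sub>M ?K (\<lambda>_. M) \<Otimes>\<^sub>M M)"
      proof -
        have "(\<lambda>p. ?fj j ((fst p)(j := snd p))) \<in> borel_measurable (Pi\<^sub>M ?K (\<lambda>_. M) \<Otimes>\<^sub>M M)"
          using borel_measurable_integrable[OF fj[OF j]]
          by (rule measurable_compose[rotated]) (subst JK, measurable)
        then show ?thesis unfolding upd by (simp add: case_prod_beta')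
      qed
      \<comment> \<open>Inserting a coordinate puts the integral over \<open>y\<close> innermost,
        whereas the recursion needs it outermost. The exchange is justified by the product of the
        norms as a majorant.\<close>
      have h_int: "integrable (Pi\<^sub>M ?K (\<lambda>_. M) \<Otimes>\<^sub>M M) (case_prod h)"
      proof (rule P.Fubini_integrable[OF h_meas])
        have G: "integrable (Pi\<^sub>M ?K (\<lambda>_. M)) (\<lambda>x. \<Prod>i\<in>?K. norm (g i (x i)))"
          by (rule prod.product_integrable_prod) (use K g in auto)
        have gj: "integrable M (\<lambda>y. norm (g j y))" using g[OF j] by simp
        have bd: "norm (h x y) \<le> (\<Prod>i\<in>?K. norm (g i (x i))) * norm (g j y)" for x y
        proof -
          have "norm (\<Prod>i\<in>?K. if x i < y then g i (x i) else 0) \<le> (\<Prod>i\<in>?K. norm (g i (x i)))"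
            unfolding prod_norm[symmetric] by (intro prod_mono) auto
          then show ?thesis
            unfolding h_def norm_mult by (intro mult_mono) (auto intro!: prod_nonneg)
        qed
        have sect: "integrable M (h x)" if "x \<in> space (Pi\<^sub>M ?K (\<lambda>_. M))" for x
        proof (rule Bochner_Integration.integrable_bound)
          show "integrable M (\<lambda>y. (\<Prod>i\<in>?K. norm (g i (x i))) * norm (g j y))" using gj by simp
          show "h x \<in> borel_measurable M" using measurable_Pair2[OF h_meas that] by simp
          show "AE y in M. norm (h x y) \<le> norm ((\<Prod>i\<in>?K. norm (g i (x i))) * norm (g j y))"
            unfolding real_norm_def by (intro AE_I2 order_trans[OF bd abs_ge_self])
        qed
        show "AE x in Pi\<^sub>M ?K (\<lambda>_. M). integrable M (\<lambda>y. case (x, y) of (x, y) \<Rightarrow> h x y)"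
          using sect by auto
        show "integrable (Pi\<^sub>M ?K (\<lambda>_. M)) (\<lambda>x. \<integral>y. norm (case (x, y) of (x, y) \<Rightarrow> h x y) \<partial>M)"
        proof (rule Bochner_Integration.integrable_bound)
          show "integrable (Pi\<^sub>M ?K (\<lambda>_. M)) (\<lambda>x. (\<Prod>i\<in>?K. norm (g i (x i))) * (\<integral>y. norm (g j y) \<partial>M))"
            using G by simp
          show "(\<lambda>x. \<integral>y. norm (case (x, y) of (x, y) \<Rightarrow> h x y) \<partial>M) \<in> borel_measurable (Pi\<^sub>M ?K (\<lambda>_. M))"
            using h_meas by measurable
          show "AE x in Pi\<^sub>M ?K (\<lambda>_. M). norm (\<integral>y. norm (case (x, y) of (x, y) \<Rightarrow> h x y) \<partial>M)
             \<le> norm ((\<Prod>i\<in>?K. norm (g i (x i))) * (\<integral>y. norm (g j y) \<partial>M))"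
          proof (rule AE_I2)
            fix x assume x: "x \<in> space (Pi\<^sub>M ?K (\<lambda>_. M))"
            have "norm (\<integral>y. norm (h x y) \<partial>M) \<le> (\<integral>y. (\<Prod>i\<in>?K. norm (g i (x i))) * norm (g j y) \<partial>M)"
              by (rule Bochner_Integration.integral_norm_bound_integral) (use sect[OF x] gj bd in auto)
            also have "\<dots> = (\<Prod>i\<in>?K. norm (g i (x i))) * (\<integral>y. norm (g j y) \<partial>M)" by simp
            also have "\<dots> \<le> norm \<dots>" by simp
            finally show "norm (\<integral>y. norm (case (x, y) of (x, y) \<Rightarrow> h x y) \<partial>M)
             \<le> norm ((\<Prod>i\<in>?K. norm (g i (x i))) * (\<integral>y. norm (g j y) \<partial>M))" by simp
          qed
        qed
      qed
      have "(\<integral>x. ?fj j x \<partial>Pi\<^sub>M J (\<lambda>_. M)) = (\<integral>x. (\<integral>y. ?fj j (x(j := y)) \<partial>M) \<partial>Pi\<^sub>M ?K (\<lambda>_. M))"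
        using prod.product_integral_insert[OF K, of "?fj j"] fj[OF j] unfolding JK[symmetric] by blast
      also have "\<dots> = (\<integral>x. (\<integral>y. h x y \<partial>M) \<partial>Pi\<^sub>M ?K (\<lambda>_. M))" by (simp only: upd)
      also have "\<dots> = (\<integral>y. (\<integral>x. h x y \<partial>Pi\<^sub>M ?K (\<lambda>_. M)) \<partial>M)"
        using P.Fubini_integral[OF h_int] by simp
      also have "\<dots> = primitive (\<lambda>y. ordered_integral A g ?K y * g j y) t"
        unfolding primitive_def ordered_integral_def h_def
        by (intro Bochner_Integration.integral_cong refl) auto
      finally show ?thesis using False by simp
    qed
  qed
  finally show ?thesis .
qed

end

context controlled_half_line
begin

text \<open>Continuity, increments and supremum are carried together because
  \<open>young_integral\<close> asks for all three of its integrand. Each step contributes a factor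
  \<open>1 + young_const\<close> and a choice of the largest variable, whence the factorial.\<close>

lemma ordered_integral_control:
  assumes A: "finite A" and g: "\<And>j. j \<in> J \<Longrightarrow> integrable M (g j)" and c: "\<And>j. j \<in> J \<Longrightarrow> 0 \<le> c j"
    and b: "\<And>j u v. j \<in> J \<Longrightarrow> 0 \<le> u \<Longrightarrow> u \<le> v \<Longrightarrow>
      norm (primitive (g j) v - primitive (g j) u) \<le> c j * \<omega> u v powr \<kappa>"
    and "card J = n" "finite J"
  defines "K \<equiv> fact n * (1 + young_const) ^ n"
  shows "continuous_on {0..} (ordered_integral A g J) \<and>
    (\<forall>u v. 0 \<le> u \<longrightarrow> u \<le> v \<longrightarrow>
      norm (ordered_integral A g J v - ordered_integral A g J u) \<le> K * (\<Prod>j\<in>J. c j) * \<omega> u v powr \<kappa>) \<and>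
    (\<forall>v\<ge>0. norm (ordered_integral A g J v) \<le> K * (\<Prod>j\<in>J. c j))"
  using assms(2-6) unfolding K_def
proof (induction n arbitrary: J)
  case 0
  then have J: "J = {}" by simp
  interpret finite_measure "Pi\<^sub>M {} (\<lambda>_. M)" by rule (simp add: space_PiM)
  \<comment> \<open>An empty product integrated over a one-point space of mass 1.\<close>
  have "ordered_integral A g J = (\<lambda>_. 1)"
    unfolding ordered_integral_def J by (simp add: ordered_on_def space_PiM measure_def)
  then show ?case by (simp add: J)
next
  case (Suc n)
  let ?T = "ordered_integral A g"
  let ?K = "fact n * (1 + young_const) ^ n :: real"
  let ?t = "\<lambda>j t. if \<exists>a\<in>J. (a, j) \<in> A then 0 else primitive (\<lambda>y. ?T (J - {j}) y * g j y) t"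
  have J: "finite J" "J \<noteq> {}" using Suc.prems by auto
  have rec: "?T J = (\<lambda>t. \<Sum>j\<in>J. ?t j t)"
    by (intro ext ordered_integral_rec A J Suc.prems(1))
  have K0: "0 \<le> ?K" using young_const_nonneg by simp
  have piece: "continuous_on {0..} (?t j)"
     "\<And>u v. 0 \<le> u \<Longrightarrow> u \<le> v \<Longrightarrow> norm (?t j v - ?t j u) \<le> ?K * (1 + young_const) * (\<Prod>j\<in>J. c j) * \<omega> u v powr \<kappa>"
    if j: "j \<in> J" for j
  proof -
    let ?C = "?K * (\<Prod>i\<in>J - {j}. c i)"
    have IH: "continuous_on {0..} (?T (J - {j}))"
      "\<And>u v. 0 \<le> u \<Longrightarrow> u \<le> v \<Longrightarrow> norm (?T (J - {j}) v - ?T (J - {j}) u) \<le> ?C * \<omega> u v powr \<kappa>"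
      "\<And>v. 0 \<le> v \<Longrightarrow> norm (?T (J - {j}) v) \<le> ?C"
      using Suc.IH[of "J - {j}"] Suc.prems j by auto
    have C0: "0 \<le> ?C" using Suc.prems(2) by (intro mult_nonneg_nonneg[OF K0] prod_nonneg) auto
    show "continuous_on {0..} (?t j)"
      using continuous_primitive[OF integrable_mult_continuous[OF Suc.prems(1)[OF j] IH(1,3)]]
      by (cases "\<exists>a\<in>J. (a, j) \<in> A") (simp_all only: if_True if_False continuous_on_const)
    fix u v :: real assume uv: "0 \<le> u" "u \<le> v"
    have "norm (primitive (\<lambda>y. ?T (J - {j}) y * g j y) v - primitive (\<lambda>y. ?T (J - {j}) y * g j y) u)
      \<le> (?C * c j + ?C * c j * young_const) * \<omega> u v powr \<kappa>"
      by (rule young_integral[OF Suc.prems(1)[OF j] IH(1) IH(2) Suc.prems(3)[OF j] IH(3)])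
         (use C0 uv Suc.prems(2)[OF j] in auto)
    also have "?C * c j + ?C * c j * young_const = ?K * (1 + young_const) * (\<Prod>j\<in>J. c j)"
      unfolding prod.remove[OF J(1) j] by (simp add: algebra_simps)
    finally have "norm (primitive (\<lambda>y. ?T (J - {j}) y * g j y) v - primitive (\<lambda>y. ?T (J - {j}) y * g j y) u)
      \<le> ?K * (1 + young_const) * (\<Prod>j\<in>J. c j) * \<omega> u v powr \<kappa>" .
    moreover from this have "0 \<le> ?K * (1 + young_const) * (\<Prod>j\<in>J. c j) * \<omega> u v powr \<kappa>"
      by (rule order_trans[OF norm_ge_zero])
    ultimately show "norm (?t j v - ?t j u) \<le> ?K * (1 + young_const) * (\<Prod>j\<in>J. c j) * \<omega> u v powr \<kappa>"
      by (cases "\<exists>a\<in>J. (a, j) \<in> A") (simp_all only: if_True if_False diff_self norm_zero)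
  qed
  have K1: "of_nat (card J) * (?K * (1 + young_const)) = fact (Suc n) * (1 + young_const) ^ Suc n"
    by (simp add: Suc.prems(4) algebra_simps)
  have diff: "norm (?T J v - ?T J u) \<le> fact (Suc n) * (1 + young_const) ^ Suc n * (\<Prod>j\<in>J. c j) * \<omega> u v powr \<kappa>"
    if "0 \<le> u" "u \<le> v" for u v
  proof -
    have "norm (?T J v - ?T J u) \<le> (\<Sum>j\<in>J. norm (?t j v - ?t j u))"
      unfolding rec sum_subtractf[symmetric] by (rule norm_sum)
    also have "\<dots> \<le> of_nat (card J) * (?K * (1 + young_const) * (\<Prod>j\<in>J. c j) * \<omega> u v powr \<kappa>)"
      by (rule sum_bounded_above) (rule piece(2)[OF _ that])
    finally show ?thesis unfolding K1[symmetric] by (simp only: mult.assoc)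
  qed
  have "norm (?T J v) \<le> fact (Suc n) * (1 + young_const) ^ Suc n * (\<Prod>j\<in>J. c j)" if "0 \<le> v" for v
  proof -
    \<comment> \<open>Since the primitives vanish at 0 and \<omega> \<le> 1, the increment bound
      from 0 is also a bound for the supremum, with the same constant.\<close>
    have "?T J 0 = 0" unfolding rec by (auto intro!: sum.neutral)
    then have "norm (?T J v) \<le> fact (Suc n) * (1 + young_const) ^ Suc n * (\<Prod>j\<in>J. c j) * \<omega> 0 v powr \<kappa>"
      using diff[of 0 v] that by simp
    also have "\<dots> \<le> fact (Suc n) * (1 + young_const) ^ Suc n * (\<Prod>j\<in>J. c j) * 1"
      using young_const_nonneg Suc.prems(2) le_1[of 0 v] nonneg[of 0 v] that kappa
      by (intro mult_left_mono powr_le1 mult_nonneg_nonneg prod_nonneg) auto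
    finally show ?thesis by simp
  qed
  moreover have "continuous_on {0..} (?T J)"
    unfolding rec by (intro continuous_on_sum piece(1))
  ultimately show ?case using diff by blast
qed

end

section \<open>Chaining along dyadic intervals\<close>

text \<open>The series is a dyadic Besov-type seminorm of \<open>Y\<close>. The range
  \<open>i < 2^m - 1\<close> omits the last cell of each level, because its right end is 1, outside
  the domain of continuity; the point 1 stands for time infinity.\<close>

locale dyadic_energy =
  fixes Y :: "real \<Rightarrow> complex" and \<theta> q :: real
  assumes theta: "0 < \<theta>" and q: "0 < q" and cont: "continuous_on {0..<1} Y"
    and summable_total: "summable (\<lambda>m. \<Sum>i<2^m - 1. (2^m) powr (\<theta> * q) *
      norm (Y (real (Suc i) / 2^m) - Y (real i / 2^m)) powr q)"
begin

abbreviation cell :: "nat \<Rightarrow> nat \<Rightarrow> real" where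
  "cell m i \<equiv> (2^m) powr (\<theta> * q) * norm (Y (real (Suc i) / 2^m) - Y (real i / 2^m)) powr q"

text \<open>Counting only cells that lie inside [u, v] makes the energy superadditive: cells
  straddling a division point are dropped.\<close>

definition energy :: "real \<Rightarrow> real \<Rightarrow> real" where
  "energy u v = (\<Sum>m. \<Sum>i<2^m - 1. if u \<le> real i / 2^m \<and> real (Suc i) / 2^m \<le> v then cell m i else 0)"

lemma summable_energy:
  "summable (\<lambda>m. \<Sum>i<2^m - 1. if u \<le> real i / 2^m \<and> real (Suc i) / 2^m \<le> v then cell m i else 0)"
proof (rule summable_comparison_test_ev[OF _ summable_total], rule always_eventually, rule allI)
  fix m :: nat
  show "norm (\<Sum>i<2^m - 1. if u \<le> real i / 2^m \<and> real (Suc i) / 2^m \<le> v then cell m i else 0)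
    \<le> (\<Sum>i<2^m - 1. cell m i)"
    by (rule order_trans[OF norm_sum sum_mono]) auto
qed

lemma energy_nonneg: "0 \<le> energy u v"
  unfolding energy_def by (intro suminf_nonneg summable_energy sum_nonneg) auto

lemma energy_le_total: "energy u v \<le> (\<Sum>m. \<Sum>i<2^m - 1. cell m i)"
  unfolding energy_def by (intro suminf_le summable_energy summable_total sum_mono) auto

lemma energy_super:
  assumes "u \<le> w" "w \<le> v" shows "energy u w + energy w v \<le> energy u v"
  unfolding energy_def suminf_add[OF summable_energy summable_energy] sum.distrib[symmetric]
proof (intro suminf_le summable_energy sum_mono)
  fix m i :: nat
  \<comment> \<open>A cell has positive length, so it cannot lie on both sides of \<open>w\<close>
    and is counted at most once on the left.\<close>
  have "real i / 2^m < real (Suc i) / 2^m" by (intro divide_strict_right_mono) auto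
  then show "(if u \<le> real i / 2^m \<and> real (Suc i) / 2^m \<le> w then cell m i else 0) +
    (if w \<le> real i / 2^m \<and> real (Suc i) / 2^m \<le> v then cell m i else 0)
    \<le> (if u \<le> real i / 2^m \<and> real (Suc i) / 2^m \<le> v then cell m i else 0)"
    using assms by (auto simp del: of_nat_Suc)
qed (simp only: sum.distrib, intro summable_add summable_energy)

lemma increment_le:
  assumes "u \<le> real i / 2^m" "real (Suc i) / 2^m \<le> v" "v < 1"
  shows "norm (Y (real (Suc i) / 2^m) - Y (real i / 2^m)) \<le> (1 / 2^m) powr \<theta> * energy u v powr (1 / q)"
proof -
  let ?n = "norm (Y (real (Suc i) / 2^m) - Y (real i / 2^m))"
  \<comment> \<open>\<open>v < 1\<close> excludes the omitted last cell, so this cell does occur in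
    the energy.\<close>
  have "real (Suc i) / 2^m < 1" using assms by linarith
  then have "real (Suc i) < real (2^m)" by (simp add: pos_divide_less_eq del: of_nat_Suc)
  then have i: "i < 2^m - 1" unfolding of_nat_less_iff by simp
  have "cell m i \<le> (\<Sum>i<2^m - 1. if u \<le> real i / 2^m \<and> real (Suc i) / 2^m \<le> v then cell m i else 0)"
    using assms i member_le_sum[of i "{..<2^m - 1}" "\<lambda>i. if u \<le> real i / 2^m \<and> real (Suc i) / 2^m \<le> v then cell m i else 0"]
    by (simp del: of_nat_Suc)
  also have "\<dots> \<le> energy u v"
    unfolding energy_def
    using sum_le_suminf[OF summable_energy, of "{m}" u v] by (simp add: sum_nonneg del: of_nat_Suc)
  finally have "cell m i powr (1 / q) \<le> energy u v powr (1 / q)"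
    using q by (intro powr_mono2) auto
  moreover have "cell m i powr (1 / q) = (2^m) powr \<theta> * ?n"
    using q by (simp add: powr_mult powr_powr del: of_nat_Suc)
  ultimately have "(2^m) powr \<theta> * ?n \<le> energy u v powr (1 / q)" by simp
  then have "(1 / 2^m) powr \<theta> * ((2^m) powr \<theta> * ?n) \<le> (1 / 2^m) powr \<theta> * energy u v powr (1 / q)"
    by (rule mult_left_mono) simp
  moreover have "(1 / 2^m) powr \<theta> * (2^m) powr \<theta> = (1::real)"
    by (subst powr_mult[symmetric]) auto
  ultimately show ?thesis by (simp add: mult.assoc[symmetric] del: of_nat_Suc)
qed

text \<open>Telescoping along the approximations. The cut-off in \<open>step\<close> removes all
  scales coarser than \<tau>, so the geometric sum is governed by \<tau> and the starting level
  \<open>k\<close> leaves no trace in the bound.\<close>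

lemma chain_limit:
  assumes w: "\<And>m. k \<le> m \<Longrightarrow> 0 \<le> w m \<and> w m < 1" and lim: "w \<longlonglongrightarrow> x" "0 \<le> x" "x < 1" and "0 \<le> \<tau>" "0 \<le> c"
    and step: "\<And>m. k \<le> m \<Longrightarrow>
      norm (Y (w (Suc m)) - Y (w m)) \<le> c * (if 1 / 2^Suc m \<le> \<tau> then (1 / 2^Suc m) powr \<theta> else 0)"
  shows "norm (Y x - Y (w k)) \<le> c * (\<tau> powr \<theta> / (1 - 2 powr - \<theta>))"
proof -
  let ?a = "\<lambda>m. if 1 / 2^m \<le> \<tau> then (1 / 2^m) powr \<theta> else (0::real)"
  have r: "2 powr - \<theta> < (1::real)" using theta powr_less_mono[of "-\<theta>" 0 2] by simp
  have tele: "norm (Y (w (k + n)) - Y (w k)) \<le> c * (\<Sum>m<n. ?a (Suc (k + m)))" for n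
  proof (induction n)
    case (Suc n)
    have "norm (Y (w (Suc (k + n))) - Y (w k))
      \<le> norm (Y (w (Suc (k + n))) - Y (w (k + n))) + norm (Y (w (k + n)) - Y (w k))"
      using norm_triangle_ineq[of "Y (w (Suc (k + n))) - Y (w (k + n))" "Y (w (k + n)) - Y (w k)"] by simp
    also have "\<dots> \<le> c * ?a (Suc (k + n)) + c * (\<Sum>m<n. ?a (Suc (k + m)))"
      using Suc.IH step[of "k + n"] by (intro add_mono) auto
    finally show ?case by (simp add: algebra_simps)
  qed simp
  have bound: "norm (Y (w (k + n)) - Y (w k)) \<le> c * (\<tau> powr \<theta> / (1 - 2 powr - \<theta>))" for n
  proof -
    \<comment> \<open>The levels up to \<open>k\<close> are added so that the sum starts at scale 1,
      where the truncated geometric series is known.\<close>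
    have "(\<Sum>m<Suc k + n. ?a m) = (\<Sum>m<Suc k. ?a m) + (\<Sum>m<n. ?a (Suc (k + m)))"
      using sum_lessThan_add[of ?a "Suc k" n] by (simp only: add_Suc)
    moreover have "0 \<le> (\<Sum>m<Suc k. ?a m)" by (intro sum_nonneg) auto
    ultimately have "(\<Sum>m<n. ?a (Suc (k + m))) \<le> (\<Sum>m<Suc k + n. ?a m)" by linarith
    also have "\<dots> \<le> min \<tau> 1 powr \<theta> / (1 - 2 powr - \<theta>)"
      using dyadic_powr_sum_le[of 1 \<theta> \<tau> "Suc k + n"] theta assms by simp
    also have "\<dots> \<le> \<tau> powr \<theta> / (1 - 2 powr - \<theta>)"
      using r theta assms by (intro divide_right_mono powr_mono2) auto
    finally show ?thesis
      using order_trans[OF tele[of n] mult_left_mono[OF _ \<open>0 \<le> c\<close>]] by blast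
  qed
  have "(\<lambda>n. Y (w (k + n))) \<longlonglongrightarrow> Y x"
  proof -
    have "(\<lambda>n. w (k + n)) \<longlonglongrightarrow> x"
      using LIMSEQ_ignore_initial_segment[OF lim(1), of k] by (simp add: add.commute)
    then show ?thesis
      using cont[unfolded continuous_on_sequentially, rule_format, of x "\<lambda>n. w (k + n)"] w lim
      by (auto simp: comp_def)
  qed
  then have "(\<lambda>n. norm (Y (w (k + n)) - Y (w k))) \<longlonglongrightarrow> norm (Y x - Y (w k))"
    by (intro tendsto_intros)
  then show ?thesis by (rule LIMSEQ_le_const2) (use bound in auto)
qed

lemma dyadic_floor_tendsto: "(\<lambda>m. of_int \<lfloor>x * 2^m\<rfloor> / 2^m) \<longlonglongrightarrow> (x::real)"
proof (rule tendsto_sandwich[of "\<lambda>m. x - (1/2)^m" _ _ "\<lambda>m. x"])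
  show "\<forall>\<^sub>F m in sequentially. x - (1/2)^m \<le> of_int \<lfloor>x * 2^m\<rfloor> / 2^m"
  proof (rule always_eventually, rule allI)
    fix m :: nat
    have "x * 2^m - 1 \<le> of_int \<lfloor>x * 2^m\<rfloor>" by linarith
    then have "(x * 2^m - 1) / 2^m \<le> of_int \<lfloor>x * 2^m\<rfloor> / 2^m" by (intro divide_right_mono) auto
    then show "x - (1/2)^m \<le> of_int \<lfloor>x * 2^m\<rfloor> / 2^m" by (simp add: diff_divide_distrib power_divide)
  qed
  show "\<forall>\<^sub>F m in sequentially. of_int \<lfloor>x * 2^m\<rfloor> / 2^m \<le> x"
    by (intro always_eventually) (auto simp: divide_le_eq)
  have "(\<lambda>m. x - (1/2)^m) \<longlonglongrightarrow> x - 0" by (intro tendsto_intros LIMSEQ_power_zero) auto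
  then show "(\<lambda>m. x - (1/2)^m) \<longlonglongrightarrow> x" by simp
qed auto

lemma dyadic_ceiling_tendsto: "(\<lambda>m. of_int \<lceil>x * 2^m\<rceil> / 2^m) \<longlonglongrightarrow> (x::real)"
proof -
  have "(\<lambda>m. - (of_int \<lfloor>(- x) * 2^m\<rfloor> / 2^m)) \<longlonglongrightarrow> - (- x)"
    by (intro tendsto_minus dyadic_floor_tendsto)
  then show ?thesis by (simp add: ceiling_def)
qed

text \<open>At the coarsest level with a dyadic point in [u, v] there is exactly one such point.
  Floors for \<open>v\<close> and ceilings for \<open>u\<close> then give two chains from this
  common point, whose cells all stay inside [u, v]; hence only \<open>energy u v\<close> and scales
  up to \<open>v - u\<close> enter, and the factor 2 counts the chains.\<close>

lemma increment_le_energy: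
  assumes uv: "0 \<le> u" "u \<le> v" "v < 1"
  shows "norm (Y v - Y u) \<le> 2 / (1 - 2 powr - \<theta>) * (energy u v powr (1 / q) * (v - u) powr \<theta>)"
proof (cases "u = v")
  case True then show ?thesis by simp
next
  case False
  then have "u < v" using uv by simp
  let ?c = "energy u v powr (1 / q)"
  let ?D = "(v - u) powr \<theta> / (1 - 2 powr - \<theta>)"
  define P where "P m \<longleftrightarrow> \<lceil>u * 2^m\<rceil> \<le> \<lfloor>v * 2^m\<rfloor>" for m :: nat
  obtain m1 where "P m1"
  proof -
    obtain m :: nat where "1 / (v - u) < 2^m" using real_arch_pow[of 2 "1 / (v - u)"] by auto
    then have "1 < v * 2^m - u * 2^m" using \<open>u < v\<close> by (simp add: field_simps)
    then have "P m" unfolding P_def by linarith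
    then show ?thesis using that by blast
  qed
  define k where "k = (LEAST m. P m)"
  have Pk: "P k" unfolding k_def by (rule LeastI) fact
  have min: "\<not> P m" if "m < k" for m using that not_less_Least unfolding k_def by blast
  \<comment> \<open>Among two consecutive integers one is even, and its half would be a dyadic point
    of the coarser level, against minimality. At level 0 the only candidate in [0, 1) is 0.\<close>
  have single: "\<lceil>u * 2^k\<rceil> = \<lfloor>v * 2^k\<rfloor>"
  proof (cases k)
    case 0
    have "\<lfloor>v\<rfloor> \<le> 0" "0 \<le> \<lceil>u\<rceil>" using uv by linarith+
    moreover have "\<lceil>u\<rceil> \<le> \<lfloor>v\<rfloor>" using Pk 0 by (simp add: P_def)
    ultimately have "\<lceil>u\<rceil> = \<lfloor>v\<rfloor>" by linarith
    then show ?thesis using 0 by simp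
  next
    case (Suc m)
    show ?thesis
    proof (rule ccontr)
      assume "\<not> ?thesis"
      then have lt: "\<lceil>u * 2^k\<rceil> < \<lfloor>v * 2^k\<rfloor>" using Pk by (simp add: P_def)
      \<comment> \<open>\<open>2 * e\<close> is the even one of the first two integers in the
        range.\<close>
      define e where "e = (\<lceil>u * 2^k\<rceil> + 1) div 2"
      have "\<lceil>u * 2^k\<rceil> \<le> 2 * e" "2 * e \<le> \<lfloor>v * 2^k\<rfloor>" using lt unfolding e_def by linarith+
      then have "u * 2^k \<le> of_int (2 * e)" "of_int (2 * e) \<le> v * 2^k"
        by (simp_all only: ceiling_le_iff le_floor_iff)
      then have "u * 2^m \<le> of_int e" "of_int e \<le> v * 2^m" using Suc by simp_all
      then have "P m" unfolding P_def by (meson ceiling_le_iff le_floor_iff order_trans)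
      then show False using min[of m] Suc by simp
    qed
  qed
  have down: "P m \<Longrightarrow> P (Suc m)" for m
  proof -
    assume "P m"
    then have *: "u * 2^m \<le> of_int \<lfloor>v * 2^m\<rfloor>" "of_int \<lfloor>v * 2^m\<rfloor> \<le> v * 2^m"
      unfolding P_def by linarith+
    then have "u * 2^Suc m \<le> of_int (2 * \<lfloor>v * 2^m\<rfloor>)" "of_int (2 * \<lfloor>v * 2^m\<rfloor>) \<le> v * 2^Suc m"
      by simp_all
    then show "P (Suc m)" unfolding P_def by (meson ceiling_le_iff le_floor_iff order_trans)
  qed
  have PP: "P m" if "k \<le> m" for m using that Pk by (induction m rule: dec_induct) (auto intro: down)
  \<comment> \<open>A cell contained in [u, v] has length at most \<open>v - u\<close>, so the
    cut-off required for chaining holds by itself.\<close>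
  have cell_step: "norm (Y (of_int (a + 1) / 2^Suc m) - Y (of_int a / 2^Suc m))
      \<le> ?c * (if 1 / 2^Suc m \<le> v - u then (1 / 2^Suc m) powr \<theta> else 0)"
    if "u * 2^Suc m \<le> of_int a" "of_int (a + 1) \<le> v * 2^Suc m" for a :: int and m
  proof -
    have "0 \<le> u * 2^Suc m" using uv by simp
    then have "0 \<le> a" using that(1) by linarith
    then obtain i where i: "a = int i" using nonneg_int_cases by blast
    have 1: "u \<le> real i / 2^Suc m" using that(1) unfolding i by (simp add: pos_le_divide_eq del: power_Suc)
    have 2: "real (Suc i) / 2^Suc m \<le> v" using that(2) unfolding i by (simp add: pos_divide_le_eq add.commute del: power_Suc)
    have "1 / 2^Suc m = real (Suc i) / 2^Suc m - real i / 2^Suc m"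
      by (simp add: diff_divide_distrib[symmetric] del: power_Suc)
    then have 3: "1 / 2^Suc m \<le> v - u" using 1 2 by simp
    have "norm (Y (real (Suc i) / 2^Suc m) - Y (real i / 2^Suc m)) \<le> (1 / 2^Suc m) powr \<theta> * ?c"
      by (rule increment_le[OF 1 2 uv(3)])
    then show ?thesis using 3 unfolding i by (simp add: mult.commute add.commute del: power_Suc)
  qed
  have in_range: "0 \<le> of_int a / (2::real)^m \<and> of_int a / (2::real)^m < 1"
    if "u * 2^m \<le> of_int a" "of_int a \<le> v * 2^m" for a :: int and m
  proof -
    have "u \<le> of_int a / 2^m" "of_int a / 2^m \<le> v"
      using that by (simp_all add: pos_le_divide_eq pos_divide_le_eq)
    then show ?thesis using uv by linarith
  qed
  have right: "norm (Y v - Y (of_int \<lfloor>v * 2^k\<rfloor> / 2^k)) \<le> ?c * ?D"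
  proof (rule chain_limit[where w = "\<lambda>m. of_int \<lfloor>v * 2^m\<rfloor> / 2^m"])
    fix m assume "k \<le> m"
    then have *: "u * 2^m \<le> of_int \<lfloor>v * 2^m\<rfloor>" "of_int \<lfloor>v * 2^m\<rfloor> \<le> v * 2^m"
      using PP[of m] unfolding P_def by linarith+
    show "0 \<le> of_int \<lfloor>v * 2^m\<rfloor> / (2::real)^m \<and> of_int \<lfloor>v * 2^m\<rfloor> / (2::real)^m < 1"
      by (rule in_range[OF *])
    let ?a = "2 * \<lfloor>v * 2^m\<rfloor>"
    have vm: "v * 2^Suc m = 2 * (v * 2^m)" by simp
    \<comment> \<open>One refinement either keeps the approximation or moves it across a single
      cell; in the first case the increment is 0.\<close>
    have "\<lfloor>v * 2^Suc m\<rfloor> = ?a \<or> \<lfloor>v * 2^Suc m\<rfloor> = ?a + 1" unfolding vm by linarith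
    moreover have "of_int ?a / 2^Suc m = of_int \<lfloor>v * 2^m\<rfloor> / (2::real)^m" by simp
    moreover have "u * 2^Suc m \<le> of_int ?a" using *(1) by simp
    ultimately show "norm (Y (of_int \<lfloor>v * 2^Suc m\<rfloor> / 2^Suc m) - Y (of_int \<lfloor>v * 2^m\<rfloor> / 2^m))
      \<le> ?c * (if 1 / 2^Suc m \<le> v - u then (1 / 2^Suc m) powr \<theta> else 0)"
      using cell_step[of m ?a] by (smt (verit) diff_self norm_zero of_int_floor_le mult_nonneg_nonneg powr_ge_zero)
  qed (use uv dyadic_floor_tendsto in auto)
  have left: "norm (Y u - Y (of_int \<lceil>u * 2^k\<rceil> / 2^k)) \<le> ?c * ?D"
  proof (rule chain_limit[where w = "\<lambda>m. of_int \<lceil>u * 2^m\<rceil> / 2^m"])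
    fix m assume "k \<le> m"
    then have *: "u * 2^m \<le> of_int \<lceil>u * 2^m\<rceil>" "of_int \<lceil>u * 2^m\<rceil> \<le> v * 2^m"
      using PP[of m] unfolding P_def by linarith+
    show "0 \<le> of_int \<lceil>u * 2^m\<rceil> / (2::real)^m \<and> of_int \<lceil>u * 2^m\<rceil> / (2::real)^m < 1"
      by (rule in_range[OF *])
    let ?a = "2 * \<lceil>u * 2^m\<rceil>"
    have um: "u * 2^Suc m = 2 * (u * 2^m)" by simp
    have "\<lceil>u * 2^Suc m\<rceil> = ?a \<or> \<lceil>u * 2^Suc m\<rceil> = ?a - 1" unfolding um by linarith
    moreover have "of_int ?a / 2^Suc m = of_int \<lceil>u * 2^m\<rceil> / (2::real)^m" by simp
    moreover have "of_int ?a \<le> v * 2^Suc m" using *(2) by simp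
    ultimately show "norm (Y (of_int \<lceil>u * 2^Suc m\<rceil> / 2^Suc m) - Y (of_int \<lceil>u * 2^m\<rceil> / 2^m))
      \<le> ?c * (if 1 / 2^Suc m \<le> v - u then (1 / 2^Suc m) powr \<theta> else 0)"
      using cell_step[of m "?a - 1"]
      by (smt (verit) diff_self norm_zero le_of_int_ceiling mult_nonneg_nonneg powr_ge_zero norm_minus_commute)
  qed (use uv dyadic_ceiling_tendsto in auto)
  have "norm (Y v - Y u) \<le> norm (Y v - Y (of_int \<lfloor>v * 2^k\<rfloor> / 2^k)) + norm (Y u - Y (of_int \<lceil>u * 2^k\<rceil> / 2^k))"
    unfolding single
    using norm_triangle_ineq4[of "Y v - Y (of_int \<lfloor>v * 2^k\<rfloor> / 2^k)" "Y u - Y (of_int \<lfloor>v * 2^k\<rfloor> / 2^k)"] by simp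
  then show ?thesis using left right by simp
qed

end

section \<open>Interpolation for bounded kernels\<close>

lemma ennreal_le_suminf: "a i \<le> suminf a" for a :: "nat \<Rightarrow> ennreal"
  using sum_le_suminf[of a "{i}"] by (simp add: summableI)

text \<open>The two endpoints of the interpolation: L1 into bounded functions with constant
  \<open>B\<close>, and L2 into L2. \<open>C2\<close> compares squared norms, so it plays the part
  of the square of an operator norm.\<close>

locale bounded_kernel = sigma_finite_measure M for M :: "'b measure" +
  fixes N :: "'l measure" and k :: "'l \<Rightarrow> 'b \<Rightarrow> complex" and B C2 :: real
  assumes k_measurable [measurable]: "(\<lambda>p. k (fst p) (snd p)) \<in> borel_measurable (N \<Otimes>\<^sub>M M)"
    and k_bound: "l \<in> space N \<Longrightarrow> x \<in> space M \<Longrightarrow> norm (k l x) \<le> B"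
    and B: "0 < B" and C2: "0 < C2"
    and L2: "integrable M f \<Longrightarrow>
      (\<integral>\<^sup>+l. ennreal ((norm (\<integral>x. k l x * f x \<partial>M))\<^sup>2) \<partial>N) \<le> ennreal C2 * (\<integral>\<^sup>+x. ennreal ((norm (f x))\<^sup>2) \<partial>M)"
begin

definition K :: "('b \<Rightarrow> complex) \<Rightarrow> 'l \<Rightarrow> complex" where
  "K f l = (\<integral>x. k l x * f x \<partial>M)"

lemma K_measurable:
  assumes [measurable]: "f \<in> borel_measurable M"
  shows "K f \<in> borel_measurable N"
proof -
  have "(\<lambda>l. \<integral>x. k l x * f x \<partial>M) \<in> borel_measurable N"
    by (rule borel_measurable_lebesgue_integral) (simp add: case_prod_beta')
  then show ?thesis by (simp add: K_def[abs_def])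
qed

lemma integrable_kernel_mult:
  assumes f: "integrable M f" and l: "l \<in> space N"
  shows "integrable M (\<lambda>x. k l x * f x)"
proof (rule Bochner_Integration.integrable_bound)
  show "integrable M (\<lambda>x. complex_of_real B * f x)" using f by simp
  have "(\<lambda>x. k l x) \<in> borel_measurable M"
    using measurable_compose[OF measurable_Pair1'[OF l] k_measurable] by simp
  then show "(\<lambda>x. k l x * f x) \<in> borel_measurable M" using f by measurable
  show "AE x in M. norm (k l x * f x) \<le> norm (complex_of_real B * f x)"
    using k_bound[OF l] B by (intro AE_I2) (auto simp: norm_mult intro!: mult_right_mono)
qed

lemma norm_K_le:
  assumes f: "integrable M f" and l: "l \<in> space N"
  shows "norm (K f l) \<le> B * (\<integral>x. norm (f x) \<partial>M)"
proof -
  have "norm (K f l) \<le> (\<integral>x. B * norm (f x) \<partial>M)"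
    unfolding K_def
    by (rule order_trans[OF integral_norm_bound integral_mono])
       (use integrable_norm[OF integrable_kernel_mult[OF f l]] integrable_kernel_mult[OF f l] f k_bound[OF l] in \<open>auto simp: norm_mult intro!: mult_right_mono\<close>)
  then show ?thesis by simp
qed

text \<open>On the level set where \<open>K f\<close> has size about \<open>T / 2^i\<close> only the part of \<open>f\<close> below a height
  depending on \<open>i\<close> matters, since the remaining part contributes at most \<open>T / 2^(i + 2)\<close> in the
  supremum norm.\<close>

theorem interpolation:
  assumes q: "2 < q" and p: "p = q / (q - 1)"
    and f: "integrable M f" and fp: "integrable M (\<lambda>x. norm (f x) powr p)"
  shows "(\<integral>\<^sup>+l. ennreal (norm (K f l) powr q) \<partial>N)
    \<le> ennreal (16 * C2 * (4 * B) powr (q - 2) / (1 - 2 powr (2 - q)) * (\<integral>x. norm (f x) powr p \<partial>M) powr (q - 1))"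
proof -
  have [measurable]: "f \<in> borel_measurable M" using f by simp
  have p1: "1 < p" using q unfolding p by (simp add: less_divide_eq)
  \<comment> \<open>The exponent that results when the sum over the layers, a multiple of |f|^((1 -
    p)(q - 2)), is multiplied by |f|^2.\<close>
  have pq: "2 + (1 - p) * (q - 2) = p" using q unfolding p by (simp add: field_simps)
  define A where "A = (\<integral>x. norm (f x) powr p \<partial>M)"
  define T where "T = B * (\<integral>x. norm (f x) \<partial>M)"
  have T0: "0 \<le> T" unfolding T_def using B by (intro mult_nonneg_nonneg integral_nonneg_AE) auto
  show ?thesis
  proof (cases "T = 0")
    case True
    have "(\<integral>\<^sup>+l. ennreal (norm (K f l) powr q) \<partial>N) = (\<integral>\<^sup>+l. 0 \<partial>N)"
      by (rule nn_integral_cong) (use norm_K_le[OF f] True in \<open>auto simp: T_def[symmetric]\<close>)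
    then show ?thesis by simp
  next
    case False
    then have T: "0 < T" using T0 by simp
    have "A \<noteq> 0"
    proof
      assume "A = 0"
      then have "AE x in M. norm (f x) powr p = 0"
        unfolding A_def using fp by (subst (asm) integral_nonneg_eq_0_iff_AE) auto
      then have "AE x in M. norm (f x) = 0" by eventually_elim auto
      then have "(\<integral>x. norm (f x) \<partial>M) = 0" by (intro integral_eq_zero_AE) auto
      then show False using False by (simp add: T_def)
    qed
    then have A: "0 < A" unfolding A_def by (simp add: less_le integral_nonneg_AE)
    define t where "t i = T / 2^i" for i :: nat
    have t: "0 < t i" for i using T by (simp add: t_def)
    have t_Suc: "t (Suc i) = t i / 2" for i by (simp add: t_def)
    \<comment> \<open>The threshold is set so that on the complement |f| \<le> t_i |f|^p / (4 B A),
      which gives the tall part L1 norm at most t_i / (4 B). The product form avoids a negative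
      power where \<open>f\<close> vanishes.\<close>
    define small where "small i x \<longleftrightarrow> t i * norm (f x) powr (p - 1) \<le> 4 * B * A" for i x
    have [measurable]: "Measurable.pred M (small i)" for i unfolding small_def by measurable
    define S where "S i x = (if small i x then f x else 0)" for i x
    define L where "L i x = (if \<not> small i x then f x else 0)" for i x
    have S: "integrable M (S i)" and L: "integrable M (L i)" for i
      unfolding S_def L_def by (intro integrable_if f; measurable)+
    have L_le: "norm (K (L i) l) \<le> t i / 4" if l: "l \<in> space N" for i l
    proof -
      have "(\<integral>x. norm (L i x) \<partial>M) \<le> (\<integral>x. t i / (4 * B * A) * norm (f x) powr p \<partial>M)"
      proof (rule integral_mono)
        fix x
        show "norm (L i x) \<le> t i / (4 * B * A) * norm (f x) powr p"
        proof (cases "small i x")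
          case True
          then show ?thesis using t[of i] A B by (simp add: L_def)
        next
          case ns: False
          then have "norm (f x) * (4 * B * A) \<le> norm (f x) * (t i * norm (f x) powr (p - 1))"
            unfolding small_def by (intro mult_left_mono) auto
          also have "norm (f x) * norm (f x) powr (p - 1) = norm (f x) powr p"
            using p1 by (cases "f x = 0") (auto simp: powr_mult_base)
          then have "norm (f x) * (t i * norm (f x) powr (p - 1)) = t i * norm (f x) powr p"
            by (simp add: mult.left_commute)
          finally show ?thesis using ns A B by (simp add: L_def pos_le_divide_eq)
        qed
      qed (use L fp in auto)
      also have "\<dots> = t i / (4 * B)" using A by (simp add: A_def[symmetric])
      finally have "B * (\<integral>x. norm (L i x) \<partial>M) \<le> t i / 4" using B by (simp add: field_simps)
      then show ?thesis using norm_K_le[OF L l, of i] by simp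
    qed
    have pointwise: "ennreal (norm (K f l) powr q) \<le> (\<Sum>i. ennreal (16 * t i powr (q - 2) * (norm (K (S i) l))\<^sup>2))"
      if l: "l \<in> space N" for l
    proof (cases "K f l = 0")
      case False
      have "norm (K f l) \<le> t 0" using norm_K_le[OF f l] by (simp add: t_def T_def)
      obtain m where m: "t m < norm (K f l)"
      proof -
        have "(\<lambda>m. T * (1/2)^m) \<longlonglongrightarrow> T * 0" by (intro tendsto_intros LIMSEQ_power_zero) auto
        then have "eventually (\<lambda>m. T * (1/2)^m < norm (K f l)) sequentially"
          using False by (intro order_tendstoD(2)[where y = "T * 0"]) auto
        then show ?thesis using that by (auto simp: eventually_sequentially t_def power_divide)
      qed
      \<comment> \<open>The layer of \<open>l\<close>: by minimality t_(i+1) < |K f l| \<le>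
        t_i.\<close>
      define i where "i = (LEAST m. t (Suc m) < norm (K f l))"
      have "t (Suc m) < norm (K f l)"
        using m t[of m] t_Suc[of m] by linarith
      then have i: "t (Suc i) < norm (K f l)" unfolding i_def by (rule LeastI)
      have ti: "norm (K f l) \<le> t i"
      proof (cases i)
        case 0 then show ?thesis using \<open>norm (K f l) \<le> t 0\<close> by simp
      next
        case (Suc j)
        then show ?thesis using not_less_Least[of j "\<lambda>m. t (Suc m) < norm (K f l)"] by (simp add: i_def not_less)
      qed
      have "K f l = (\<integral>x. k l x * S i x + k l x * L i x \<partial>M)"
        unfolding K_def by (intro Bochner_Integration.integral_cong) (auto simp: S_def L_def)
      also have "\<dots> = K (S i) l + K (L i) l"
        unfolding K_def
        by (intro Bochner_Integration.integral_add integrable_kernel_mult S L l)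
      finally have "norm (K f l) \<le> norm (K (S i) l) + norm (K (L i) l)"
        using norm_triangle_ineq by metis
      \<comment> \<open>From t_i / 2 < |K f l| the tall part takes away at most t_i / 4. Squaring
        the remaining quarter is the source of the factor 16.\<close>
      then have KS: "t i / 4 \<le> norm (K (S i) l)"
        using i L_le[OF l, of i] t_Suc[of i] by linarith
      have "norm (K f l) powr q \<le> t i powr q" using ti q by (intro powr_mono2) auto
      also have "\<dots> = t i powr (q - 2) * (t i)\<^sup>2"
        using t[of i] by (simp add: powr_diff)
      also have "\<dots> = 16 * t i powr (q - 2) * (t i / 4)\<^sup>2"
        by (simp add: power_divide)
      also have "\<dots> \<le> 16 * t i powr (q - 2) * (norm (K (S i) l))\<^sup>2"
        using KS t[of i] by (intro mult_left_mono power_mono) auto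
      finally have "ennreal (norm (K f l) powr q) \<le> ennreal (16 * t i powr (q - 2) * (norm (K (S i) l))\<^sup>2)"
        by (rule ennreal_leI)
      also have "\<dots> \<le> (\<Sum>i. ennreal (16 * t i powr (q - 2) * (norm (K (S i) l))\<^sup>2))"
        by (rule ennreal_le_suminf)
      finally show ?thesis .
    qed simp
    have [measurable]: "S i \<in> borel_measurable M" for i using S by simp
    have [measurable]: "K (S i) \<in> borel_measurable N" for i by (rule K_measurable) simp
    define G where "G = (4 * B * A) powr (q - 2) / (1 - 2 powr (2 - q))"
    have r: "2 powr (2 - q) < (1::real)" using q powr_less_mono[of "2 - q" 0 2] by simp
    have G: "0 \<le> G" unfolding G_def using r by simp
    \<comment> \<open>For fixed \<open>x\<close> the layers that see \<open>f x\<close> are those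
      with \<open>t i\<close> below a threshold depending on |f x|. Their powers form a truncated
      geometric series, whose bound does not depend on \<open>T\<close>.\<close>
    have height: "(\<Sum>i. ennreal (t i powr (q - 2) * (norm (S i x))\<^sup>2)) \<le> ennreal (G * norm (f x) powr p)" for x
    proof (cases "f x = 0")
      case True
      then have "S i x = 0" for i by (simp add: S_def)
      then show ?thesis by simp
    next
      case False
      then have fx: "0 < norm (f x)" by simp
      let ?\<tau> = "4 * B * A * norm (f x) powr (1 - p)"
      have eq: "small i x \<longleftrightarrow> t i \<le> ?\<tau>" for i
      proof -
        have "t i \<le> ?\<tau> \<longleftrightarrow> t i * norm (f x) powr (p - 1) \<le> ?\<tau> * norm (f x) powr (p - 1)"
          by (rule mult_le_cancel_right_pos[symmetric]) (use fx in simp)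
        also have "norm (f x) powr (1 - p) * norm (f x) powr (p - 1) = 1"
          using fx by (simp add: powr_add[symmetric])
        then have "?\<tau> * norm (f x) powr (p - 1) = 4 * B * A" by (simp add: mult.assoc)
        finally show ?thesis by (simp add: small_def)
      qed
      have fin: "(\<Sum>i<n. t i powr (q - 2) * (norm (S i x))\<^sup>2) \<le> G * norm (f x) powr p" for n
      proof -
        have "(\<Sum>i<n. t i powr (q - 2) * (norm (S i x))\<^sup>2) =
            (\<Sum>i<n. if T / 2^i \<le> ?\<tau> then (T / 2^i) powr (q - 2) else 0) * (norm (f x))\<^sup>2"
          unfolding sum_distrib_right by (intro sum.cong) (auto simp: S_def eq t_def)
        also have "\<dots> \<le> (min ?\<tau> T powr (q - 2) / (1 - 2 powr - (q - 2))) * (norm (f x))\<^sup>2"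
          using q T A B by (intro mult_right_mono dyadic_powr_sum_le) auto
        also have "\<dots> \<le> (?\<tau> powr (q - 2) / (1 - 2 powr - (q - 2))) * (norm (f x))\<^sup>2"
          using q T A B r by (intro mult_right_mono divide_right_mono powr_mono2) auto
        also have "?\<tau> powr (q - 2) = (4 * B * A) powr (q - 2) * norm (f x) powr ((1 - p) * (q - 2))"
          using A B by (subst powr_mult) (auto simp: powr_powr)
        also have "(norm (f x))\<^sup>2 = norm (f x) powr 2" using fx by simp
        also have "(4 * B * A) powr (q - 2) * norm (f x) powr ((1 - p) * (q - 2)) / (1 - 2 powr - (q - 2)) * norm (f x) powr 2
          = G * (norm (f x) powr 2 * norm (f x) powr ((1 - p) * (q - 2)))"
          by (simp add: G_def)
        also have "norm (f x) powr 2 * norm (f x) powr ((1 - p) * (q - 2)) = norm (f x) powr p"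
          unfolding powr_add[symmetric] pq ..
        finally show ?thesis .
      qed
      show ?thesis
        unfolding suminf_eq_SUP
        by (intro SUP_least) (use fin in \<open>auto simp: sum_ennreal intro!: ennreal_leI\<close>)
    qed
    have "(\<integral>\<^sup>+l. ennreal (norm (K f l) powr q) \<partial>N)
      \<le> (\<integral>\<^sup>+l. (\<Sum>i. ennreal (16 * t i powr (q - 2) * (norm (K (S i) l))\<^sup>2)) \<partial>N)"
      by (rule nn_integral_mono) (rule pointwise)
    also have "\<dots> = (\<Sum>i. \<integral>\<^sup>+l. ennreal (16 * t i powr (q - 2) * (norm (K (S i) l))\<^sup>2) \<partial>N)"
      by (intro nn_integral_suminf) measurable
    also have "\<dots> \<le> (\<Sum>i. ennreal (16 * C2) * (\<integral>\<^sup>+x. ennreal (t i powr (q - 2) * (norm (S i x))\<^sup>2) \<partial>M))"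
    proof (intro suminf_le summableI)
      fix i
      have "(\<integral>\<^sup>+l. ennreal (16 * t i powr (q - 2) * (norm (K (S i) l))\<^sup>2) \<partial>N)
        = ennreal (16 * t i powr (q - 2)) * (\<integral>\<^sup>+l. ennreal ((norm (K (S i) l))\<^sup>2) \<partial>N)"
        by (subst nn_integral_cmult[symmetric]) (auto simp: ennreal_mult)
      also have "\<dots> \<le> ennreal (16 * t i powr (q - 2)) * (ennreal C2 * (\<integral>\<^sup>+x. ennreal ((norm (S i x))\<^sup>2) \<partial>M))"
        using L2[OF S, of i] by (intro mult_left_mono) (auto simp: K_def)
      also have "\<dots> = ennreal (16 * C2) * (ennreal (t i powr (q - 2)) * (\<integral>\<^sup>+x. ennreal ((norm (S i x))\<^sup>2) \<partial>M))"
        using C2 by (simp add: ennreal_mult mult_ac)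
      also have "ennreal (t i powr (q - 2)) * (\<integral>\<^sup>+x. ennreal ((norm (S i x))\<^sup>2) \<partial>M)
        = (\<integral>\<^sup>+x. ennreal (t i powr (q - 2) * (norm (S i x))\<^sup>2) \<partial>M)"
        by (subst nn_integral_cmult[symmetric]) (auto simp: ennreal_mult)
      finally show "(\<integral>\<^sup>+l. ennreal (16 * t i powr (q - 2) * (norm (K (S i) l))\<^sup>2) \<partial>N)
        \<le> ennreal (16 * C2) * (\<integral>\<^sup>+x. ennreal (t i powr (q - 2) * (norm (S i x))\<^sup>2) \<partial>M)" .
    qed
    also have "\<dots> = ennreal (16 * C2) * (\<integral>\<^sup>+x. (\<Sum>i. ennreal (t i powr (q - 2) * (norm (S i x))\<^sup>2)) \<partial>M)"
      unfolding ennreal_suminf_cmult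
      by (subst nn_integral_suminf) auto
    also have "\<dots> \<le> ennreal (16 * C2) * (\<integral>\<^sup>+x. ennreal (G * norm (f x) powr p) \<partial>M)"
      by (intro mult_left_mono nn_integral_mono height) simp
    also have "(\<integral>\<^sup>+x. ennreal (G * norm (f x) powr p) \<partial>M) = ennreal (G * A)"
      unfolding A_def using fp G by (subst nn_integral_eq_integral) auto
    also have "ennreal (16 * C2) * ennreal (G * A) = ennreal (16 * C2 * (G * A))"
      using C2 G A by (simp add: ennreal_mult[symmetric])
    also have "16 * C2 * (G * A) = 16 * C2 * (4 * B) powr (q - 2) / (1 - 2 powr (2 - q)) * A powr (q - 1)"
    proof -
      have "A powr (q - 1) = A powr (q - 2) * A"
        using A powr_add[of A "q - 2" 1] by simp
      moreover have "(4 * B * A) powr (q - 2) = (4 * B) powr (q - 2) * A powr (q - 2)"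
        using A B by (subst powr_mult[symmetric]) auto
      ultimately show ?thesis by (simp add: G_def)
    qed
    finally show ?thesis by (simp add: A_def)
  qed
qed

end

section \<open>Control of a single path\<close>

text \<open>Used to run a path by its clock. Continuity of the inverse comes from monotonicity and
  surjectivity, with no epsilon argument.\<close>

lemma ex_continuous_inverse:
  fixes \<Phi> :: "real \<Rightarrow> real"
  assumes cont: "continuous_on {0..} \<Phi>" and mono: "\<And>x y. 0 \<le> x \<Longrightarrow> x < y \<Longrightarrow> \<Phi> x < \<Phi> y"
    and \<Phi>0: "\<Phi> 0 = 0" and lt1: "\<And>x. 0 \<le> x \<Longrightarrow> \<Phi> x < 1"
    and unb: "\<And>u. u < 1 \<Longrightarrow> \<exists>x\<ge>0. u < \<Phi> x"
  obtains \<psi> where "continuous_on {0..<1} \<psi>" "\<And>x. 0 \<le> x \<Longrightarrow> \<psi> (\<Phi> x) = x"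
    "\<And>u. 0 \<le> u \<Longrightarrow> u < 1 \<Longrightarrow> 0 \<le> \<psi> u \<and> \<Phi> (\<psi> u) = u"
    "\<And>u v. 0 \<le> u \<Longrightarrow> u \<le> v \<Longrightarrow> v < 1 \<Longrightarrow> \<psi> u \<le> \<psi> v"
proof -
  have "\<exists>x\<ge>0. \<Phi> x = u" if u: "0 \<le> u" "u < 1" for u
  proof -
    obtain b where b: "0 \<le> b" "u < \<Phi> b" using unb[OF u(2)] by auto
    have "\<exists>x\<ge>0. x \<le> b \<and> \<Phi> x = u"
      by (rule IVT') (use b u \<Phi>0 in \<open>auto intro: continuous_on_subset[OF cont]\<close>)
    then show ?thesis by auto
  qed
  then obtain \<psi>0 where \<psi>0: "\<And>u. 0 \<le> u \<Longrightarrow> u < 1 \<Longrightarrow> 0 \<le> \<psi>0 u \<and> \<Phi> (\<psi>0 u) = u" by metis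
  \<comment> \<open>The identity on negative arguments makes the image the whole line, hence open,
    as the continuity criterion for monotone functions requires; this also settles the endpoint
    0.\<close>
  define \<psi> where "\<psi> u = (if u < 0 then u else \<psi>0 u)" for u
  have nn: "0 \<le> \<Phi> x" if "0 \<le> x" for x using mono[of 0 x] \<Phi>0 that by (cases "x = 0") auto
  have le: "x \<le> y" if "\<Phi> x \<le> \<Phi> y" "0 \<le> x" "0 \<le> y" for x y
    using mono[of y x] that by linarith
  have inv: "\<psi> (\<Phi> x) = x" if "0 \<le> x" for x
    using \<psi>0[OF nn lt1, of x] le[of "\<psi>0 (\<Phi> x)" x] le[of x "\<psi>0 (\<Phi> x)"] nn[OF that] that
    by (auto simp: \<psi>_def)
  have mon: "\<psi> u \<le> \<psi> v" if "u \<le> v" "v < 1" for u v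
  proof (cases "0 \<le> u")
    case True
    then show ?thesis using le[of "\<psi>0 u" "\<psi>0 v"] \<psi>0[of u] \<psi>0[of v] that by (simp add: \<psi>_def)
  next
    case False
    then show ?thesis using \<psi>0[of v] that by (auto simp: \<psi>_def)
  qed
  have "y \<in> \<psi> ` {..<1}" for y
  proof (cases "0 \<le> y")
    case True
    then show ?thesis using inv[of y] lt1[of y] by (metis imageI lessThan_iff)
  next
    case False
    then show ?thesis by (intro image_eqI[of _ _ y]) (auto simp: \<psi>_def)
  qed
  then have "\<psi> ` {..<1} = UNIV" by auto
  then have "continuous_on {..<1} \<psi>"
    by (intro continuous_onI_mono) (auto intro: mon)
  then have "continuous_on {0..<1} \<psi>" by (rule continuous_on_subset) auto
  moreover have "0 \<le> \<psi> u \<and> \<Phi> (\<psi> u) = u" if "0 \<le> u" "u < 1" for u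
    using \<psi>0[OF that] that by (simp add: \<psi>_def)
  ultimately show ?thesis using that[of \<psi>] inv mon by blast
qed

context half_line_measure
begin

lemma primitive_tendsto:
  fixes h :: "real \<Rightarrow> real"
  assumes h: "integrable M h"
  shows "(\<lambda>n. primitive h (real n)) \<longlonglongrightarrow> (\<integral>x. h x \<partial>M)"
  unfolding primitive_def
proof (rule integral_dominated_convergence[where w = "\<lambda>x. norm (h x)"])
  show "AE x in M. (\<lambda>n. if x < real n then h x else 0) \<longlonglongrightarrow> h x"
  proof (rule AE_I2)
    fix x
    obtain n0 where "x < real n0" using reals_Archimedean2 by blast
    then have "eventually (\<lambda>n. (if x < real n then h x else 0) = h x) sequentially"
      unfolding eventually_sequentially by (intro exI[of _ n0]) auto
    then show "(\<lambda>n. if x < real n then h x else 0) \<longlonglongrightarrow> h x" by (rule tendsto_eventually)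
  qed
  show "(\<lambda>x. if x < real n then h x else 0) \<in> borel_measurable M" for n
    by (intro borel_measurable_integrable integrable_if h) measurable
qed (use h in auto)

lemma primitive_mono:
  fixes h :: "real \<Rightarrow> real"
  assumes h: "integrable M h" and nn: "\<And>x. 0 \<le> h x"
  shows "s \<le> t \<Longrightarrow> primitive h s \<le> primitive h t" and "primitive h t \<le> (\<integral>x. h x \<partial>M)"
proof -
  have int: "integrable M (\<lambda>x. if x < t then h x else 0)" for t
    by (intro integrable_if h) measurable
  show "s \<le> t \<Longrightarrow> primitive h s \<le> primitive h t"
    unfolding primitive_def by (intro integral_mono int) (use nn in auto)
  show "primitive h t \<le> (\<integral>x. h x \<partial>M)"
    unfolding primitive_def by (intro integral_mono int h) (use nn in auto)
qed

text \<open>The summand \<open>x / (1 + x)\<close> makes the clock strictly increasing also where \<open>h\<close> vanishes.\<close>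

definition clock :: "(real \<Rightarrow> real) \<Rightarrow> real \<Rightarrow> real" where
  "clock h x = (primitive h x / (\<integral>y. h y \<partial>M) + x / (1 + x)) / 2"

text \<open>The clock averages two functions with limit 1, so it tends to 1 without reaching it. The
  average is also the reason for the factor 2 in the comparison of mass with clock time.\<close>

lemma clock_props:
  assumes h: "integrable M h" and nn: "\<And>x. 0 \<le> h x" and pos: "0 < (\<integral>y. h y \<partial>M)"
  shows "continuous_on {0..} (clock h)"
    and "\<And>x y. 0 \<le> x \<Longrightarrow> x < y \<Longrightarrow> clock h x < clock h y"
    and "clock h 0 = 0"
    and "\<And>x. 0 \<le> x \<Longrightarrow> clock h x < 1"
    and "\<And>u. u < 1 \<Longrightarrow> \<exists>x\<ge>0. u < clock h x"
    and "\<And>x y. 0 \<le> x \<Longrightarrow> x \<le> y \<Longrightarrow> primitive h y - primitive h x \<le> 2 * (\<integral>y. h y \<partial>M) * (clock h y - clock h x)"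
proof -
  let ?A = "\<integral>y. h y \<partial>M"
  have frac: "x / (1 + x) < y / (1 + y)" if "0 \<le> x" "x < y" for x y :: real
  proof -
    have "x * (1 + y) < y * (1 + x)" using that by (simp add: algebra_simps)
    then show ?thesis using that by (simp add: pos_less_divide_eq pos_divide_less_eq mult.commute)
  qed
  show "continuous_on {0..} (clock h)"
    unfolding clock_def by (intro continuous_intros continuous_primitive h) (use pos in auto)
  show "clock h x < clock h y" if "0 \<le> x" "x < y" for x y
    unfolding clock_def
    using frac[OF that] primitive_mono(1)[OF h nn, of x y] that pos
    by (intro divide_strict_right_mono add_le_less_mono divide_right_mono) auto
  show "clock h 0 = 0" by (simp add: clock_def)
  show "clock h x < 1" if "0 \<le> x" for x
  proof -
    have "primitive h x / ?A \<le> 1" using primitive_mono(2)[OF h nn, of x] pos by simp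
    moreover have "x / (1 + x) < 1" using that by simp
    ultimately show ?thesis unfolding clock_def by simp
  qed
  show "\<exists>x\<ge>0. u < clock h x" if "u < 1" for u
  proof -
    have "(\<lambda>n. real n / (1 + real n)) \<longlonglongrightarrow> 1"
      using LIMSEQ_n_over_Suc_n by (simp add: add.commute)
    then have "(\<lambda>n. clock h (real n)) \<longlonglongrightarrow> (?A / ?A + 1) / 2"
      unfolding clock_def by (intro tendsto_intros primitive_tendsto h) (use pos in auto)
    then have "(\<lambda>n. clock h (real n)) \<longlonglongrightarrow> 1" using pos by simp
    then have "eventually (\<lambda>n. u < clock h (real n)) sequentially"
      by (rule order_tendstoD(1)) (rule that)
    then obtain n where "u < clock h (real n)" by (auto simp: eventually_sequentially)
    then show ?thesis by (intro exI[of _ "real n"]) simp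
  qed
  show "primitive h y - primitive h x \<le> 2 * ?A * (clock h y - clock h x)" if "0 \<le> x" "x \<le> y" for x y
  proof -
    have "2 * ?A * (clock h y - clock h x) = primitive h y - primitive h x + ?A * (y / (1 + y) - x / (1 + x))"
      using pos by (simp add: clock_def field_simps)
    moreover have "0 \<le> y / (1 + y) - x / (1 + x)" using frac[of x y] that by (cases "x = y") auto
    ultimately show ?thesis using pos by simp
  qed
qed

end

locale half_line_kernel = half_line_measure M + bounded_kernel M N k B C2
  for M :: "real measure" and N :: "'l measure" and k B C2
begin

definition path :: "(real \<Rightarrow> complex) \<Rightarrow> 'l \<Rightarrow> real \<Rightarrow> complex" where
  "path f l t = K (\<lambda>x. if x < t then f x else 0) l"

text \<open>|f| \<le> 1 + |f|^p, and initial segments have finite measure.\<close>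

lemma integrable_initial:
  assumes [measurable]: "f \<in> borel_measurable M" and fp: "integrable M (\<lambda>x. norm (f x) powr p)" and p: "1 \<le> p"
  shows "integrable M (\<lambda>x. if x < t then f x else (0::complex))"
proof (rule Bochner_Integration.integrable_bound)
  have "integrable M (indicator {x \<in> space M. x < t} :: real \<Rightarrow> real)"
    using finite_initial[of t] by (intro integrable_real_indicator) auto
  then show "integrable M (\<lambda>x. indicator {x \<in> space M. x < t} x + norm (f x) powr p)"
    using fp by (rule Bochner_Integration.integrable_add)
  show "AE x in M. norm (if x < t then f x else 0) \<le> norm (indicator {x \<in> space M. x < t} x + norm (f x) powr p)"
  proof (rule AE_I2)
    fix x assume x: "x \<in> space M"
    have "norm (f x) \<le> 1 + norm (f x) powr p"
    proof (cases "norm (f x) \<le> 1")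
      case False
      then have "norm (f x) powr 1 \<le> norm (f x) powr p" using p by (intro powr_mono) auto
      then show ?thesis using False by simp
    qed (simp add: add_increasing2)
    then show "norm (if x < t then f x else 0) \<le> norm (indicator {x \<in> space M. x < t} x + norm (f x) powr p)"
      using x by auto
  qed
qed measurable

lemma path_diff:
  assumes f: "\<And>t. integrable M (\<lambda>x. if x < t then f x else 0)" and st: "s \<le> t" and l: "l \<in> space N"
  shows "path f l t - path f l s = K (\<lambda>x. if s \<le> x \<and> x < t then f x else 0) l"
  unfolding path_def K_def
  by (subst Bochner_Integration.integral_diff[symmetric])
     (use st in \<open>auto intro!: integrable_kernel_mult f l Bochner_Integration.integral_cong\<close>)

text \<open>\<open>f\<close> may fail to be integrable, so only below a fixed \<open>T\<close> is
  the path a primitive of an integrable function. Continuity is local, hence this is enough for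
  it.\<close>

lemma path_eq_primitive:
  assumes "t \<le> T"
  shows "path f l t = primitive (\<lambda>x. k l x * (if x < T then f x else 0)) t"
  unfolding path_def K_def primitive_def using assms
  by (intro Bochner_Integration.integral_cong) auto

lemma continuous_path:
  assumes f: "\<And>t. integrable M (\<lambda>x. if x < t then f x else 0)" and l: "l \<in> space N"
  shows "continuous_on S (path f l)"
proof (intro continuous_at_imp_continuous_on ballI)
  fix a
  let ?g = "primitive (\<lambda>x. k l x * (if x < a + 1 then f x else 0))"
  have "isCont ?g a"
    using continuous_primitive[OF integrable_kernel_mult[OF f l], of UNIV "a + 1"]
    by (simp add: continuous_on_eq_continuous_at)
  moreover have "eventually (\<lambda>t. path f l t = ?g t) (nhds a)"
    unfolding eventually_nhds
    by (intro exI[of _ "{..<a + 1}"]) (auto intro: path_eq_primitive)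
  ultimately show "isCont (path f l) a" using isCont_cong by blast
qed

text \<open>With \<open>\<theta> = hoelder_exp q\<close>, the exponent \<open>1 / q + \<theta>\<close> exceeds \<open>1 / 2\<close>, which Young integration
  needs, and is still below \<open>1 / p\<close>, which makes the dyadic energy integrable in \<open>l\<close>.\<close>

definition hoelder_exp :: "real \<Rightarrow> real" where
  "hoelder_exp q = 3 / 4 * (1 - 2 / q)"

definition interp_const :: "real \<Rightarrow> real" where
  "interp_const q = 16 * C2 * (4 * B) powr (q - 2) / (1 - 2 powr (2 - q))"

text \<open>The first factor is the chaining constant; the power of 2 compensates for the control
  being half of the sum of an energy and a clock increment.\<close>

definition chain_const :: "real \<Rightarrow> real" where
  "chain_const q = 2 / (1 - 2 powr - hoelder_exp q) * 2 powr (1 / q + hoelder_exp q)"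

text \<open>The factor 2^(q - 1) comes from comparing mass with clock time, and the last one is the
  geometric series over the dyadic levels with ratio 2^(-(q - 2)/4).\<close>

definition path_const :: "real \<Rightarrow> real" where
  "path_const q = chain_const q powr q * (interp_const q * 2 powr (q - 1) * (1 / (1 - 2 powr (- ((q - 2) / 4)))))"

lemma consts_nonneg:
  assumes q: "2 < q"
  shows "0 < hoelder_exp q" "1 / 2 < 1 / q + hoelder_exp q" "0 \<le> interp_const q" "0 \<le> chain_const q"
    and "0 \<le> path_const q" "hoelder_exp q * q = 3 / 4 * (q - 2)"
proof -
  show h: "0 < hoelder_exp q" "1 / 2 < 1 / q + hoelder_exp q" "hoelder_exp q * q = 3 / 4 * (q - 2)"
    using q by (auto simp: hoelder_exp_def field_simps)
  have small: "2 powr - e < (1::real)" if "0 < e" for e using powr_less_mono[of "-e" 0 2] that by simp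
  show "0 \<le> interp_const q" unfolding interp_const_def using C2 small[of "q - 2"] q by simp
  moreover show "0 \<le> chain_const q" unfolding chain_const_def using small[OF h(1)] by simp
  ultimately show "0 \<le> path_const q" unfolding path_const_def using small[of "(q - 2) / 4"] q by simp
qed

text \<open>Chaining bounds an increment by a product of powers 1/q of an energy and \<theta> of a
  clock increment; both are superadditive, so the product is at most the power 1/q + \<theta> of
  their sum. Dividing the energy by its total keeps the control below 1 and moves the size into
  \<open>c\<close>, whose q-th power is a multiple of the total energy and therefore integrable in
  \<open>l\<close>.\<close>

theorem path_control:
  assumes q: "2 < q" and p: "p = q / (q - 1)"
    and f[measurable]: "f \<in> borel_measurable M" and fp: "integrable M (\<lambda>x. norm (f x) powr p)"
  shows "\<exists>c w. c \<in> borel_measurable N \<and> (\<forall>l. 0 \<le> c l) \<and>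
    (AE l in N. control (w l) (1 / q + hoelder_exp q) \<and>
      (\<forall>s t. 0 \<le> s \<longrightarrow> s \<le> t \<longrightarrow> norm (path f l t - path f l s) \<le> c l * w l s t powr (1 / q + hoelder_exp q))) \<and>
    (\<integral>\<^sup>+l. ennreal (c l powr q) \<partial>N) \<le> ennreal (path_const q * (\<integral>x. norm (f x) powr p \<partial>M) powr (q - 1))"
proof -
  let ?\<theta> = "hoelder_exp q"
  let ?\<kappa> = "1 / q + ?\<theta>"
  define A where "A = (\<integral>x. norm (f x) powr p \<partial>M)"
  have p1: "1 < p" using q unfolding p by (simp add: less_divide_eq)
  have loc: "integrable M (\<lambda>x. if x < t then f x else 0)" for t
    by (rule integrable_initial[OF f fp]) (use p1 in simp)
  have A0: "0 \<le> A" unfolding A_def by (intro integral_nonneg_AE) auto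
  note cn = consts_nonneg[OF q]
  show ?thesis
  proof (cases "A = 0")
    \<comment> \<open>The clock divides by \<open>A\<close>, so functions vanishing almost
      everywhere are treated apart.\<close>
    case True
    then have "AE x in M. norm (f x) powr p = 0"
      unfolding A_def using fp by (subst (asm) integral_nonneg_eq_0_iff_AE) auto
    then have f0: "AE x in M. f x = 0" by eventually_elim auto
    have "path f l t = 0" for l t
      unfolding path_def K_def by (rule integral_eq_zero_AE) (use f0 in eventually_elim, auto)
    moreover have "control (\<lambda>_ _. 0) ?\<kappa>" by standard (use cn in auto)
    ultimately show ?thesis
      by (intro exI[of _ "\<lambda>_. 0"] exI[of _ "\<lambda>_ _ _. 0"]) auto
  next
    case False
    then have A: "0 < A" using A0 by simp
    define h where "h x = norm (f x) powr p" for x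
    have h: "integrable M h" "\<And>x. 0 \<le> h x" and Ah: "A = (\<integral>x. h x \<partial>M)"
      using fp by (auto simp: h_def[abs_def] A_def)
    define \<Phi> where "\<Phi> = clock h"
    note \<Phi> = clock_props[OF h A[unfolded Ah], folded \<Phi>_def Ah]
    obtain \<psi> where \<psi>: "continuous_on {0..<1} \<psi>" "\<And>x. 0 \<le> x \<Longrightarrow> \<psi> (\<Phi> x) = x"
      "\<And>u. 0 \<le> u \<Longrightarrow> u < 1 \<Longrightarrow> 0 \<le> \<psi> u \<and> \<Phi> (\<psi> u) = u"
      "\<And>u v. 0 \<le> u \<Longrightarrow> u \<le> v \<Longrightarrow> v < 1 \<Longrightarrow> \<psi> u \<le> \<psi> v"
      using ex_continuous_inverse[OF \<Phi>(1-5)] by blast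
    define Y where "Y l u = path f l (\<psi> u)" for l u
    define cell where "cell m i l = (2^m) powr (?\<theta> * q) * norm (Y l (real (Suc i) / 2^m) - Y l (real i / 2^m)) powr q"
      for m i :: nat and l
    have dy: "0 \<le> real i / 2^m" "real i / 2^m \<le> real (Suc i) / 2^m" "real (Suc i) / 2^m < 1" if "i < 2^m - 1" for i m :: nat
    proof -
      have "Suc i < 2^m" using that by simp
      then have "real (Suc i) < 2^m" by (metis of_nat_less_iff of_nat_numeral of_nat_power)
      then show "real (Suc i) / 2^m < 1" by (simp add: pos_divide_less_eq del: of_nat_Suc)
    qed (auto intro!: divide_right_mono)
    have path_meas: "(\<lambda>l. path f l t) \<in> borel_measurable N" for t
      unfolding path_def by (rule K_measurable) measurable
    have cell_meas [measurable]: "cell m i \<in> borel_measurable N" for m i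
      unfolding cell_def[abs_def] Y_def using path_meas by measurable
    have cell0: "0 \<le> cell m i l" for m i l by (simp add: cell_def)
    have cell_int: "(\<integral>\<^sup>+l. ennreal (cell m i l) \<partial>N) \<le> ennreal ((2^m) powr (?\<theta> * q) * (interp_const q * (2 * A / 2^m) powr (q - 1)))"
      if i: "i < 2^m - 1" for m i
    proof -
      \<comment> \<open>A dyadic cell in clock time is the interval [?a, ?b) in real time, and the
        increment of the path over it is \<open>K\<close> of the piece of \<open>f\<close> there.
        That piece carries mass at most 2 A / 2^m, which interpolation turns into a moment.\<close>
      let ?a = "\<psi> (real i / 2^m)" and ?b = "\<psi> (real (Suc i) / 2^m)"
      let ?f = "\<lambda>x. if ?a \<le> x \<and> x < ?b then f x else 0"
      note d = dy[OF i]
      have d1: "real i / 2^m < 1" and d2: "0 \<le> real (Suc i) / 2^m" using d by linarith+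
      have ab: "0 \<le> ?a" "?a \<le> ?b" using \<psi>(3)[OF d(1) d1] \<psi>(4)[OF d] by blast+
      have \<Phi>ab: "\<Phi> ?b - \<Phi> ?a = 1 / 2^m"
        using \<psi>(3)[OF d(1) d1] \<psi>(3)[OF d2 d(3)] by (simp add: add_divide_distrib)
      have fint: "integrable M ?f"
      proof -
        have "integrable M (\<lambda>x. if ?a \<le> x then if x < ?b then f x else 0 else 0)"
          by (intro integrable_if loc) measurable
        also have "(\<lambda>x. if ?a \<le> x then if x < ?b then f x else 0 else 0) = ?f" by (intro ext) simp
        finally show ?thesis .
      qed
      have hint: "integrable M (\<lambda>x. norm (?f x) powr p)"
      proof -
        have "integrable M (\<lambda>x. if ?a \<le> x \<and> x < ?b then norm (f x) powr p else 0)"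
          by (intro integrable_if fp) measurable
        also have "(\<lambda>x. if ?a \<le> x \<and> x < ?b then norm (f x) powr p else 0) = (\<lambda>x. norm (?f x) powr p)" by auto
        finally show ?thesis .
      qed
      have "(\<integral>x. norm (?f x) powr p \<partial>M) = primitive h ?b - primitive h ?a"
        unfolding primitive_diff[OF h(1) ab(2)]
        by (intro Bochner_Integration.integral_cong) (auto simp: h_def)
      also have "\<dots> \<le> 2 * A / 2^m"
        using \<Phi>(6)[OF ab] \<Phi>ab by simp
      finally have mass: "(\<integral>x. norm (?f x) powr p \<partial>M) powr (q - 1) \<le> (2 * A / 2^m) powr (q - 1)"
        using q by (intro powr_mono2) auto
      have "(\<integral>\<^sup>+l. ennreal (cell m i l) \<partial>N) = (\<integral>\<^sup>+l. ennreal ((2^m) powr (?\<theta> * q)) * ennreal (norm (K ?f l) powr q) \<partial>N)"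
        by (intro nn_integral_cong)
           (simp add: cell_def Y_def path_diff[OF loc ab(2)] ennreal_mult del: of_nat_Suc)
      also have "\<dots> = ennreal ((2^m) powr (?\<theta> * q)) * (\<integral>\<^sup>+l. ennreal (norm (K ?f l) powr q) \<partial>N)"
      proof (rule nn_integral_cmult)
        have [measurable]: "K ?f \<in> borel_measurable N" by (rule K_measurable) measurable
        show "(\<lambda>l. ennreal (norm (K ?f l) powr q)) \<in> borel_measurable N" by measurable
      qed
      also have "\<dots> \<le> ennreal ((2^m) powr (?\<theta> * q)) * ennreal (interp_const q * (\<integral>x. norm (?f x) powr p \<partial>M) powr (q - 1))"
        using interpolation[OF q p fint hint] by (intro mult_left_mono) (auto simp: interp_const_def)
      also have "\<dots> \<le> ennreal ((2^m) powr (?\<theta> * q)) * ennreal (interp_const q * (2 * A / 2^m) powr (q - 1))"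
        using mass cn(3) by (intro mult_left_mono ennreal_leI) auto
      finally show ?thesis using cn(3) by (simp add: ennreal_mult)
    qed
    \<comment> \<open>Level \<open>m\<close> has fewer than 2^m cells, weight 2^(m \<theta> q) and
      moments of order 2^(-m (q - 1)); the exponents add up to -m (q - 2)/4.\<close>
    define \<delta> where "\<delta> = (q - 2) / 4"
    have \<delta>: "0 < \<delta>" using q by (simp add: \<delta>_def)
    define r where "r = 2 powr - \<delta>"
    have r: "0 < r" "r < 1" using powr_less_mono[of "-\<delta>" 0 2] \<delta> by (auto simp: r_def)
    define G where "G = interp_const q * (2 * A) powr (q - 1)"
    have G: "0 \<le> G" unfolding G_def using cn(3) by simp
    have level_int: "(\<integral>\<^sup>+l. ennreal (\<Sum>i<2^m - 1. cell m i l) \<partial>N) \<le> ennreal (G * r^m)" for m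
    proof -
      have "(\<integral>\<^sup>+l. ennreal (\<Sum>i<2^m - 1. cell m i l) \<partial>N) = (\<Sum>i<2^m - 1. \<integral>\<^sup>+l. ennreal (cell m i l) \<partial>N)"
        by (subst nn_integral_sum[symmetric]) (auto simp: sum_ennreal cell0)
      also have "\<dots> \<le> (\<Sum>i<(2::nat)^m - 1. ennreal ((2^m) powr (?\<theta> * q) * (interp_const q * (2 * A / 2^m) powr (q - 1))))"
        by (intro sum_mono cell_int) auto
      also have "\<dots> \<le> (\<Sum>i<(2::nat)^m. ennreal ((2^m) powr (?\<theta> * q) * (interp_const q * (2 * A / 2^m) powr (q - 1))))"
        by (rule sum_mono2) auto
      also have "\<dots> = ennreal (\<Sum>i<(2::nat)^m. (2^m) powr (?\<theta> * q) * (interp_const q * (2 * A / 2^m) powr (q - 1)))"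
        using cn(3) by (intro sum_ennreal) simp
      also have "(\<Sum>i<(2::nat)^m. (2^m) powr (?\<theta> * q) * (interp_const q * (2 * A / 2^m) powr (q - 1)))
        = 2^m * ((2^m) powr (?\<theta> * q) * (interp_const q * (2 * A / 2^m) powr (q - 1)))"
        by simp
      also have "2^m * ((2^m) powr (?\<theta> * q) * (interp_const q * (2 * A / 2^m) powr (q - 1))) = G * r^m"
      proof -
        have m: "(2::real)^m = 2 powr real m" by (simp add: powr_realpow)
        have 1: "(2 * A / 2^m) powr (q - 1) = (2 * A) powr (q - 1) * 2 powr (- (real m * (q - 1)))"
          unfolding m using A by (simp add: powr_divide powr_powr powr_minus_divide)
        have 2: "r^m = 2 powr (- (real m * \<delta>))"
          unfolding r_def by (simp add: powr_power mult.commute)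
        have "2^m * ((2^m) powr (?\<theta> * q) * 2 powr (- (real m * (q - 1)))) = 2 powr (real m + real m * (?\<theta> * q) + - (real m * (q - 1)))"
          unfolding m by (simp only: powr_powr powr_add mult.assoc)
        also have "real m + real m * (?\<theta> * q) + - (real m * (q - 1)) = - (real m * \<delta>)"
          unfolding cn(6) \<delta>_def by (simp add: field_simps)
        finally have 3: "r^m = 2^m * ((2^m) powr (?\<theta> * q) * 2 powr (- (real m * (q - 1))))" using 2 by simp
        show ?thesis unfolding 1 3 G_def by (simp only: mult_ac)
      qed
      finally show ?thesis .
    qed
    define W where "W l = (\<Sum>m. ennreal (\<Sum>i<2^m - 1. cell m i l))" for l
    have W_meas [measurable]: "W \<in> borel_measurable N" unfolding W_def[abs_def] by measurable
    have W_int: "(\<integral>\<^sup>+l. W l \<partial>N) \<le> ennreal (G * (1 / (1 - r)))"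
    proof -
      have "(\<integral>\<^sup>+l. W l \<partial>N) = (\<Sum>m. \<integral>\<^sup>+l. ennreal (\<Sum>i<2^m - 1. cell m i l) \<partial>N)"
        unfolding W_def by (rule nn_integral_suminf) measurable
      also have "\<dots> \<le> (\<Sum>m. ennreal (G * r^m))"
        by (intro suminf_le summableI level_int)
      also have "\<dots> = ennreal (\<Sum>m. G * r^m)"
        using r G by (intro suminf_ennreal2 summable_mult summable_geometric) auto
      also have "(\<Sum>m. G * r^m) = G * (1 / (1 - r))"
        using r suminf_geometric[of r] by (subst suminf_mult) (auto intro: summable_geometric)
      finally show ?thesis .
    qed
    then have W_fin: "AE l in N. W l \<noteq> \<infinity>"
      by (intro nn_integral_noteq_infinite) (auto simp: top_unique)
    define c where "c l = chain_const q * enn2real (W l) powr (1 / q)" for l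
    define e where "e l u v = dyadic_energy.energy (Y l) ?\<theta> q u v" for l u v
    \<comment> \<open>If the total energy is 0, the quotient is 0 by convention, which is consistent
      because every partial energy vanishes too.\<close>
    define w where "w l s t = (e l (\<Phi> s) (\<Phi> t) / enn2real (W l) + (\<Phi> t - \<Phi> s)) / 2" for l s t
    have good: "control (w l) ?\<kappa> \<and> (\<forall>s t. 0 \<le> s \<longrightarrow> s \<le> t \<longrightarrow>
        norm (path f l t - path f l s) \<le> c l * w l s t powr ?\<kappa>)"
      if l: "l \<in> space N" and fin: "W l \<noteq> \<infinity>" for l
    proof -
      define V where "V = enn2real (W l)"
      have sumW: "summable (\<lambda>m. \<Sum>i<2^m - 1. cell m i l)" "(\<Sum>m. \<Sum>i<2^m - 1. cell m i l) = V"
      proof -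
        have nn: "0 \<le> (\<Sum>i<2^m - 1. cell m i l)" for m by (intro sum_nonneg cell0)
        show s: "summable (\<lambda>m. \<Sum>i<2^m - 1. cell m i l)"
          using fin nn unfolding W_def by (intro summable_suminf_not_top) auto
        show "(\<Sum>m. \<Sum>i<2^m - 1. cell m i l) = V"
          unfolding V_def W_def suminf_ennreal2[OF nn s]
          by (rule enn2real_ennreal[OF suminf_nonneg[OF s nn], symmetric])
      qed
      interpret E: dyadic_energy "Y l" ?\<theta> q
      proof
        show "continuous_on {0..<1} (Y l)"
          unfolding Y_def by (intro continuous_on_compose2[OF continuous_path[OF loc l, of UNIV] \<psi>(1)]) auto
      qed (use cn(1) q sumW(1) in \<open>auto simp: cell_def\<close>)
      have eE: "e l u v = E.energy u v" for u v by (simp add: e_def)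
      have eV: "e l u v \<le> V" for u v
        using E.energy_le_total sumW(2) by (simp add: eE cell_def)
      have V0: "0 \<le> V" by (simp add: V_def)
      have \<Phi>mono: "\<Phi> s \<le> \<Phi> t" if "0 \<le> s" "s \<le> t" for s t
        using \<Phi>(2)[of s t] that by (cases "s = t") auto
      have \<Phi>0: "0 \<le> \<Phi> s" if "0 \<le> s" for s using \<Phi>mono[of 0 s] \<Phi>(3) that by simp
      have ctrl: "control (w l) ?\<kappa>"
      proof
        show "0 \<le> w l s t" if "0 \<le> s" "s \<le> t" for s t
          unfolding w_def using E.energy_nonneg \<Phi>mono[OF that] by (simp add: eE)
        show "w l s u + w l u t \<le> w l s t" if "0 \<le> s" "s \<le> u" "u \<le> t" for s u t
        proof -
          have "(e l (\<Phi> s) (\<Phi> u) + e l (\<Phi> u) (\<Phi> t)) / V \<le> e l (\<Phi> s) (\<Phi> t) / V"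
            unfolding eE using that by (intro divide_right_mono E.energy_super \<Phi>mono V0) auto
          then have "e l (\<Phi> s) (\<Phi> u) / V + e l (\<Phi> u) (\<Phi> t) / V \<le> e l (\<Phi> s) (\<Phi> t) / V"
            by (simp only: add_divide_distrib)
          moreover have "(x + (b - a)) / 2 + (y + (c - b)) / 2 \<le> (z + (c - a)) / 2" if "x + y \<le> z"
            for x y z a b c :: real using that by (simp add: field_simps)
          ultimately show ?thesis unfolding w_def V_def[symmetric] by blast
        qed
        show "w l s t \<le> 1" if "0 \<le> s" "s \<le> t" for s t
        proof -
          have "e l (\<Phi> s) (\<Phi> t) / V \<le> 1" using eV[of "\<Phi> s" "\<Phi> t"] V0 by (cases "V = 0") (auto simp: divide_le_eq_1)
          moreover have "\<Phi> t - \<Phi> s \<le> 1" using \<Phi>(4)[of t] \<Phi>0[of s] that by simp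
          ultimately show ?thesis unfolding w_def V_def[symmetric] by simp
        qed
      qed (use cn(2) in simp)
      have "norm (path f l t - path f l s) \<le> c l * w l s t powr ?\<kappa>" if st: "0 \<le> s" "s \<le> t" for s t
      proof -
        let ?e = "e l (\<Phi> s) (\<Phi> t)" and ?d = "\<Phi> t - \<Phi> s" and ?w = "w l s t"
        have e0: "0 \<le> ?e" by (simp add: eE E.energy_nonneg)
        have d0: "0 \<le> ?d" using \<Phi>mono[OF st] by simp
        have w0: "0 \<le> ?w" by (rule control.nonneg[OF ctrl st])
        \<comment> \<open>Undoing the normalisation: twice the control dominates each of its two
          summands.\<close>
        have "?e \<le> V * (2 * ?w)"
        proof (cases "V = 0")
          case False
          then have "V * (2 * ?w) = ?e + V * ?d"
            unfolding w_def V_def[symmetric] by (simp add: distrib_left)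
          then show ?thesis using mult_nonneg_nonneg[OF V0 d0] by linarith
        qed (use eV[of "\<Phi> s" "\<Phi> t"] in simp)
        then have "?e powr (1 / q) \<le> (V * (2 * ?w)) powr (1 / q)"
          using e0 q by (intro powr_mono2) auto
        also have "\<dots> = V powr (1 / q) * (2 * ?w) powr (1 / q)" using V0 w0 by (simp add: powr_mult)
        finally have 1: "?e powr (1 / q) \<le> V powr (1 / q) * (2 * ?w) powr (1 / q)" .
        have "?d \<le> 2 * ?w" unfolding w_def V_def[symmetric] using e0 V0 by simp
        then have 2: "?d powr ?\<theta> \<le> (2 * ?w) powr ?\<theta>" using d0 cn(1) by (intro powr_mono2) auto
        have "norm (path f l t - path f l s) = norm (Y l (\<Phi> t) - Y l (\<Phi> s))"
          using st \<psi>(2) by (simp add: Y_def)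
        also have "\<dots> \<le> 2 / (1 - 2 powr - ?\<theta>) * (?e powr (1 / q) * ?d powr ?\<theta>)"
          unfolding eE using st by (intro E.increment_le_energy \<Phi>0 \<Phi>mono \<Phi>(4)) auto
        also have "\<dots> \<le> 2 / (1 - 2 powr - ?\<theta>) * ((V powr (1 / q) * (2 * ?w) powr (1 / q)) * (2 * ?w) powr ?\<theta>)"
          using powr_less_mono[of "-?\<theta>" 0 2] cn(1)
          by (intro mult_left_mono mult_mono 1 2) auto
        also have "\<dots> = c l * ?w powr ?\<kappa>"
          unfolding c_def chain_const_def V_def[symmetric]
          using w0 by (simp add: powr_mult powr_add)
        finally show ?thesis .
      qed
      with ctrl show ?thesis by blast
    qed
    have "AE l in N. control (w l) ?\<kappa> \<and> (\<forall>s t. 0 \<le> s \<longrightarrow> s \<le> t \<longrightarrow>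
        norm (path f l t - path f l s) \<le> c l * w l s t powr ?\<kappa>)"
      using W_fin AE_space by eventually_elim (rule good)
    moreover have "c \<in> borel_measurable N" unfolding c_def[abs_def] by measurable
    moreover have "\<forall>l. 0 \<le> c l" using cn(4) by (simp add: c_def)
    moreover have "(\<integral>\<^sup>+l. ennreal (c l powr q) \<partial>N) \<le> ennreal (path_const q * A powr (q - 1))"
    proof -
      have "(\<integral>\<^sup>+l. ennreal (c l powr q) \<partial>N) \<le> (\<integral>\<^sup>+l. ennreal (chain_const q powr q) * W l \<partial>N)"
      proof (rule nn_integral_mono)
        fix l
        have "c l powr q = chain_const q powr q * enn2real (W l)"
          unfolding c_def using cn(4) q by (simp add: powr_mult powr_powr)
        then have "ennreal (c l powr q) = ennreal (chain_const q powr q) * ennreal (enn2real (W l))"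
          by (simp add: ennreal_mult)
        \<comment> \<open>Where \<open>W l\<close> is infinite, \<open>enn2real\<close> returns 0,
          so the inequality holds at every \<open>l\<close>.\<close>
        also have "\<dots> \<le> ennreal (chain_const q powr q) * W l"
          by (intro mult_left_mono) (auto simp: ennreal_enn2real_if)
        finally show "ennreal (c l powr q) \<le> ennreal (chain_const q powr q) * W l" .
      qed
      also have "\<dots> = ennreal (chain_const q powr q) * (\<integral>\<^sup>+l. W l \<partial>N)"
        by (rule nn_integral_cmult) measurable
      also have "\<dots> \<le> ennreal (chain_const q powr q) * ennreal (G * (1 / (1 - r)))"
        by (intro mult_left_mono W_int) simp
      also have "\<dots> = ennreal (path_const q * A powr (q - 1))"
        using A G r
        by (simp add: ennreal_mult[symmetric] path_const_def G_def r_def \<delta>_def powr_mult mult_ac)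
      finally show ?thesis .
    qed
    ultimately show ?thesis unfolding A_def by blast
  qed
qed

end

section \<open>The maximal bound for a family of kernels\<close>

locale kernel_family = half_line_measure M
  for M :: "real measure" +
  fixes N :: "'l measure" and k :: "'i \<Rightarrow> 'l \<Rightarrow> real \<Rightarrow> complex" and B C2 :: real and J :: "'i set"
  assumes kern: "j \<in> J \<Longrightarrow> half_line_kernel M N (k j) B C2"
    and J: "finite J" "J \<noteq> {}"
begin

definition trunc :: "('i \<times> 'i) set \<Rightarrow> ('i \<Rightarrow> real) \<Rightarrow> ('i \<Rightarrow> real \<Rightarrow> complex) \<Rightarrow> 'l \<Rightarrow> complex" where
  "trunc A D f l =
     (\<integral>x. (\<Prod>j\<in>J. f j (x j) * k j l (x j) * indicator {0<..} (D j - x j)) *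
          (\<Prod>\<alpha>\<in>A. indicator {0<..} (x (fst \<alpha>) - x (snd \<alpha>)))
      \<partial>Pi\<^sub>M J (\<lambda>_. M))"

text \<open>Cutting off each integrand at its own \<open>D j\<close> makes any common limit above
  all of them harmless. Stopping the integrand at \<open>D j\<close> stops its primitive
  there.\<close>

lemma trunc_eq_ordered_integral:
  assumes A: "A \<subseteq> J \<times> J" and t: "\<And>j. j \<in> J \<Longrightarrow> D j \<le> t"
  shows "trunc A D f l = ordered_integral A (\<lambda>j y. if y < D j then k j l y * f j y else 0) J t"
  unfolding trunc_def ordered_integral_def
proof (rule Bochner_Integration.integral_cong[OF refl])
  fix x :: "'i \<Rightarrow> real"
  have fin: "finite A" using A J finite_subset by blast
  have 1: "(\<Prod>\<alpha>\<in>A. indicator {0<..} (x (fst \<alpha>) - x (snd \<alpha>))) = (if ordered_on A J x then 1 else (0::complex))"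
  proof (cases "ordered_on A J x")
    case True
    then have "\<forall>\<alpha>\<in>A. x (snd \<alpha>) < x (fst \<alpha>)" using A by (force simp: ordered_on_def)
    then show ?thesis using True by (simp add: prod.neutral)
  next
    case False
    then obtain \<alpha> where "\<alpha> \<in> A" "\<not> x (snd \<alpha>) < x (fst \<alpha>)" by (auto simp: ordered_on_def)
    then have "(\<Prod>\<alpha>\<in>A. indicator {0<..} (x (fst \<alpha>) - x (snd \<alpha>))) = (0::complex)"
      using fin by (intro prod_zero bexI[of _ \<alpha>]) auto
    then show ?thesis using False by simp
  qed
  have 2: "(\<Prod>j\<in>J. f j (x j) * k j l (x j) * indicator {0<..} (D j - x j)) =
      (\<Prod>j\<in>J. if x j < t then if x j < D j then k j l (x j) * f j (x j) else 0 else 0)"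
  proof (rule prod.cong[OF refl])
    fix j assume "j \<in> J"
    then show "f j (x j) * k j l (x j) * indicator {0<..} (D j - x j) =
      (if x j < t then if x j < D j then k j l (x j) * f j (x j) else 0 else 0)"
      using t[of j] by (auto simp: indicator_def)
  qed
  show "(\<Prod>j\<in>J. f j (x j) * k j l (x j) * indicator {0<..} (D j - x j)) *
      (\<Prod>\<alpha>\<in>A. indicator {0<..} (x (fst \<alpha>) - x (snd \<alpha>))) =
    (if ordered_on A J x then \<Prod>j\<in>J. if x j < t then if x j < D j then k j l (x j) * f j (x j) else 0 else 0 else 0)"
    unfolding 1 2 by simp
qed

text \<open>The last factor is the price of one common control for all paths: the average of
  \<open>card J\<close> controls dominates each of them up to the factor
  \<open>card J\<close>.\<close>

definition order_const :: "real \<Rightarrow> real" where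
  "order_const \<kappa> = fact (card J) * (1 + control.young_const \<kappa>) ^ card J * (real (card J) powr \<kappa>) ^ card J"

text \<open>The increment of a stopped path over [u, v] is the increment of the original path over a
  smaller interval, and controls are monotone; the bound therefore does not see
  \<open>D\<close>.\<close>

lemma trunc_bound:
  assumes A: "A \<subseteq> J \<times> J" and D: "\<And>j. j \<in> J \<Longrightarrow> 0 < D j"
    and l: "l \<in> space N" and f: "\<And>j t. j \<in> J \<Longrightarrow> integrable M (\<lambda>x. if x < t then f j x else 0)"
    and w: "\<And>j. j \<in> J \<Longrightarrow> control (w j) \<kappa>" and c: "\<And>j. j \<in> J \<Longrightarrow> 0 \<le> c j"
    and b: "\<And>j s t. j \<in> J \<Longrightarrow> 0 \<le> s \<Longrightarrow> s \<le> t \<Longrightarrow>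
      norm ((\<integral>x. k j l x * (if x < t then f j x else 0) \<partial>M) - (\<integral>x. k j l x * (if x < s then f j x else 0) \<partial>M))
        \<le> c j * w j s t powr \<kappa>"
  shows "norm (trunc A D f l) \<le> order_const \<kappa> * (\<Prod>j\<in>J. c j)"
proof -
  let ?n = "real (card J)"
  have n: "0 < ?n" using J by (simp add: card_gt_0_iff)
  \<comment> \<open>Averaging, rather than summing, keeps the common control below 1.\<close>
  define \<omega> where "\<omega> s t = (\<Sum>j\<in>J. w j s t) / ?n" for s t
  obtain j0 where j0: "j0 \<in> J" using J by auto
  have \<kappa>: "1 / 2 < \<kappa>" using control.kappa[OF w[OF j0]] .
  have ctrl: "control \<omega> \<kappa>"
  proof
    show "0 \<le> \<omega> s t" if "0 \<le> s" "s \<le> t" for s t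
      unfolding \<omega>_def using control.nonneg[OF w that] by (auto intro!: divide_nonneg_nonneg sum_nonneg)
    show "\<omega> s u + \<omega> u t \<le> \<omega> s t" if "0 \<le> s" "s \<le> u" "u \<le> t" for s u t
      unfolding \<omega>_def add_divide_distrib[symmetric] sum.distrib[symmetric]
      by (intro divide_right_mono sum_mono control.super[OF w that]) auto
    show "\<omega> s t \<le> 1" if "0 \<le> s" "s \<le> t" for s t
    proof -
      have "(\<Sum>j\<in>J. w j s t) \<le> of_nat (card J) * 1"
        by (intro sum_bounded_above control.le_1[OF w that])
      then show ?thesis unfolding \<omega>_def using n by simp
    qed
  qed (rule \<kappa>)
  interpret controlled_half_line M \<omega> \<kappa>
    by (intro controlled_half_line.intro half_line_measure_axioms ctrl)
  let ?g = "\<lambda>j y. if y < D j then k j l y * f j y else 0"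
  define t where "t = Max (D ` J)"
  have t: "D j \<le> t" if "j \<in> J" for j unfolding t_def using that J by auto
  have t0: "0 \<le> t" using t[OF j0] D[OF j0] by simp
  have prim: "primitive (?g j) u = (\<integral>x. k j l x * (if x < min u (D j) then f j x else 0) \<partial>M)" for j u
    unfolding primitive_def by (intro Bochner_Integration.integral_cong) auto
  have g_int: "integrable M (?g j)" if j: "j \<in> J" for j
  proof -
    interpret half_line_kernel M N "k j" B C2 by (rule kern[OF j])
    have "integrable M (\<lambda>y. k j l y * (if y < D j then f j y else 0))"
      by (intro integrable_kernel_mult f j l)
    also have "(\<lambda>y. k j l y * (if y < D j then f j y else 0)) = ?g j" by auto
    finally show ?thesis .
  qed
  have g_ctrl: "norm (primitive (?g j) v - primitive (?g j) u) \<le> (c j * ?n powr \<kappa>) * \<omega> u v powr \<kappa>"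
    if j: "j \<in> J" and uv: "0 \<le> u" "u \<le> v" for j u v
  proof -
    let ?u = "min u (D j)" and ?v = "min v (D j)"
    have m: "0 \<le> ?u" "?u \<le> ?v" using uv D[OF j] by auto
    have wj: "w j ?u ?v \<le> ?n * \<omega> u v"
    proof (cases "u \<le> D j")
      case True
      then have "w j ?u ?v \<le> w j u v"
        using uv by (intro control.mono[OF w[OF j]]) auto
      also have "\<dots> \<le> (\<Sum>j\<in>J. w j u v)"
        using J j control.nonneg[OF w uv] by (intro member_le_sum) auto
      finally show ?thesis unfolding \<omega>_def using n by simp
    next
      case False
      then have "?u = D j" "?v = D j" using uv by auto
      \<comment> \<open>After the stopping time the interval is degenerate, and superadditivity at a
        single point reads 2 w \<le> w.\<close>
      then have "w j ?u ?v \<le> 0"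
        using control.super[OF w[OF j], of "D j" "D j" "D j"] D[OF j] by simp
      then show ?thesis using nonneg[OF uv] n by (meson mult_nonneg_nonneg less_imp_le order_trans)
    qed
    have "norm (primitive (?g j) v - primitive (?g j) u) \<le> c j * w j ?u ?v powr \<kappa>"
      unfolding prim by (rule b[OF j m])
    also have "\<dots> \<le> c j * (?n * \<omega> u v) powr \<kappa>"
      using control.nonneg[OF w[OF j] m] wj \<kappa> c[OF j] by (intro mult_left_mono powr_mono2) auto
    also have "\<dots> = (c j * ?n powr \<kappa>) * \<omega> u v powr \<kappa>"
      using n nonneg[OF uv] by (simp add: powr_mult)
    finally show ?thesis .
  qed
  have "finite A" using A J finite_subset by blast
  from ordered_integral_control[OF this g_int _ g_ctrl refl J(1)] t0 c
  have "norm (ordered_integral A ?g J t) \<le>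
    fact (card J) * (1 + young_const) ^ card J * (\<Prod>j\<in>J. c j * ?n powr \<kappa>)" by simp
  moreover have "trunc A D f l = ordered_integral A ?g J t"
    by (rule trunc_eq_ordered_integral[OF A t])
  ultimately show ?thesis
    unfolding order_const_def prod.distrib by (simp add: mult_ac)
qed

definition max_const :: "real \<Rightarrow> real" where
  "max_const q = order_const (1 / q + 3 / 4 * (1 - 2 / q)) powr (q / card J) * (card J * half_line_kernel.path_const B C2 q)"

text \<open>The majorant \<open>G\<close> is chosen before \<open>D\<close>, off a single null set.
  The Hoelder step is done by normalisation: n functions with integrals at most P are formed, and
  the product of their n-th roots is at most their sum, at the cost of a factor n.\<close>

theorem max_bound:
  assumes A: "A \<subseteq> J \<times> J" and q: "2 < q" and p: "p = q / (q - 1)"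
    and f: "\<And>j. j \<in> J \<Longrightarrow> f j \<in> borel_measurable M"
    and fp: "\<And>j. j \<in> J \<Longrightarrow> integrable M (\<lambda>x. norm (f j x) powr p)"
  shows "\<exists>G. G \<in> borel_measurable N \<and> (\<forall>l. 0 \<le> G l) \<and>
    (AE l in N. \<forall>D. (\<forall>j\<in>J. 0 < D j) \<longrightarrow> norm (trunc A D f l) \<le> G l) \<and>
    (\<integral>\<^sup>+l. ennreal (G l powr (q / card J)) \<partial>N)
      \<le> ennreal (max_const q * (\<Prod>j\<in>J. (\<integral>x. norm (f j x) powr p \<partial>M) powr ((q - 1) / card J)))"
proof -
  let ?n = "real (card J)"
  let ?P = "half_line_kernel.path_const B C2 q"
  obtain j0 where j0: "j0 \<in> J" using J by auto
  interpret j0: half_line_kernel M N "k j0" B C2 by (rule kern[OF j0])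
  have n: "0 < ?n" using J by (simp add: card_gt_0_iff)
  have p1: "1 < p" using q unfolding p by (simp add: less_divide_eq)
  define \<kappa> where "\<kappa> = 1 / q + 3 / 4 * (1 - 2 / q)"
  have \<kappa>: "1 / q + j0.hoelder_exp q = \<kappa>" by (simp add: \<kappa>_def j0.hoelder_exp_def)
  have P0: "0 \<le> ?P" by (rule j0.consts_nonneg[OF q])
  define F where "F j = (\<integral>x. norm (f j x) powr p \<partial>M)" for j
  have F0: "0 \<le> F j" for j unfolding F_def by (intro integral_nonneg_AE) auto
  have "\<forall>j\<in>J. \<exists>c w. c \<in> borel_measurable N \<and> (\<forall>l. 0 \<le> c l) \<and>
    (AE l in N. control (w l) \<kappa> \<and> (\<forall>s t. 0 \<le> s \<longrightarrow> s \<le> t \<longrightarrow>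
      norm ((\<integral>x. k j l x * (if x < t then f j x else 0) \<partial>M) - (\<integral>x. k j l x * (if x < s then f j x else 0) \<partial>M))
        \<le> c l * w l s t powr \<kappa>)) \<and>
    (\<integral>\<^sup>+l. ennreal (c l powr q) \<partial>N) \<le> ennreal (?P * F j powr (q - 1))"
  proof
    fix j assume j: "j \<in> J"
    interpret half_line_kernel M N "k j" B C2 by (rule kern[OF j])
    show "\<exists>c w. c \<in> borel_measurable N \<and> (\<forall>l. 0 \<le> c l) \<and>
    (AE l in N. control (w l) \<kappa> \<and> (\<forall>s t. 0 \<le> s \<longrightarrow> s \<le> t \<longrightarrow>
      norm ((\<integral>x. k j l x * (if x < t then f j x else 0) \<partial>M) - (\<integral>x. k j l x * (if x < s then f j x else 0) \<partial>M))
        \<le> c l * w l s t powr \<kappa>)) \<and>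
    (\<integral>\<^sup>+l. ennreal (c l powr q) \<partial>N) \<le> ennreal (?P * F j powr (q - 1))"
      using path_control[OF q p f[OF j] fp[OF j]] unfolding path_def K_def \<kappa> F_def .
  qed
  then obtain c w where c: "\<And>j. j \<in> J \<Longrightarrow> c j \<in> borel_measurable N" "\<And>j l. j \<in> J \<Longrightarrow> 0 \<le> c j l"
    and cw: "\<And>j. j \<in> J \<Longrightarrow> AE l in N. control (w j l) \<kappa> \<and> (\<forall>s t. 0 \<le> s \<longrightarrow> s \<le> t \<longrightarrow>
      norm ((\<integral>x. k j l x * (if x < t then f j x else 0) \<partial>M) - (\<integral>x. k j l x * (if x < s then f j x else 0) \<partial>M))
        \<le> c j l * w j l s t powr \<kappa>)"
    and ci: "\<And>j. j \<in> J \<Longrightarrow> (\<integral>\<^sup>+l. ennreal (c j l powr q) \<partial>N) \<le> ennreal (?P * F j powr (q - 1))"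
    unfolding bchoice_iff by blast
  have loc: "integrable M (\<lambda>x. if x < t then f j x else 0)" if "j \<in> J" for j t
    by (rule j0.integrable_initial[OF f[OF that] fp[OF that]]) (use p1 in simp)
  have AE_all: "AE l in N. \<forall>j\<in>J. control (w j l) \<kappa> \<and> (\<forall>s t. 0 \<le> s \<longrightarrow> s \<le> t \<longrightarrow>
      norm ((\<integral>x. k j l x * (if x < t then f j x else 0) \<partial>M) - (\<integral>x. k j l x * (if x < s then f j x else 0) \<partial>M))
        \<le> c j l * w j l s t powr \<kappa>)"
    by (intro AE_finite_allI J cw)
  define G where "G l = \<bar>order_const \<kappa>\<bar> * (\<Prod>j\<in>J. \<bar>c j l\<bar>)" for l
  have G_meas: "G \<in> borel_measurable N" unfolding G_def[abs_def] using c(1) by measurable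
  have G0: "0 \<le> G l" for l unfolding G_def by (intro mult_nonneg_nonneg prod_nonneg) auto
  have bound: "AE l in N. \<forall>D. (\<forall>j\<in>J. 0 < D j) \<longrightarrow> norm (trunc A D f l) \<le> G l"
    using AE_all AE_space
  proof eventually_elim
    case (elim l)
    show ?case
    proof (intro allI impI)
      fix D assume D: "\<forall>j\<in>J. (0::real) < D j"
      have "norm (trunc A D f l) \<le> order_const \<kappa> * (\<Prod>j\<in>J. c j l)"
        by (rule trunc_bound[OF A _ elim(2) loc, where w = "\<lambda>j. w j l"])
           (use elim(1) D c(2) in auto)
      also have "\<dots> \<le> \<bar>order_const \<kappa>\<bar> * (\<Prod>j\<in>J. c j l)"
        using c(2) by (intro mult_right_mono prod_nonneg) auto
      also have "(\<Prod>j\<in>J. c j l) = (\<Prod>j\<in>J. \<bar>c j l\<bar>)"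
        using c(2) by (intro prod.cong) auto
      finally show "norm (trunc A D f l) \<le> G l" unfolding G_def .
    qed
  qed
  have "0 \<le> order_const \<kappa>"
  proof -
    interpret control "\<lambda>_ _. 0" \<kappa> by standard (use j0.consts_nonneg(2)[OF q] in \<open>auto simp: \<kappa>\<close>)
    show ?thesis unfolding order_const_def using young_const_nonneg by simp
  qed
  then have Gq: "G l powr (q / ?n) = order_const \<kappa> powr (q / ?n) * (\<Prod>j\<in>J. c j l powr (q / ?n))" for l
  proof -
    have "(\<Prod>j\<in>J. \<bar>c j l\<bar>) powr (q / ?n) = (\<Prod>j\<in>J. \<bar>c j l\<bar> powr (q / ?n))"
      by (rule prod_powr_distrib)
    also have "\<dots> = (\<Prod>j\<in>J. c j l powr (q / ?n))" using c(2) by (intro prod.cong) auto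
    finally show ?thesis
      unfolding G_def using \<open>0 \<le> order_const \<kappa>\<close> by (simp add: powr_mult prod_nonneg)
  qed
  have "(\<integral>\<^sup>+l. ennreal (G l powr (q / ?n)) \<partial>N)
      \<le> ennreal (max_const q * (\<Prod>j\<in>J. F j powr ((q - 1) / ?n)))"
  proof (cases "\<exists>j\<in>J. F j = 0")
    \<comment> \<open>The normalisation below divides by powers of \<open>F j\<close>. If one of
      them is 0, then \<open>c j\<close>, hence \<open>G\<close>, vanishes almost
      everywhere.\<close>
    case True
    then obtain j where j: "j \<in> J" "F j = 0" by auto
    have [measurable]: "c j \<in> borel_measurable N" by (rule c(1)[OF j(1)])
    have "(\<integral>\<^sup>+l. ennreal (c j l powr q) \<partial>N) = 0" using ci[OF j(1)] j(2) by simp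
    then have "AE l in N. ennreal (c j l powr q) = 0"
      by (subst (asm) nn_integral_0_iff_AE) auto
    then have "AE l in N. ennreal (G l powr (q / ?n)) = 0"
    proof eventually_elim
      case (elim l)
      then have "c j l powr (q / ?n) = 0" by simp
      then have "(\<Prod>j\<in>J. c j l powr (q / ?n)) = 0" using j J by (intro prod_zero) auto
      then show ?case unfolding Gq by simp
    qed
    then have "(\<integral>\<^sup>+l. ennreal (G l powr (q / ?n)) \<partial>N) = (\<integral>\<^sup>+l. 0 \<partial>N)"
      by (rule nn_integral_cong_AE)
    then show ?thesis by simp
  next
    case False
    then have F: "0 < F j" if "j \<in> J" for j using F0[of j] that by (auto simp: less_le)
    define y where "y j l = c j l powr q / F j powr (q - 1)" for j l
    have y0: "0 \<le> y j l" for j l by (simp add: y_def)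
    have y_meas: "y j \<in> borel_measurable N" if "j \<in> J" for j
      unfolding y_def[abs_def] using c(1)[OF that] by measurable
    let ?S = "order_const \<kappa> powr (q / ?n) * (\<Prod>j\<in>J. F j powr ((q - 1) / ?n))"
    have S0: "0 \<le> ?S" by (intro mult_nonneg_nonneg prod_nonneg) auto
    have le: "G l powr (q / ?n) \<le> ?S * (\<Sum>j\<in>J. y j l)" for l
    proof -
      have "c j l powr (q / ?n) = F j powr ((q - 1) / ?n) * y j l powr (1 / ?n)" if "j \<in> J" for j
        unfolding y_def using F[OF that] c(2)[OF that] by (simp add: powr_divide powr_powr)
      then have "(\<Prod>j\<in>J. c j l powr (q / ?n)) = (\<Prod>j\<in>J. F j powr ((q - 1) / ?n)) * (\<Prod>j\<in>J. y j l powr (1 / ?n))"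
        by (simp add: prod.distrib)
      \<comment> \<open>Each factor is at most the n-th root of the full sum, and there are n
        factors.\<close>
      also have "(\<Prod>j\<in>J. y j l powr (1 / ?n)) \<le> (\<Prod>j\<in>J. (\<Sum>i\<in>J. y i l) powr (1 / ?n))"
        using y0 J n by (intro prod_mono conjI powr_mono2 member_le_sum) auto
      also have "\<dots> = (\<Sum>i\<in>J. y i l)"
      proof (cases "(\<Sum>i\<in>J. y i l) = 0")
        case False
        then have "0 < (\<Sum>i\<in>J. y i l)" using y0 by (simp add: less_le sum_nonneg)
        then show ?thesis
          using n powr_realpow[of "(\<Sum>i\<in>J. y i l) powr (1 / ?n)" "card J"] by (simp add: powr_powr)
      qed (use n in simp)
      finally have "(\<Prod>j\<in>J. c j l powr (q / ?n)) \<le> (\<Prod>j\<in>J. F j powr ((q - 1) / ?n)) * (\<Sum>i\<in>J. y i l)"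
        by (simp add: mult_left_mono prod_nonneg)
      then show ?thesis unfolding Gq mult.assoc by (intro mult_left_mono) auto
    qed
    have y_int: "(\<integral>\<^sup>+l. ennreal (y j l) \<partial>N) \<le> ennreal ?P" if j: "j \<in> J" for j
    proof -
      have [measurable]: "c j \<in> borel_measurable N" by (rule c(1)[OF j])
      have Fj: "0 < F j powr (q - 1)" using F[OF j] by simp
      have "(\<integral>\<^sup>+l. ennreal (y j l) \<partial>N) = (\<integral>\<^sup>+l. ennreal (1 / F j powr (q - 1)) * ennreal (c j l powr q) \<partial>N)"
        unfolding y_def by (intro nn_integral_cong) (simp add: ennreal_mult[symmetric])
      also have "\<dots> = ennreal (1 / F j powr (q - 1)) * (\<integral>\<^sup>+l. ennreal (c j l powr q) \<partial>N)"
        by (rule nn_integral_cmult) measurable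
      also have "\<dots> \<le> ennreal (1 / F j powr (q - 1)) * ennreal (?P * F j powr (q - 1))"
        by (intro mult_left_mono ci j) simp
      also have "\<dots> = ennreal ?P" using Fj P0 by (simp add: ennreal_mult[symmetric])
      finally show ?thesis .
    qed
    have "(\<integral>\<^sup>+l. ennreal (G l powr (q / ?n)) \<partial>N) \<le> (\<integral>\<^sup>+l. ennreal ?S * (\<Sum>j\<in>J. ennreal (y j l)) \<partial>N)"
      using le S0 y0 by (intro nn_integral_mono) (simp add: sum_ennreal ennreal_mult[symmetric] sum_nonneg ennreal_leI)
    also have "\<dots> = ennreal ?S * (\<Sum>j\<in>J. \<integral>\<^sup>+l. ennreal (y j l) \<partial>N)"
      using y_meas by (subst nn_integral_cmult) (auto simp: nn_integral_sum)
    also have "\<dots> \<le> ennreal ?S * (\<Sum>j\<in>J. ennreal ?P)"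
      by (intro mult_left_mono sum_mono y_int) auto
    also have "(\<Sum>j\<in>J. ennreal ?P) = ennreal (?n * ?P)"
      using P0 by (subst sum_ennreal) auto
    also have "ennreal ?S * ennreal (?n * ?P) = ennreal (max_const q * (\<Prod>j\<in>J. F j powr ((q - 1) / ?n)))"
      using S0 P0 by (simp add: ennreal_mult[symmetric] max_const_def \<kappa>_def mult_ac)
    finally show ?thesis .
  qed
  then show ?thesis using G_meas G0 bound unfolding F_def by blast
qed

end

section \<open>Measurability of the maximal function and the endpoint p = 1\<close>

context half_line_measure
begin

text \<open>Fubini with coordinate \<open>j\<close> innermost. This permits replacing a kernel by an
  almost everywhere equal one under the product integral.\<close>

lemma AE_PiM_component_finite:
  assumes "finite J" "j \<in> J" and P: "AE y in M. P y"
  shows "AE x in Pi\<^sub>M J (\<lambda>_. M). P (x j)"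
proof -
  obtain Z where Z: "{y \<in> space M. \<not> P y} \<subseteq> Z" "emeasure M Z = 0" "Z \<in> sets M"
    using P by (auto elim: AE_E)
  define u :: "('a \<Rightarrow> real) \<Rightarrow> ennreal" where "u x = indicator Z (x j)" for x
  have J: "J = insert j (J - {j})" using assms by auto
  have u: "u \<in> borel_measurable (Pi\<^sub>M J (\<lambda>_. M))"
    unfolding u_def
    by (rule measurable_compose[OF measurable_component_singleton[OF assms(2)]]) (use Z in simp)
  have "(\<integral>\<^sup>+x. u x \<partial>Pi\<^sub>M (insert j (J - {j})) (\<lambda>_. M)) =
      (\<integral>\<^sup>+x. (\<integral>\<^sup>+y. u (x(j := y)) \<partial>M) \<partial>Pi\<^sub>M (J - {j}) (\<lambda>_. M))"
    by (rule prod.product_nn_integral_insert) (use assms u J in auto)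
  also have "\<dots> = 0" using Z by (simp add: u_def)
  finally have "(\<integral>\<^sup>+x. u x \<partial>Pi\<^sub>M J (\<lambda>_. M)) = 0" using J by simp
  then have "AE x in Pi\<^sub>M J (\<lambda>_. M). u x = 0" using nn_integral_0_iff_AE[OF u] by simp
  then show ?thesis
    using AE_space
  proof eventually_elim
    case (elim x)
    then have "x j \<in> space M" using assms(2) by (auto simp: space_PiM)
    then show ?case using elim(1) Z(1) by (auto simp: u_def indicator_def split: if_splits)
  qed
qed

lemma trunc_integrand_measurable:
  assumes A: "A \<subseteq> J \<times> J" and u: "\<And>j. j \<in> J \<Longrightarrow> u j \<in> borel_measurable M"
  shows "(\<lambda>x. (\<Prod>j\<in>J. u j (x j) * indicator {0<..} (E j - x j)) *
      (\<Prod>\<alpha>\<in>A. indicator {0<..} (x (fst \<alpha>) - x (snd \<alpha>))) :: complex) \<in> borel_measurable (Pi\<^sub>M J (\<lambda>_. M))"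
proof -
  have ind: "(\<lambda>p. indicator {0<..} (g p) :: complex) \<in> borel_measurable M'"
    if "g \<in> borel_measurable M'" for g :: "('a \<Rightarrow> real) \<Rightarrow> real" and M'
    using that by measurable
  have uc: "(\<lambda>x. u j (x j)) \<in> borel_measurable (Pi\<^sub>M J (\<lambda>_. M))" if j: "j \<in> J" for j
    by (rule measurable_compose[OF measurable_component_singleton[OF j] u[OF j]])
  show ?thesis
    using A
    by (intro borel_measurable_times borel_measurable_prod ind borel_measurable_diff component_measurable
        borel_measurable_const uc) auto
qed

end

context kernel_family
begin

lemma trunc_measurable:
  assumes A: "A \<subseteq> J \<times> J" and f: "\<And>j. j \<in> J \<Longrightarrow> f j \<in> borel_measurable M"
  shows "trunc A D f \<in> borel_measurable N"
proof -
  interpret P: finite_product_sigma_finite "\<lambda>_. M" J by unfold_locales (rule J)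
  have k: "(\<lambda>p. k j (fst p) (snd p j)) \<in> borel_measurable (N \<Otimes>\<^sub>M Pi\<^sub>M J (\<lambda>_. M))" if j: "j \<in> J" for j
  proof -
    interpret half_line_kernel M N "k j" B C2 by (rule kern[OF j])
    have "(\<lambda>p. (fst p, snd p j)) \<in> N \<Otimes>\<^sub>M Pi\<^sub>M J (\<lambda>_. M) \<rightarrow>\<^sub>M N \<Otimes>\<^sub>M M"
      using measurable_compose[OF measurable_snd measurable_component_singleton[OF j]] by measurable
    from measurable_compose[OF this k_measurable] show ?thesis by simp
  qed
  have comp: "(\<lambda>p. snd p j) \<in> N \<Otimes>\<^sub>M Pi\<^sub>M J (\<lambda>_. M) \<rightarrow>\<^sub>M M" if j: "j \<in> J" for j
    by (rule measurable_compose[OF measurable_snd measurable_component_singleton[OF j]])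
  have real_comp: "(\<lambda>p. snd p j) \<in> N \<Otimes>\<^sub>M Pi\<^sub>M J (\<lambda>_. M) \<rightarrow>\<^sub>M borel" if j: "j \<in> J" for j
    using measurable_compose[OF comp[OF j] id_measurable] .
  have fc: "(\<lambda>p. f j (snd p j)) \<in> borel_measurable (N \<Otimes>\<^sub>M Pi\<^sub>M J (\<lambda>_. M))" if j: "j \<in> J" for j
    by (rule measurable_compose[OF comp[OF j] f[OF j]])
  have ind: "(\<lambda>p. indicator {0<..} (g p) :: complex) \<in> borel_measurable M'"
    if "g \<in> borel_measurable M'" for g :: "'x \<Rightarrow> real" and M'
    using that by measurable
  have "(\<lambda>p. (\<Prod>j\<in>J. f j (snd p j) * k j (fst p) (snd p j) * indicator {0<..} (D j - snd p j)) *
          (\<Prod>\<alpha>\<in>A. indicator {0<..} (snd p (fst \<alpha>) - snd p (snd \<alpha>))) :: complex)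
      \<in> borel_measurable (N \<Otimes>\<^sub>M Pi\<^sub>M J (\<lambda>_. M))"
    using A
    by (intro borel_measurable_times borel_measurable_prod ind borel_measurable_diff real_comp fc k
        borel_measurable_const) auto
  then have "(\<lambda>l. trunc A D f l) \<in> borel_measurable N"
    unfolding trunc_def by (intro P.borel_measurable_lebesgue_integral) (simp add: case_prod_beta')
  then show ?thesis by simp
qed

text \<open>The cut-off \<open>x j < D j\<close> is strict, so indicators approaching from below
  converge at every point, the boundary included, and the limit truncation supplies the
  majorant.\<close>

lemma trunc_tendsto:
  assumes A: "A \<subseteq> J \<times> J" and f: "\<And>j. j \<in> J \<Longrightarrow> f j \<in> borel_measurable M"
    and loc: "\<And>j t. j \<in> J \<Longrightarrow> integrable M (\<lambda>x. if x < t then f j x else 0)" and l: "l \<in> space N"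
    and d: "\<And>j m. j \<in> J \<Longrightarrow> d m j < D j" "\<And>j. j \<in> J \<Longrightarrow> (\<lambda>m. d m j) \<longlonglongrightarrow> D j"
  shows "(\<lambda>m. trunc A (d m) f l) \<longlonglongrightarrow> trunc A D f l"
  unfolding trunc_def
proof (rule integral_dominated_convergence)
  let ?w = "\<lambda>x. \<Prod>j\<in>J. norm (k j l (x j) * (if x j < D j then f j (x j) else 0))"
  have kf: "integrable M (\<lambda>y. k j l y * (if y < D j then f j y else 0))" if j: "j \<in> J" for j
  proof -
    interpret half_line_kernel M N "k j" B C2 by (rule kern[OF j])
    show ?thesis by (intro integrable_kernel_mult loc j l)
  qed
  show "integrable (Pi\<^sub>M J (\<lambda>_. M)) ?w"
    by (rule prod.product_integrable_prod[OF J(1), where f = "\<lambda>j y. norm (k j l y * (if y < D j then f j y else 0))"])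
       (intro integrable_norm kf)
  have bd: "norm (\<Prod>\<alpha>\<in>A. indicator {0<..} (x (fst \<alpha>) - x (snd \<alpha>)) :: complex) \<le> 1" for x :: "'i \<Rightarrow> real"
    unfolding prod_norm[symmetric] by (intro prod_le_1) (auto simp: indicator_def)
  show "AE x in Pi\<^sub>M J (\<lambda>_. M). norm ((\<Prod>j\<in>J. f j (x j) * k j l (x j) * indicator {0<..} (d m j - x j)) *
          (\<Prod>\<alpha>\<in>A. indicator {0<..} (x (fst \<alpha>) - x (snd \<alpha>)))) \<le> ?w x" for m
  proof (rule AE_I2)
    fix x
    have "norm (\<Prod>j\<in>J. f j (x j) * k j l (x j) * indicator {0<..} (d m j - x j)) \<le> ?w x"
      unfolding prod_norm[symmetric]
    proof (intro prod_mono conjI norm_ge_zero)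
      fix j assume "j \<in> J"
      then show "norm (f j (x j) * k j l (x j) * indicator {0<..} (d m j - x j))
        \<le> norm (k j l (x j) * (if x j < D j then f j (x j) else 0))"
        using d(1)[of j m] by (auto simp: indicator_def norm_mult)
    qed
    from mult_mono[OF this bd[of x]]
    show "norm ((\<Prod>j\<in>J. f j (x j) * k j l (x j) * indicator {0<..} (d m j - x j)) *
          (\<Prod>\<alpha>\<in>A. indicator {0<..} (x (fst \<alpha>) - x (snd \<alpha>)))) \<le> ?w x"
      by (simp add: norm_mult prod_nonneg)
  qed
  show "AE x in Pi\<^sub>M J (\<lambda>_. M). (\<lambda>m. (\<Prod>j\<in>J. f j (x j) * k j l (x j) * indicator {0<..} (d m j - x j)) *
          (\<Prod>\<alpha>\<in>A. indicator {0<..} (x (fst \<alpha>) - x (snd \<alpha>))))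
      \<longlonglongrightarrow> (\<Prod>j\<in>J. f j (x j) * k j l (x j) * indicator {0<..} (D j - x j)) *
          (\<Prod>\<alpha>\<in>A. indicator {0<..} (x (fst \<alpha>) - x (snd \<alpha>)))"
  proof (rule AE_I2)
    fix x
    have "(\<lambda>m. indicator {0<..} (d m j - x j) :: complex) \<longlonglongrightarrow> indicator {0<..} (D j - x j)" if j: "j \<in> J" for j
    proof (rule tendsto_eventually)
      show "eventually (\<lambda>m. (indicator {0<..} (d m j - x j) :: complex) = indicator {0<..} (D j - x j)) sequentially"
      proof (cases "x j < D j")
        case True
        from order_tendstoD(1)[OF d(2)[OF j] this] show ?thesis
          by eventually_elim (use True in \<open>auto simp: indicator_def\<close>)
      next
        case False
        then show ?thesis using d(1)[OF j]
          by (intro always_eventually allI) (auto simp: indicator_def not_less intro: less_imp_le order_trans)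
      qed
    qed
    then show "(\<lambda>m. (\<Prod>j\<in>J. f j (x j) * k j l (x j) * indicator {0<..} (d m j - x j)) *
          (\<Prod>\<alpha>\<in>A. indicator {0<..} (x (fst \<alpha>) - x (snd \<alpha>))))
      \<longlonglongrightarrow> (\<Prod>j\<in>J. f j (x j) * k j l (x j) * indicator {0<..} (D j - x j)) *
          (\<Prod>\<alpha>\<in>A. indicator {0<..} (x (fst \<alpha>) - x (snd \<alpha>)))"
      by (intro tendsto_mult tendsto_prod tendsto_const)
  qed
  have meas: "(\<lambda>x. (\<Prod>j\<in>J. f j (x j) * k j l (x j) * indicator {0<..} (E j - x j)) *
          (\<Prod>\<alpha>\<in>A. indicator {0<..} (x (fst \<alpha>) - x (snd \<alpha>))) :: complex)
      \<in> borel_measurable (Pi\<^sub>M J (\<lambda>_. M))" for E :: "'i \<Rightarrow> real"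
  proof -
    have "(\<lambda>y. f j y * k j l y) \<in> borel_measurable M" if j: "j \<in> J" for j
    proof -
      interpret half_line_kernel M N "k j" B C2 by (rule kern[OF j])
      have "(\<lambda>x. k j l x) \<in> borel_measurable M"
        using measurable_compose[OF measurable_Pair1'[OF l] k_measurable] by simp
      then show ?thesis using f[OF j] by measurable
    qed
    then show ?thesis by (rule trunc_integrand_measurable[OF A])
  qed
  show "(\<lambda>x. (\<Prod>j\<in>J. f j (x j) * k j l (x j) * indicator {0<..} (D j - x j)) *
          (\<Prod>\<alpha>\<in>A. indicator {0<..} (x (fst \<alpha>) - x (snd \<alpha>))))
      \<in> borel_measurable (Pi\<^sub>M J (\<lambda>_. M))" by (rule meas)
  show "(\<lambda>x. (\<Prod>j\<in>J. f j (x j) * k j l (x j) * indicator {0<..} (d m j - x j)) *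
          (\<Prod>\<alpha>\<in>A. indicator {0<..} (x (fst \<alpha>) - x (snd \<alpha>))))
      \<in> borel_measurable (Pi\<^sub>M J (\<lambda>_. M))" for m by (rule meas)
qed

definition max_trunc :: "('i \<times> 'i) set \<Rightarrow> ('i \<Rightarrow> real \<Rightarrow> complex) \<Rightarrow> 'l \<Rightarrow> ennreal" where
  "max_trunc A f l = (SUP D\<in>{D. \<forall>j\<in>J. 0 < D j}. ennreal (norm (trunc A D f l)))"

text \<open>By left continuity in the truncation, the supremum may be taken over rational
  truncations, a countable family of measurable functions.\<close>

lemma max_trunc_measurable:
  assumes A: "A \<subseteq> J \<times> J" and f: "\<And>j. j \<in> J \<Longrightarrow> f j \<in> borel_measurable M"
    and loc: "\<And>j t. j \<in> J \<Longrightarrow> integrable M (\<lambda>x. if x < t then f j x else 0)"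
  shows "max_trunc A f \<in> borel_measurable N"
proof -
  \<comment> \<open>Extensional functions on the finite set \<open>J\<close>; leaving the values
    outside \<open>J\<close> free would destroy countability.\<close>
  let ?Q = "PiE J (\<lambda>_. \<rat> \<inter> {0<..}) :: ('i \<Rightarrow> real) set"
  have count: "countable ?Q"
    by (intro countable_PiE J countable_Int1 countable_rat)
  have [measurable]: "trunc A D f \<in> borel_measurable N" for D
    by (rule trunc_measurable[OF A f])
  have "(\<lambda>l. SUP D\<in>?Q. ennreal (norm (trunc A D f l))) \<in> borel_measurable N"
    by (intro borel_measurable_SUP count) measurable
  moreover have "max_trunc A f l = (SUP D\<in>?Q. ennreal (norm (trunc A D f l)))" if l: "l \<in> space N" for l
    unfolding max_trunc_def
  proof (rule antisym)
    show "(SUP D\<in>{D. \<forall>j\<in>J. 0 < D j}. ennreal (norm (trunc A D f l))) \<le> (SUP D\<in>?Q. ennreal (norm (trunc A D f l)))"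
    proof (rule SUP_least)
      fix D assume D: "D \<in> {D. \<forall>j\<in>J. (0::real) < D j}"
      \<comment> \<open>The shift by 2 keeps the lower end nonnegative, so the rational
        approximations are positive and admissible.\<close>
      have "\<exists>r. r \<in> \<rat> \<and> D j * (1 - 1 / real (m + 2)) < r \<and> r < D j" if "j \<in> J" for j m
      proof -
        have "D j * (1 - 1 / real (m + 2)) < D j * 1"
          using D that by (intro mult_strict_left_mono) auto
        then show ?thesis using Rats_dense_in_real by fastforce
      qed
      then obtain r where r: "\<And>j m. j \<in> J \<Longrightarrow> r j m \<in> \<rat> \<and> D j * (1 - 1 / real (m + 2)) < r j m \<and> r j m < D j"
        by metis
      define d where "d m = restrict (\<lambda>j. r j m) J" for m
      have pos: "0 < r j m" if "j \<in> J" for j m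
      proof -
        have "0 \<le> D j * (1 - 1 / real (m + 2))" using D that by (intro mult_nonneg_nonneg) auto
        then show ?thesis using r[OF that, of m] by linarith
      qed
      have dQ: "d m \<in> ?Q" for m unfolding d_def using r pos by auto
      have lim: "(\<lambda>m. d m j) \<longlonglongrightarrow> D j" if j: "j \<in> J" for j
      proof (rule tendsto_sandwich)
        show "\<forall>\<^sub>F m in sequentially. D j * (1 - 1 / real (m + 2)) \<le> d m j"
          using r j by (intro always_eventually) (auto simp: d_def less_imp_le)
        show "\<forall>\<^sub>F m in sequentially. d m j \<le> D j"
          using r j by (intro always_eventually) (auto simp: d_def less_imp_le)
        have "(\<lambda>m. 1 / real (m + 2)) \<longlonglongrightarrow> 0"
          using LIMSEQ_ignore_initial_segment[OF lim_1_over_n, of 2] by simp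
        then have "(\<lambda>m. D j * (1 - 1 / real (m + 2))) \<longlonglongrightarrow> D j * (1 - 0)"
          by (intro tendsto_intros)
        then show "(\<lambda>m. D j * (1 - 1 / real (m + 2))) \<longlonglongrightarrow> D j" by simp
      qed auto
      have "(\<lambda>m. trunc A (d m) f l) \<longlonglongrightarrow> trunc A D f l"
        by (rule trunc_tendsto[OF A f loc l _ lim]) (use r in \<open>auto simp: d_def\<close>)
      then have "(\<lambda>m. ennreal (norm (trunc A (d m) f l))) \<longlonglongrightarrow> ennreal (norm (trunc A D f l))"
        by (intro tendsto_ennrealI tendsto_norm)
      then show "ennreal (norm (trunc A D f l)) \<le> (SUP D\<in>?Q. ennreal (norm (trunc A D f l)))"
        by (rule LIMSEQ_le_const2) (intro exI[of _ 0] allI impI SUP_upper dQ)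
    qed
    show "(SUP D\<in>?Q. ennreal (norm (trunc A D f l))) \<le> (SUP D\<in>{D. \<forall>j\<in>J. 0 < D j}. ennreal (norm (trunc A D f l)))"
      by (rule SUP_subset_mono) (auto simp: PiE_def Pi_def)
  qed
  ultimately show ?thesis by (subst measurable_cong) auto
qed

text \<open>The endpoint p = 1: with integrable functions, bounded kernels suffice and no
  cancellation is used.\<close>

lemma trunc_trivial_bound:
  assumes A: "A \<subseteq> J \<times> J" and f: "\<And>j. j \<in> J \<Longrightarrow> integrable M (f j)" and l: "l \<in> space N"
  shows "norm (trunc A D f l) \<le> (\<Prod>j\<in>J. B * (\<integral>x. norm (f j x) \<partial>M))"
proof -
  have kB: "norm (k j l y) \<le> B" if "j \<in> J" "y \<in> space M" for j y
  proof -
    interpret half_line_kernel M N "k j" B C2 by (rule kern[OF that(1)])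
    show ?thesis by (rule k_bound[OF l that(2)])
  qed
  have bd: "norm (\<Prod>\<alpha>\<in>A. indicator {0<..} (x (fst \<alpha>) - x (snd \<alpha>)) :: complex) \<le> 1" for x :: "'i \<Rightarrow> real"
    unfolding prod_norm[symmetric] by (intro prod_le_1) (auto simp: indicator_def)
  have "norm (trunc A D f l) \<le> (\<integral>x. (\<Prod>j\<in>J. B * norm (f j (x j))) \<partial>Pi\<^sub>M J (\<lambda>_. M))"
    unfolding trunc_def
  proof (rule order_trans[OF integral_norm_bound integral_mono'])
    show "integrable (Pi\<^sub>M J (\<lambda>_. M)) (\<lambda>x. \<Prod>j\<in>J. B * norm (f j (x j)))"
      by (rule prod.product_integrable_prod[OF J(1), where f = "\<lambda>j y. B * norm (f j y)"])
         (use f in auto)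
    fix x assume x: "x \<in> space (Pi\<^sub>M J (\<lambda>_. M))"
    have xj: "x j \<in> space M" if "j \<in> J" for j using x that by (auto simp: space_PiM)
    have B0: "0 \<le> B" using J kB xj norm_ge_zero order_trans by (metis ex_in_conv)
    show "0 \<le> (\<Prod>j\<in>J. B * norm (f j (x j)))" using B0 by (intro prod_nonneg) auto
    have "norm (\<Prod>j\<in>J. f j (x j) * k j l (x j) * indicator {0<..} (D j - x j)) \<le> (\<Prod>j\<in>J. B * norm (f j (x j)))"
      unfolding prod_norm[symmetric]
    proof (intro prod_mono conjI norm_ge_zero)
      fix j assume j: "j \<in> J"
      have "norm (f j (x j) * k j l (x j) * indicator {0<..} (D j - x j)) \<le> norm (f j (x j)) * norm (k j l (x j))"
        by (auto simp: indicator_def norm_mult)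
      also have "\<dots> \<le> norm (f j (x j)) * B"
        using kB[OF j xj[OF j]] by (intro mult_left_mono) auto
      finally show "norm (f j (x j) * k j l (x j) * indicator {0<..} (D j - x j)) \<le> B * norm (f j (x j))"
        by (simp add: mult.commute)
    qed
    from mult_mono[OF this bd[of x]]
    show "norm ((\<Prod>j\<in>J. f j (x j) * k j l (x j) * indicator {0<..} (D j - x j)) *
          (\<Prod>\<alpha>\<in>A. indicator {0<..} (x (fst \<alpha>) - x (snd \<alpha>)))) \<le> (\<Prod>j\<in>J. B * norm (f j (x j)))"
      using B0 by (simp add: norm_mult prod_nonneg)
  qed
  also have "\<dots> = (\<Prod>j\<in>J. \<integral>y. B * norm (f j y) \<partial>M)"
    by (rule prod.product_integral_prod[OF J(1)]) (use f in auto)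
  finally show ?thesis by simp
qed

end

section \<open>Lebesgue measure on the half-line\<close>

lemma complete_measure_lebesgue_on:
  fixes S :: "'a::euclidean_space set"
  assumes S: "S \<in> sets lebesgue" shows "complete_measure (lebesgue_on S)"
proof
  fix A B :: "'a set" assume AB: "A \<subseteq> B" "B \<in> null_sets (lebesgue_on S)"
  then have "B \<subseteq> S" "B \<in> null_sets lebesgue"
    using S by (auto simp: null_sets_restrict_space)
  then have "A \<in> null_sets lebesgue" by (intro completion.complete2[OF AB(1)])
  then show "A \<in> sets (lebesgue_on S)"
    using AB(1) \<open>B \<subseteq> S\<close> S by (auto simp: sets_restrict_space_iff)
qed

text \<open>Carries measurability from the Borel versions of the kernels back to the given
  kernels.\<close>

lemma (in complete_measure) measurable_cong_AE:
  assumes f: "f \<in> M \<rightarrow>\<^sub>M N" and ae: "AE x in M. f x = g x" and g: "\<And>x. x \<in> space M \<Longrightarrow> g x \<in> space N"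
  shows "g \<in> M \<rightarrow>\<^sub>M N"
proof (rule measurableI[OF g])
  fix S assume "S \<in> sets N"
  then have fS: "f -` S \<inter> space M \<in> sets M" using f by (intro measurable_sets)
  have "AE x in M. x \<in> f -` S \<inter> space M \<longleftrightarrow> x \<in> g -` S \<inter> space M"
    using ae by eventually_elim simp
  then show "g -` S \<inter> space M \<in> sets M"
    using fS by (rule in_sets_AE) (rule Int_lower2)
qed

lemma AE_lebesgue_on_iff:
  fixes S :: "'a::euclidean_space set"
  assumes "S \<in> sets lebesgue"
  shows "(AE x in lebesgue_on S. P x) \<longleftrightarrow> (AE x in lborel. x \<in> S \<longrightarrow> P x)"
proof -
  have "S \<inter> space lebesgue \<in> sets lebesgue" using assms by simp
  then show ?thesis by (simp only: AE_restrict_space_iff AE_completion_iff)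
qed

lemma half_line_measure_leb_pos: "half_line_measure leb_pos"
proof -
  have pos: "{0::real<..} \<in> sets lebesgue" by auto
  have "sigma_finite_measure (lebesgue :: real measure)"
  proof
    show "\<exists>A. countable A \<and> A \<subseteq> sets lebesgue \<and> \<Union> A = space (lebesgue :: real measure) \<and> (\<forall>a\<in>A. emeasure lebesgue a \<noteq> \<infinity>)"
    proof (intro exI[of _ "range (\<lambda>n::nat. {- real n..real n})"] conjI ballI)
      show "\<Union> (range (\<lambda>n::nat. {- real n..real n})) = space lebesgue"
      proof safe
        fix x :: real
        obtain n :: nat where "\<bar>x\<bar> \<le> real n" using real_arch_simple by blast
        then show "x \<in> \<Union> (range (\<lambda>n::nat. {- real n..real n}))" by (intro UN_I[of n]) auto
      qed simp
    qed auto
  qed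
  then interpret sigma_finite_measure leb_pos
    using pos by (rule sigma_finite_measure_restrict_space)
  show ?thesis
  proof
    show "(\<lambda>x. x) \<in> borel_measurable leb_pos"
      by (intro measurable_restrict_space1 measurable_completion) simp
    show "AE x in leb_pos. x \<noteq> c" for c
      using AE_lborel_singleton[of c] unfolding AE_lebesgue_on_iff[OF pos] by eventually_elim auto
    show "space leb_pos \<subseteq> {0<..}" by simp
    have "{x \<in> space leb_pos. x < c} = {0<..<c}" for c :: real by auto
    moreover have "emeasure leb_pos {0<..<c} = emeasure lebesgue {0<..<c}" for c :: real
      by (rule emeasure_restrict_space) auto
    ultimately show "emeasure leb_pos {x \<in> space leb_pos. x < c} < \<infinity>" for c
      by (cases "0 \<le> c") simp_all
  qed
qed

text \<open>Planar Lebesgue measurability is weaker than measurability for the product of the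
  one-dimensional sigma-algebras, which the Fubini arguments need. A Borel version agreeing on
  almost every section closes the gap, since each section enters only through integrals.\<close>

lemma ex_bounded_borel_version:
  fixes k :: "real \<Rightarrow> real \<Rightarrow> complex"
  assumes I: "I \<in> sets lebesgue"
    and k: "(\<lambda>(lam, x). k lam x) \<in> borel_measurable (lebesgue_on (I \<times> {0<..}))"
    and B: "\<And>lam x. lam \<in> I \<Longrightarrow> 0 < x \<Longrightarrow> norm (k lam x) \<le> B" "0 \<le> B"
  obtains k' where "(\<lambda>p. k' (fst p) (snd p)) \<in> borel_measurable (borel \<Otimes>\<^sub>M borel)"
    "\<And>lam x. norm (k' lam x) \<le> B"
    "AE lam in lebesgue_on I. AE x in leb_pos. k lam x = k' lam x"
proof -
  \<comment> \<open>Only the Borel part of \<open>I\<close> is kept, so that the strip is Borel; the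
    rest is contained in a null set of parameters.\<close>
  obtain I0 Z Z' where I0: "I = I0 \<union> Z" "Z \<subseteq> Z'" "Z' \<in> null_sets lborel" "I0 \<in> sets lborel"
    using I by (rule sets_completionE)
  let ?S = "I0 \<times> {0::real<..}"
  have Sb: "?S \<in> sets (borel :: (real \<times> real) measure)"
    using I0(4) by (intro borel_Times) auto
  then have S: "?S \<in> sets lebesgue" by simp
  define h where "h p = (if p \<in> ?S then k (fst p) (snd p) else 0)" for p
  have "(\<lambda>(lam, x). k lam x) \<in> borel_measurable (lebesgue_on ?S)"
    by (rule measurable_restrict_mono[OF k]) (use I0 in auto)
  then have h: "h \<in> borel_measurable lebesgue"
    using borel_measurable_if[OF S, of "\<lambda>p. k (fst p) (snd p)"]
    unfolding h_def[abs_def] case_prod_beta' by blast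
  have hB: "norm (h p) \<le> B" for p using B I0(1) by (auto simp: h_def)
  have "(\<lambda>p. Re (h p)) \<in> borel_measurable (completion lborel)"
    using h by (simp add: borel_measurable_complex_iff)
  then obtain u where u: "u \<in> borel_measurable lborel" "AE p in lborel. Re (h p) = u p"
    using completion_ex_borel_measurable_real by blast
  have "(\<lambda>p. Im (h p)) \<in> borel_measurable (completion lborel)"
    using h by (simp add: borel_measurable_complex_iff)
  then obtain v where v: "v \<in> borel_measurable lborel" "AE p in lborel. Im (h p) = v p"
    using completion_ex_borel_measurable_real by blast
  note [measurable] = u(1) v(1)
  \<comment> \<open>Discarding values above \<open>B\<close> makes the bound hold everywhere and
    changes nothing where the version agrees with \<open>h\<close>.\<close>
  define h' where "h' p = (if norm (Complex (u p) (v p)) \<le> B then Complex (u p) (v p) else 0)" for p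
  have cuv [measurable]: "(\<lambda>p. Complex (u p) (v p)) \<in> borel_measurable lborel"
    unfolding Complex_eq by measurable
  have h': "h' \<in> borel_measurable lborel" unfolding h'_def[abs_def] by measurable
  have ae: "AE p in lborel. h p = h' p"
    using u(2) v(2)
  proof eventually_elim
    case (elim p)
    then have "Complex (u p) (v p) = h p" by (simp add: complex_eq_iff)
    then show ?case using hB[of p] by (simp add: h'_def)
  qed
  have "AE p in lborel \<Otimes>\<^sub>M lborel. h p = h' p" using ae unfolding lborel_prod .
  then have ae2: "AE lam in lborel. AE x in lborel. h (lam, x) = h' (lam, x)"
    by (rule pair_sigma_finite.AE_pair[OF lborel_pair.pair_sigma_finite_axioms])
  have Zae: "AE lam in lborel. lam \<notin> Z'" using I0(3) by (rule AE_not_in)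
  show ?thesis
  proof (rule that[of "\<lambda>lam x. h' (lam, x)"])
    show "(\<lambda>p. h' (fst p, snd p)) \<in> borel_measurable (borel \<Otimes>\<^sub>M borel)"
      using h' by (simp add: borel_prod)
    show "norm (h' (lam, x)) \<le> B" for lam x using B(2) by (simp add: h'_def)
    show "AE lam in lebesgue_on I. AE x in leb_pos. k lam x = h' (lam, x)"
      unfolding AE_lebesgue_on_iff[OF I]
      using ae2 Zae
    proof eventually_elim
      case (elim lam)
      show ?case
      proof
        assume "lam \<in> I"
        then have lam: "lam \<in> I0" using elim(2) I0 by auto
        have "AE x in lborel. x \<in> {0<..} \<longrightarrow> k lam x = h' (lam, x)"
          using elim(1) by eventually_elim (use lam in \<open>auto simp: h_def\<close>)
        then show "AE x in leb_pos. k lam x = h' (lam, x)"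
          by (subst AE_lebesgue_on_iff) auto
      qed
    qed
  qed
qed

section \<open>Norms as integrals and the L2 hypothesis\<close>

lemma ennpowr_ennreal: "0 \<le> x \<Longrightarrow> ennpowr (ennreal x) a = ennreal (x powr a)"
  by (simp add: ennpowr_def)

lemma ennpowr_mono:
  assumes "x \<le> y" "0 < a" shows "ennpowr x a \<le> ennpowr y a"
proof (cases "y = \<infinity>")
  case False
  then have x: "x \<noteq> \<infinity>" using assms(1) by (metis infinity_ennreal_def top_unique)
  have "enn2real x \<le> enn2real y"
    by (rule enn2real_mono[OF assms(1)]) (use False in \<open>simp add: less_top[symmetric]\<close>)
  then show ?thesis using False x assms(2)
    by (simp add: ennpowr_def ennreal_leI powr_mono2)
qed (simp add: ennpowr_def)

lemma Lnormc_ennreal: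
  assumes "g \<in> borel_measurable M" "0 < r"
  shows "Lnormc M (ennreal r) g = ennpowr (\<integral>\<^sup>+x. ennreal (norm (g x) powr r) \<partial>M) (1 / r)"
  using assms by (simp add: Lnormc_def Lnorm_def ennpowr_ennreal)

lemma Lspace_ennreal:
  assumes f: "f \<in> Lspace M (ennreal r)" and r: "0 < r"
  shows "f \<in> borel_measurable M" "integrable M (\<lambda>x. norm (f x) powr r)"
    "Lnormc M (ennreal r) f = ennreal ((\<integral>x. norm (f x) powr r \<partial>M) powr (1 / r))"
proof -
  show fm [measurable]: "f \<in> borel_measurable M" using f by (simp add: Lspace_def)
  have "ennpowr (\<integral>\<^sup>+x. ennreal (norm (f x) powr r) \<partial>M) (1 / r) < \<infinity>"
    using f Lnormc_ennreal[OF fm r] by (simp add: Lspace_def)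
  then have fin: "(\<integral>\<^sup>+x. ennreal (norm (f x) powr r) \<partial>M) < \<infinity>"
    by (cases "(\<integral>\<^sup>+x. ennreal (norm (f x) powr r) \<partial>M) = \<infinity>")
       (simp_all add: ennpowr_def less_top[symmetric])
  show int: "integrable M (\<lambda>x. norm (f x) powr r)"
    by (rule integrableI_bounded) (use fin in auto)
  show "Lnormc M (ennreal r) f = ennreal ((\<integral>x. norm (f x) powr r \<partial>M) powr (1 / r))"
    unfolding Lnormc_ennreal[OF fm r]
    by (subst nn_integral_eq_integral[OF int]) (auto simp: ennpowr_ennreal integral_nonneg_AE)
qed

text \<open>Truncation to the compact sets [1/(m+1), m+1] exhausts the half-line. The images
  converge for each \<open>l\<close> by dominated convergence, with bounded kernel and integrable
  \<open>f\<close>, and Fatou's lemma passes the L2 bound to the limit.\<close>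

lemma kernel_L2_bound_integrable:
  fixes k :: "'l \<Rightarrow> real \<Rightarrow> complex"
  assumes k [measurable]: "(\<lambda>p. k (fst p) (snd p)) \<in> borel_measurable (N \<Otimes>\<^sub>M leb_pos)"
    and kB: "\<And>l x. norm (k l x) \<le> B" and C2: "0 < C2"
    and H: "\<And>g. g \<in> Lspace leb_pos (ennreal 2) \<Longrightarrow> compactly_supported g \<Longrightarrow>
      (\<integral>\<^sup>+l. ennreal ((norm (\<integral>x. k l x * g x \<partial>leb_pos))\<^sup>2) \<partial>N) \<le> ennreal C2 * (\<integral>\<^sup>+x. ennreal ((norm (g x))\<^sup>2) \<partial>leb_pos)"
    and f: "integrable leb_pos f"
  shows "(\<integral>\<^sup>+l. ennreal ((norm (\<integral>x. k l x * f x \<partial>leb_pos))\<^sup>2) \<partial>N) \<le> ennreal C2 * (\<integral>\<^sup>+x. ennreal ((norm (f x))\<^sup>2) \<partial>leb_pos)"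
proof (cases "(\<integral>\<^sup>+x. ennreal ((norm (f x))\<^sup>2) \<partial>leb_pos) = \<infinity>")
  case True
  then show ?thesis using C2 by (simp add: ennreal_mult_top)
next
  case False
  interpret half_line_measure leb_pos by (rule half_line_measure_leb_pos)
  have [measurable]: "f \<in> borel_measurable leb_pos" using f by simp
  define S where "S m = {1 / real (Suc m)..real (Suc m)}" for m
  define g where "g m x = (if x \<in> S m then f x else 0)" for m x
  have gm [measurable]: "g m \<in> borel_measurable leb_pos" for m
    unfolding g_def S_def atLeastAtMost_iff by measurable
  have le: "(\<integral>\<^sup>+x. ennreal ((norm (g m x))\<^sup>2) \<partial>leb_pos) \<le> (\<integral>\<^sup>+x. ennreal ((norm (f x))\<^sup>2) \<partial>leb_pos)" for m
    by (intro nn_integral_mono) (simp add: g_def)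
  have "g m \<in> Lspace leb_pos (ennreal 2)" for m
  proof -
    have "(\<integral>\<^sup>+x. ennreal (norm (g m x) powr 2) \<partial>leb_pos) \<noteq> \<infinity>"
      using le[of m] False by (auto simp: top_unique)
    then have "ennpowr (\<integral>\<^sup>+x. ennreal (norm (g m x) powr 2) \<partial>leb_pos) (1 / 2) < \<infinity>"
      by (simp add: ennpowr_def)
    then show ?thesis using Lnormc_ennreal[OF gm, of 2] gm by (simp add: Lspace_def)
  qed
  moreover have "compactly_supported (g m)" for m
    unfolding compactly_supported_def
  proof (intro exI[of _ "S m"] conjI ballI)
    show "S m \<subseteq> {0<..}"
    proof
      fix x assume "x \<in> S m"
      then have "1 / real (Suc m) \<le> x" by (simp add: S_def)
      moreover have "0 < 1 / real (Suc m)" by simp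
      ultimately show "x \<in> {0<..}" unfolding greaterThan_iff by linarith
    qed
  qed (auto simp: S_def g_def)
  ultimately have bound: "(\<integral>\<^sup>+l. ennreal ((norm (\<integral>x. k l x * g m x \<partial>leb_pos))\<^sup>2) \<partial>N)
      \<le> ennreal C2 * (\<integral>\<^sup>+x. ennreal ((norm (f x))\<^sup>2) \<partial>leb_pos)" for m
    by (intro order_trans[OF H mult_left_mono[OF le]]) auto
  have lim: "(\<lambda>m. \<integral>x. k l x * g m x \<partial>leb_pos) \<longlonglongrightarrow> (\<integral>x. k l x * f x \<partial>leb_pos)" if l: "l \<in> space N" for l
  proof (rule integral_dominated_convergence[where w = "\<lambda>x. B * norm (f x)"])
    have [measurable]: "k l \<in> borel_measurable leb_pos"
      using measurable_compose[OF measurable_Pair1'[OF l] k] by simp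
    show "(\<lambda>x. k l x * f x) \<in> borel_measurable leb_pos" by measurable
    show "(\<lambda>x. k l x * g m x) \<in> borel_measurable leb_pos" for m by measurable
    show "integrable leb_pos (\<lambda>x. B * norm (f x))" using f by simp
    show "AE x in leb_pos. norm (k l x * g m x) \<le> B * norm (f x)" for m
      using kB order_trans[OF norm_ge_zero kB]
      by (intro AE_I2) (auto simp: g_def norm_mult intro!: mult_right_mono)
    show "AE x in leb_pos. (\<lambda>m. k l x * g m x) \<longlonglongrightarrow> k l x * f x"
    proof (rule AE_I2)
      fix x :: real assume "x \<in> space leb_pos"
      then have x: "0 < x" by simp
      obtain a :: nat where "1 / x < real a" using reals_Archimedean2 by blast
      obtain b :: nat where "x < real b" using reals_Archimedean2 by blast
      have "x \<in> S m" if "max a b \<le> m" for m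
      proof -
        have "1 / x < real (Suc m)" "x < real (Suc m)" using that \<open>1 / x < real a\<close> \<open>x < real b\<close> by auto
        then have "1 / real (Suc m) < x" using x by (simp add: pos_divide_less_eq mult.commute del: of_nat_Suc)
        then show ?thesis using \<open>x < real (Suc m)\<close> by (simp add: S_def del: of_nat_Suc)
      qed
      then have "eventually (\<lambda>m. k l x * g m x = k l x * f x) sequentially"
        unfolding eventually_sequentially by (intro exI[of _ "max a b"]) (auto simp: g_def)
      then show "(\<lambda>m. k l x * g m x) \<longlonglongrightarrow> k l x * f x" by (rule tendsto_eventually)
    qed
  qed
  have meas: "(\<lambda>l. \<integral>x. k l x * g m x \<partial>leb_pos) \<in> borel_measurable N" for m
    by (rule borel_measurable_lebesgue_integral) (simp add: case_prod_beta')
  have "(\<integral>\<^sup>+l. ennreal ((norm (\<integral>x. k l x * f x \<partial>leb_pos))\<^sup>2) \<partial>N)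
    = (\<integral>\<^sup>+l. liminf (\<lambda>m. ennreal ((norm (\<integral>x. k l x * g m x \<partial>leb_pos))\<^sup>2)) \<partial>N)"
  proof (rule nn_integral_cong)
    fix l assume "l \<in> space N"
    then have "(\<lambda>m. ennreal ((norm (\<integral>x. k l x * g m x \<partial>leb_pos))\<^sup>2)) \<longlonglongrightarrow> ennreal ((norm (\<integral>x. k l x * f x \<partial>leb_pos))\<^sup>2)"
      by (intro tendsto_ennrealI tendsto_power tendsto_norm lim)
    then show "ennreal ((norm (\<integral>x. k l x * f x \<partial>leb_pos))\<^sup>2) = liminf (\<lambda>m. ennreal ((norm (\<integral>x. k l x * g m x \<partial>leb_pos))\<^sup>2))"
      by (intro lim_imp_Liminf[symmetric]) auto
  qed
  also have "\<dots> \<le> liminf (\<lambda>m. \<integral>\<^sup>+l. ennreal ((norm (\<integral>x. k l x * g m x \<partial>leb_pos))\<^sup>2) \<partial>N)"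
    using meas by (intro nn_integral_liminf) measurable
  also have "\<dots> \<le> ennreal C2 * (\<integral>\<^sup>+x. ennreal ((norm (f x))\<^sup>2) \<partial>leb_pos)"
    by (intro Liminf_le) (auto simp: bound)
  finally show ?thesis .
qed

text \<open>For almost every parameter the two kernels give the same integral against
  \<open>g\<close>; the rest turns the norm inequality into one between squared integrals.\<close>

lemma kernel_L2_transfer:
  assumes I: "I \<in> sets lebesgue"
    and K: "Lnormc (lebesgue_on I) 2 (kernel_op k g) \<le> ennreal C * Lnormc leb_pos 2 g"
    and g: "g \<in> Lspace leb_pos (ennreal 2)"
    and k': "\<And>lam. (\<lambda>x. k' lam x) \<in> borel_measurable leb_pos"
    and ae: "AE lam in lebesgue_on I. AE x in leb_pos. k lam x = k' lam x"
  shows "(\<integral>\<^sup>+lam. ennreal ((norm (\<integral>x. k' lam x * g x \<partial>leb_pos))\<^sup>2) \<partial>lebesgue_on I)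
    \<le> ennreal (C\<^sup>2) * (\<integral>\<^sup>+x. ennreal ((norm (g x))\<^sup>2) \<partial>leb_pos)"
proof -
  interpret L: complete_measure leb_pos by (rule complete_measure_lebesgue_on) auto
  define X where "X = (\<integral>\<^sup>+lam. ennreal (norm (kernel_op k g lam) powr 2) \<partial>lebesgue_on I)"
  define Y where "Y = (\<integral>x. norm (g x) powr 2 \<partial>leb_pos)"
  note gL = Lspace_ennreal[OF g, simplified]
  have Y0: "0 \<le> Y" unfolding Y_def by (intro integral_nonneg_AE) auto
  have two: "(2::ennreal) = ennreal 2" by simp
  have bd: "Lnormc (lebesgue_on I) (ennreal 2) (kernel_op k g) \<le> ennreal C * ennreal (Y powr (1 / 2))"
    using K gL(3) unfolding two Y_def by simp
  \<comment> \<open>Finiteness rules out the default value for non-measurable functions, so the norm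
    is given by the integral.\<close>
  then have "Lnormc (lebesgue_on I) (ennreal 2) (kernel_op k g) \<noteq> \<infinity>"
    by (auto simp: ennreal_mult_eq_top_iff top_unique)
  then have "Lnormc (lebesgue_on I) (ennreal 2) (kernel_op k g) = ennpowr X (1 / 2)"
    by (auto simp: Lnormc_def Lnorm_def X_def ennpowr_ennreal split: if_splits)
  then have le: "ennpowr X (1 / 2) \<le> ennreal C * ennreal (Y powr (1 / 2))" using bd by simp
  have "X \<noteq> \<infinity>" using le by (auto simp: ennpowr_def ennreal_mult_eq_top_iff top_unique)
  then obtain x where x: "X = ennreal x" "0 \<le> x" by (cases X) auto
  \<comment> \<open>\<open>ennreal C\<close> is 0 for negative \<open>C\<close>; the absolute value
    covers both signs before squaring.\<close>
  have "ennreal (x powr (1 / 2)) \<le> ennreal (\<bar>C\<bar> * Y powr (1 / 2))"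
  proof -
    have "ennreal C * ennreal (Y powr (1 / 2)) \<le> ennreal \<bar>C\<bar> * ennreal (Y powr (1 / 2))"
      by (intro mult_right_mono ennreal_leI) auto
    then show ?thesis using le x by (simp add: ennpowr_ennreal ennreal_mult)
  qed
  then have "sqrt x \<le> \<bar>C\<bar> * sqrt Y" using x Y0 by (simp add: ennreal_le_iff powr_half_sqrt)
  then have "(sqrt x)\<^sup>2 \<le> (\<bar>C\<bar> * sqrt Y)\<^sup>2" using x by (intro power_mono) auto
  then have "x \<le> C\<^sup>2 * Y" using x Y0 by (simp add: power_mult_distrib)
  then have "X \<le> ennreal (C\<^sup>2) * ennreal Y" using x Y0 by (simp add: ennreal_mult[symmetric] ennreal_leI)
  also have "ennreal Y = (\<integral>\<^sup>+x. ennreal (norm (g x) powr 2) \<partial>leb_pos)"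
    unfolding Y_def using gL(2) by (subst nn_integral_eq_integral) auto
  also have "X = (\<integral>\<^sup>+lam. ennreal ((norm (\<integral>x. k' lam x * g x \<partial>leb_pos))\<^sup>2) \<partial>lebesgue_on I)"
    unfolding X_def
  proof (rule nn_integral_cong_AE)
    show "AE lam in lebesgue_on I. ennreal (norm (kernel_op k g lam) powr 2) = ennreal ((norm (\<integral>x. k' lam x * g x \<partial>leb_pos))\<^sup>2)"
      using ae
    proof eventually_elim
      case (elim lam)
      have m': "(\<lambda>x. k' lam x * g x) \<in> borel_measurable leb_pos" using k'[of lam] gL(1) by measurable
      have e: "AE x in leb_pos. k' lam x * g x = k lam x * g x" using elim by eventually_elim simp
      have "kernel_op k g lam = (\<integral>x. k' lam x * g x \<partial>leb_pos)"
        unfolding kernel_op_def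
        using L.measurable_cong_AE[OF m' e] m' e
        by (intro integral_cong_AE) (auto elim: eventually_mono)
      then show ?case by simp
    qed
  qed
  finally show ?thesis by simp
qed

section \<open>Exponents in the extended reals and the passage to the given kernels\<close>

lemma ennreal_eq_of_inverse_eq:
  assumes "inverse s = ennreal a" "0 < a" shows "s = ennreal (1 / a)"
proof (cases s)
  case (real t)
  show ?thesis
  proof (cases "t = 0")
    case False
    then have "0 < t" using real by simp
    then have "ennreal (inverse t) = ennreal a" using assms(1) real by (simp add: inverse_ennreal)
    then have "inverse t = a" using assms(2) \<open>0 < t\<close> by (subst (asm) ennreal_inj) auto
    then show ?thesis using real by (simp add: divide_inverse flip: \<open>inverse t = a\<close>)
  qed (use assms real in simp)
qed (use assms in simp)

lemma inverse_conjugate_exponent: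
  fixes q :: ennreal
  assumes "inverse q + inverse (ennreal p) = 1" and p: "1 \<le> p"
  shows "inverse q = ennreal (1 - 1 / p)"
proof -
  have ip: "inverse (ennreal p) = ennreal (1 / p)" using p by (simp add: inverse_ennreal divide_inverse)
  have "inverse q \<noteq> top" using assms by auto
  then obtain r where r: "inverse q = ennreal r" "0 \<le> r" by (cases "inverse q") auto
  have "ennreal (r + 1 / p) = ennreal 1" using assms(1) r p by (simp add: ip)
  then have "r + 1 / p = 1" using r p by (subst (asm) ennreal_inj) auto
  then have "r = 1 - 1 / p" by simp
  then show ?thesis using r by simp
qed

theorem theorem5p2:
  fixes n :: nat and I :: "real set"
    and k :: "nat \<Rightarrow> real \<Rightarrow> real \<Rightarrow> complex"
    and C :: "nat \<Rightarrow> real" and A :: "(nat \<times> nat) set"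
    and p :: real and q s :: ennreal
  assumes n: "2 \<le> n"
    and I: "I \<in> sets lebesgue"
    and k_measurable: "\<And>i. i \<in> {1..n} \<Longrightarrow>
          (\<lambda>(lam, x). k i lam x) \<in> borel_measurable (lebesgue_on (I \<times> {0<..}))"
    and k_bounded: "\<And>i. i \<in> {1..n} \<Longrightarrow>
          \<exists>B. \<forall>lam\<in>I. \<forall>x>0. norm (k i lam x) \<le> B"
    and K_L2: "\<And>i f. i \<in> {1..n} \<Longrightarrow> f \<in> Lspace leb_pos 2 \<Longrightarrow> compactly_supported f \<Longrightarrow>
          Lnormc (lebesgue_on I) 2 (kernel_op (k i) f) \<le> ennreal (C i) * Lnormc leb_pos 2 f"
    and A: "A \<subseteq> {1..n} \<times> {1..n}"
    and p: "1 \<le> p" "p < 2"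
    and q: "inverse q + inverse (ennreal p) = 1"
    and s: "inverse s = of_nat n * inverse q"
  shows "\<exists>Cn::real. \<forall>f. (\<forall>i\<in>{1..n}. f i \<in> Lspace leb_pos (ennreal p)) \<longrightarrow>
          Lnorm (lebesgue_on I) s (max_op n k A f)
            \<le> ennreal Cn * (\<Prod>i=1..n. Lnormc leb_pos (ennreal p) (f i))"
proof -
  let ?N = "lebesgue_on I" and ?J = "{1..n}"
  interpret M: half_line_measure leb_pos by (rule half_line_measure_leb_pos)
  interpret N: complete_measure ?N by (rule complete_measure_lebesgue_on[OF I])
  interpret L: complete_measure leb_pos by (rule complete_measure_lebesgue_on) auto
  have "\<forall>i\<in>?J. \<exists>b. \<forall>lam\<in>I. \<forall>x>0. norm (k i lam x) \<le> b" using k_bounded by blast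
  then obtain b where b: "\<And>i lam x. i \<in> ?J \<Longrightarrow> lam \<in> I \<Longrightarrow> 0 < x \<Longrightarrow> norm (k i lam x) \<le> b i"
    unfolding bchoice_iff by blast
  \<comment> \<open>Single constants for all kernels; the summand 1 makes them positive.
    \<open>C2\<close> collects squares because it compares squared norms.\<close>
  define B where "B = 1 + (\<Sum>i\<in>?J. \<bar>b i\<bar>)"
  define C2 where "C2 = 1 + (\<Sum>i\<in>?J. (C i)\<^sup>2)"
  have B: "0 < B" unfolding B_def by (intro add_pos_nonneg sum_nonneg) auto
  have C2: "0 < C2" unfolding C2_def by (intro add_pos_nonneg sum_nonneg) auto
  have kB: "norm (k i lam x) \<le> B" if "i \<in> ?J" "lam \<in> I" "0 < x" for i lam x
  proof -
    have "\<bar>b i\<bar> \<le> (\<Sum>i\<in>?J. \<bar>b i\<bar>)" using that(1) by (intro member_le_sum) auto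
    then show ?thesis using b[OF that] unfolding B_def by linarith
  qed
  have CC: "(C i)\<^sup>2 \<le> C2" if "i \<in> ?J" for i
  proof -
    have "(C i)\<^sup>2 \<le> (\<Sum>i\<in>?J. (C i)\<^sup>2)" using that by (intro member_le_sum) auto
    then show ?thesis unfolding C2_def by linarith
  qed
  have "\<forall>i\<in>?J. \<exists>k'. (\<lambda>p. k' (fst p) (snd p)) \<in> borel_measurable (borel \<Otimes>\<^sub>M borel) \<and>
    (\<forall>lam x. norm (k' lam x) \<le> B) \<and> (AE lam in ?N. AE x in leb_pos. k i lam x = k' lam x)"
  proof
    fix i assume i: "i \<in> ?J"
    show "\<exists>k'. (\<lambda>p. k' (fst p) (snd p)) \<in> borel_measurable (borel \<Otimes>\<^sub>M borel) \<and>
      (\<forall>lam x. norm (k' lam x) \<le> B) \<and> (AE lam in ?N. AE x in leb_pos. k i lam x = k' lam x)"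
      by (rule ex_bounded_borel_version[OF I k_measurable[OF i] kB[OF i]]) (use B in auto)
  qed
  then obtain k' where k': "\<And>i. i \<in> ?J \<Longrightarrow> (\<lambda>p. k' i (fst p) (snd p)) \<in> borel_measurable (borel \<Otimes>\<^sub>M borel)"
    "\<And>i lam x. i \<in> ?J \<Longrightarrow> norm (k' i lam x) \<le> B"
    "\<And>i. i \<in> ?J \<Longrightarrow> AE lam in ?N. AE x in leb_pos. k i lam x = k' i lam x"
    unfolding bchoice_iff by blast
  have k'_sect: "(\<lambda>x. k' i lam x) \<in> borel_measurable leb_pos" if "i \<in> ?J" for i lam
    using measurable_compose[OF measurable_Pair[OF measurable_const M.id_measurable] k'(1)[OF that]] by simp
  have k'_joint: "(\<lambda>p. k' i (fst p) (snd p)) \<in> borel_measurable (?N \<Otimes>\<^sub>M leb_pos)" if "i \<in> ?J" for i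
  proof -
    have "(\<lambda>x. x) \<in> ?N \<rightarrow>\<^sub>M borel"
      by (intro measurable_restrict_space1 measurable_completion) simp
    then have "(\<lambda>p. (fst p, snd p)) \<in> ?N \<Otimes>\<^sub>M leb_pos \<rightarrow>\<^sub>M borel \<Otimes>\<^sub>M borel"
      by (intro measurable_Pair measurable_compose[OF measurable_fst] measurable_compose[OF measurable_snd] M.id_measurable)
    from measurable_compose[OF this k'(1)[OF that]] show ?thesis by simp
  qed
  have two: "(2::ennreal) = ennreal 2" by simp
  interpret F: kernel_family leb_pos ?N k' B C2 ?J
  proof (intro kernel_family.intro half_line_measure_leb_pos kernel_family_axioms.intro)
    fix j assume j: "j \<in> ?J"
    show "half_line_kernel leb_pos ?N (k' j) B C2"
    proof (intro half_line_kernel.intro half_line_measure_leb_pos bounded_kernel.intro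
        M.sigma_finite_measure_axioms bounded_kernel_axioms.intro B C2 k'_joint[OF j] k'(2)[OF j])
      fix f :: "real \<Rightarrow> complex" assume f: "integrable leb_pos f"
      show "(\<integral>\<^sup>+l. ennreal ((norm (\<integral>x. k' j l x * f x \<partial>leb_pos))\<^sup>2) \<partial>?N)
        \<le> ennreal C2 * (\<integral>\<^sup>+x. ennreal ((norm (f x))\<^sup>2) \<partial>leb_pos)"
      proof (rule kernel_L2_bound_integrable[OF k'_joint[OF j] k'(2)[OF j] C2 _ f])
        fix g assume g: "g \<in> Lspace leb_pos (ennreal 2)" "compactly_supported g"
        have "(\<integral>\<^sup>+l. ennreal ((norm (\<integral>x. k' j l x * g x \<partial>leb_pos))\<^sup>2) \<partial>?N)
          \<le> ennreal ((C j)\<^sup>2) * (\<integral>\<^sup>+x. ennreal ((norm (g x))\<^sup>2) \<partial>leb_pos)"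
          using kernel_L2_transfer[OF I K_L2[OF j g(1)[folded two] g(2)] g(1) k'_sect[OF j] k'(3)[OF j]] .
        also have "\<dots> \<le> ennreal C2 * (\<integral>\<^sup>+x. ennreal ((norm (g x))\<^sup>2) \<partial>leb_pos)"
          using CC[OF j] by (intro mult_right_mono ennreal_leI) auto
        finally show "(\<integral>\<^sup>+l. ennreal ((norm (\<integral>x. k' j l x * g x \<partial>leb_pos))\<^sup>2) \<partial>?N)
          \<le> ennreal C2 * (\<integral>\<^sup>+x. ennreal ((norm (g x))\<^sup>2) \<partial>leb_pos)" .
      qed
    qed
  qed (use n in auto)
  have card: "card ?J = n" by simp
  \<comment> \<open>The exceptional set comes from the kernels alone, so one null set serves all
    \<open>D\<close> at once, as the uncountable supremum requires.\<close>
  have trunc_eq: "AE lam in ?N. \<forall>D. trunc_op n k A D f lam = F.trunc A D f lam"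
    if f: "\<And>j. j \<in> ?J \<Longrightarrow> f j \<in> borel_measurable leb_pos" for f
  proof -
    have "AE lam in ?N. \<forall>j\<in>?J. AE x in leb_pos. k j lam x = k' j lam x"
      by (intro AE_finite_allI k'(3)) auto
    then show ?thesis
    proof eventually_elim
      case (elim lam)
      let ?P = "Pi\<^sub>M ?J (\<lambda>_. leb_pos)"
      have k_sect: "(\<lambda>x. k j lam x) \<in> borel_measurable leb_pos" if j: "j \<in> ?J" for j
      proof (rule L.measurable_cong_AE[OF k'_sect[OF j, of lam]])
        show "AE x in leb_pos. k' j lam x = k j lam x" using bspec[OF elim j] by eventually_elim simp
      qed simp
      have "AE x in ?P. \<forall>j\<in>?J. k j lam (x j) = k' j lam (x j)"
        by (intro AE_finite_allI M.AE_PiM_component_finite) (use elim in auto)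
      then have ae: "AE x in ?P. (\<Prod>j\<in>?J. f j (x j) * k j lam (x j) * indicator {0<..} (D j - x j)) *
          (\<Prod>\<alpha>\<in>A. indicator {0<..} (x (fst \<alpha>) - x (snd \<alpha>))) =
          (\<Prod>j\<in>?J. f j (x j) * k' j lam (x j) * indicator {0<..} (D j - x j)) *
          (\<Prod>\<alpha>\<in>A. indicator {0<..} (x (fst \<alpha>) - x (snd \<alpha>)))" for D
      proof eventually_elim
        case (elim x)
        then have "(\<Prod>j\<in>?J. f j (x j) * k j lam (x j) * indicator {0<..} (D j - x j)) =
          (\<Prod>j\<in>?J. f j (x j) * k' j lam (x j) * indicator {0<..} (D j - x j))"
          by (intro prod.cong) auto
        then show ?case by simp
      qed
      have m: "(\<lambda>y. f j y * k j lam y) \<in> borel_measurable leb_pos" "(\<lambda>y. f j y * k' j lam y) \<in> borel_measurable leb_pos"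
        if "j \<in> ?J" for j
        using f[OF that] k_sect[OF that] k'_sect[OF that, of lam] by measurable
      show ?case
        unfolding trunc_op_def F.trunc_def
        by (intro allI integral_cong_AE ae M.trunc_integrand_measurable[OF A m(1)] M.trunc_integrand_measurable[OF A m(2)])
    qed
  qed
  have max_eq: "AE lam in ?N. F.max_trunc A f lam = max_op n k A f lam"
    if f: "\<And>j. j \<in> ?J \<Longrightarrow> f j \<in> borel_measurable leb_pos" for f
  proof -
    have "AE lam in ?N. \<forall>D. trunc_op n k A D f lam = F.trunc A D f lam" by (rule trunc_eq) (rule f)
    then show ?thesis by eventually_elim (simp only: max_op_def F.max_trunc_def)
  qed
  \<comment> \<open>Part of the claim, since \<open>Lnorm\<close> is infinite on functions that are
    not measurable.\<close>
  have max_meas: "max_op n k A f \<in> borel_measurable ?N"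
    if f: "\<And>j. j \<in> ?J \<Longrightarrow> f j \<in> borel_measurable leb_pos"
      and loc: "\<And>j t. j \<in> ?J \<Longrightarrow> integrable leb_pos (\<lambda>x. if x < t then f j x else 0)" for f
  proof (rule N.measurable_cong_AE)
    show "F.max_trunc A f \<in> borel_measurable ?N" by (rule F.max_trunc_measurable[OF A]) (rule f, assumption, rule loc)
    show "AE lam in ?N. F.max_trunc A f lam = max_op n k A f lam" by (rule max_eq) (rule f)
  qed simp
  have iq: "inverse q = ennreal (1 - 1 / p)" by (rule inverse_conjugate_exponent[OF q p(1)])
  show ?thesis
  proof (cases "p = 1")
    case True
    then have "inverse q = 0" using iq by simp
    \<comment> \<open>At p = 1 the reciprocals of q and s are both 0, so the left-hand norm is an
      essential supremum.\<close>
    then have s_top: "s = \<infinity>" using s by simp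
    show ?thesis
    proof (intro exI[of _ "B ^ n"] allI impI)
      fix f assume "\<forall>i\<in>?J. f i \<in> Lspace leb_pos (ennreal p)"
      then have f: "f j \<in> Lspace leb_pos (ennreal 1)" if "j \<in> ?J" for j using that True by simp
      have fm: "f j \<in> borel_measurable leb_pos" if "j \<in> ?J" for j
        by (rule Lspace_ennreal(1)[OF f[OF that]]) simp
      have fi: "integrable leb_pos (f j)" if "j \<in> ?J" for j
        using Lspace_ennreal(2)[OF f[OF that]] fm[OF that] by (simp add: integrable_norm_iff)
      have fn: "Lnormc leb_pos (ennreal p) (f j) = ennreal (\<integral>x. norm (f j x) \<partial>leb_pos)" if "j \<in> ?J" for j
        using Lspace_ennreal(3)[OF f[OF that]] True by (simp add: integral_nonneg_AE)
      have loc: "integrable leb_pos (\<lambda>x. if x < t then f j x else 0)" if "j \<in> ?J" for j t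
        by (intro integrable_if fi that) measurable
      have meas: "max_op n k A f \<in> borel_measurable ?N" by (rule max_meas) (rule fm, assumption, rule loc)
      have eq: "AE lam in ?N. F.max_trunc A f lam = max_op n k A f lam" by (rule max_eq) (rule fm)
      have "AE lam in ?N. max_op n k A f lam \<le> ennreal (\<Prod>j\<in>?J. B * (\<integral>x. norm (f j x) \<partial>leb_pos))"
        using eq AE_space
      proof eventually_elim
        case (elim lam)
        show ?case
          unfolding elim(1)[symmetric] F.max_trunc_def
          by (intro SUP_least ennreal_leI F.trunc_trivial_bound[OF A fi elim(2)])
      qed
      then have "Lnorm ?N s (max_op n k A f) \<le> ennreal (\<Prod>j\<in>?J. B * (\<integral>x. norm (f j x) \<partial>leb_pos))"
        using meas by (simp add: Lnorm_def s_top esssup_I)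
      also have "\<dots> = ennreal (B ^ n) * (\<Prod>j\<in>?J. ennreal (\<integral>x. norm (f j x) \<partial>leb_pos))"
        using B by (simp add: prod.distrib ennreal_mult prod_nonneg prod_ennreal integral_nonneg_AE)
      also have "(\<Prod>j\<in>?J. ennreal (\<integral>x. norm (f j x) \<partial>leb_pos)) = (\<Prod>j\<in>?J. Lnormc leb_pos (ennreal p) (f j))"
        by (intro prod.cong) (simp_all add: fn)
      finally show "Lnorm ?N s (max_op n k A f) \<le> ennreal (B ^ n) * (\<Prod>j\<in>?J. Lnormc leb_pos (ennreal p) (f j))" .
    qed
  next
    case False
    then have p1: "1 < p" using p by simp
    \<comment> \<open>The finite conjugate exponent as a real number; it exceeds 2 exactly because p
      < 2.\<close>
    define r where "r = p / (p - 1)"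
    have r: "2 < r" using p p1 by (simp add: r_def less_divide_eq)
    have pr: "p = r / (r - 1)" using p1 by (simp add: r_def field_simps)
    have "1 - 1 / p = 1 / r" using p1 by (simp add: r_def field_simps)
    then have "inverse s = ennreal (real n / r)"
      using iq s r by (simp add: ennreal_of_nat_eq_real_of_nat ennreal_mult[symmetric])
    then have s_eq: "s = ennreal (r / n)"
      using ennreal_eq_of_inverse_eq[of s "real n / r"] n r by simp
    have rn: "0 < r / n" using r n by simp
    define K where "K = \<bar>F.max_const r\<bar> powr (1 / (r / n))"
    show ?thesis
    proof (intro exI[of _ K] allI impI)
      fix f assume "\<forall>i\<in>?J. f i \<in> Lspace leb_pos (ennreal p)"
      then have f: "f j \<in> Lspace leb_pos (ennreal p)" if "j \<in> ?J" for j using that by blast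
      have p0: "0 < p" using p by simp
      note fL = Lspace_ennreal[OF f p0]
      define N where "N j = (\<integral>x. norm (f j x) powr p \<partial>leb_pos)" for j
      have N0: "0 \<le> N j" for j unfolding N_def by (intro integral_nonneg_AE) auto
      have loc: "integrable leb_pos (\<lambda>x. if x < t then f j x else 0)" if "j \<in> ?J" for j t
      proof -
        interpret half_line_kernel leb_pos ?N "k' j" B C2 by (rule F.kern[OF that])
        show ?thesis by (rule integrable_initial[OF fL(1)[OF that] fL(2)[OF that] p(1)])
      qed
      have meas: "max_op n k A f \<in> borel_measurable ?N" by (rule max_meas) (rule fL(1), assumption, rule loc)
      have eq: "AE lam in ?N. F.max_trunc A f lam = max_op n k A f lam" by (rule max_eq) (rule fL(1))
      obtain G where G: "G \<in> borel_measurable ?N" "\<And>l. 0 \<le> G l"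
        "AE l in ?N. \<forall>D. (\<forall>j\<in>?J. 0 < D j) \<longrightarrow> norm (F.trunc A D f l) \<le> G l"
        "(\<integral>\<^sup>+l. ennreal (G l powr (r / n)) \<partial>?N) \<le> ennreal (F.max_const r * (\<Prod>j\<in>?J. N j powr ((r - 1) / n)))"
        using F.max_bound[where f = f, OF A r pr] fL(1,2) unfolding card N_def by blast
      have "AE lam in ?N. ennpowr (max_op n k A f lam) (r / n) \<le> ennreal (G lam powr (r / n))"
        using eq G(3)
      proof eventually_elim
        case (elim lam)
        have "max_op n k A f lam \<le> ennreal (G lam)"
          unfolding elim(1)[symmetric] F.max_trunc_def using elim(2) by (intro SUP_least ennreal_leI) auto
        from ennpowr_mono[OF this rn] show ?case using G(2) by (simp add: ennpowr_ennreal)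
      qed
      then have "(\<integral>\<^sup>+lam. ennpowr (max_op n k A f lam) (r / n) \<partial>?N) \<le> (\<integral>\<^sup>+l. ennreal (G l powr (r / n)) \<partial>?N)"
        by (rule nn_integral_mono_AE)
      also note G(4)
      also have "ennreal (F.max_const r * (\<Prod>j\<in>?J. N j powr ((r - 1) / n))) \<le> ennreal (\<bar>F.max_const r\<bar> * (\<Prod>j\<in>?J. N j powr ((r - 1) / n)))"
        by (intro ennreal_leI mult_right_mono prod_nonneg) auto
      finally have int: "(\<integral>\<^sup>+lam. ennpowr (max_op n k A f lam) (r / n) \<partial>?N)
        \<le> ennreal (\<bar>F.max_const r\<bar> * (\<Prod>j\<in>?J. N j powr ((r - 1) / n)))" .
      have "Lnorm ?N s (max_op n k A f) = ennpowr (\<integral>\<^sup>+lam. ennpowr (max_op n k A f lam) (r / n) \<partial>?N) (1 / (r / n))"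
        using meas rn unfolding Lnorm_def s_eq by simp
      also have "\<dots> \<le> ennpowr (ennreal (\<bar>F.max_const r\<bar> * (\<Prod>j\<in>?J. N j powr ((r - 1) / n)))) (1 / (r / n))"
        by (rule ennpowr_mono[OF int]) (use r n in simp)
      also have "\<dots> = ennreal ((\<bar>F.max_const r\<bar> * (\<Prod>j\<in>?J. N j powr ((r - 1) / n))) powr (1 / (r / n)))"
        by (intro ennpowr_ennreal mult_nonneg_nonneg prod_nonneg) auto
      also have "(\<bar>F.max_const r\<bar> * (\<Prod>j\<in>?J. N j powr ((r - 1) / n))) powr (1 / (r / n))
        = K * (\<Prod>j\<in>?J. N j powr (1 / p))"
      proof -
        \<comment> \<open>The outer power n/r turns (r - 1)/n into (r - 1)/r = 1/p, which restores
          the norms of the functions.\<close>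
        have e: "(r - 1) / n * (1 / (r / n)) = 1 / p" using n r by (simp add: pr)
        have "(\<Prod>j\<in>?J. N j powr ((r - 1) / n)) powr (1 / (r / n)) = (\<Prod>j\<in>?J. N j powr (1 / p))"
          unfolding prod_powr_distrib powr_powr e ..
        then show ?thesis unfolding K_def by (simp add: powr_mult prod_nonneg)
      qed
      also have "ennreal (K * (\<Prod>j\<in>?J. N j powr (1 / p))) = ennreal K * (\<Prod>j\<in>?J. ennreal (N j powr (1 / p)))"
        unfolding K_def by (simp add: ennreal_mult prod_nonneg prod_ennreal)
      also have "(\<Prod>j\<in>?J. ennreal (N j powr (1 / p))) = (\<Prod>j\<in>?J. Lnormc leb_pos (ennreal p) (f j))"
        by (intro prod.cong) (simp_all add: fL(3) N_def)
      finally show "Lnorm ?N s (max_op n k A f) \<le> ennreal K * (\<Prod>j\<in>?J. Lnormc leb_pos (ennreal p) (f j))" .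
    qed
  qed
qed

end
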